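(* Let $\mathrm{H}$ be a homology functor with coefficients in a field and let $\mathbb{X}=(X,f)$ be an $\mathbb{R}$-space all of whose levelsets $\mathbb{X}_q^q=f^{-1}(q)$, $q\in\mathbb{R}$, are $\mathrm{H}$-taut. Then each of the four functions $\mu=\mu^{/\backslash}_{\mathrm{H}\mathbb{X}},\ \mu^{\backslash\backslash}_{\mathrm{H}\mathbb{X}},\ \mu^{//}_{\mathrm{H}\mathbb{X}},\ \mu^{\backslash/}_{\mathrm{H}\mathbb{X}}$ is additive: for all $-\infty\le a<p<b<c<q<d\le+\infty$, $$\mu([a,b]\times[c,d])=\mu([a,p]\times[c,d])+\mu([p,b]\times[c,d]),$$ $$\mu([a,b]\times[c,d])=\mu([a,b]\times[c,q])+\mu([a,b]\times[q,d]).$$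
   Context: An $\mathbb{R}$-space is a pair $\mathbb{X}=(X,f)$ with $X$ a topological space and $f:X\to\mathbb{R}$ continuous. For $-\infty\le a\le b\le+\infty$ put $\mathbb{X}_a^b=f^{-1}([a,b])$, with $\mathbb{X}_{-\infty}^{-\infty}=\mathbb{X}_{+\infty}^{+\infty}=\emptyset$; also $\mathbb{X}^q=f^{-1}(-\infty,q]$ and $\mathbb{X}_q=f^{-1}[q,+\infty)$. Fix a field $\mathbf{k}$ and a homology theory $(\mathrm{H}_k)_k$ with coefficients in $\mathbf{k}$ (Eilenberg–Steenrod axioms). A homology functor $\mathrm{H}$ with field coefficients means $\mathrm{H}=\mathrm{H}_j(-;\mathbf{k})$ in some fixed degree $j$. A zigzag module $\mathbb{V}$ of length $n$ is a sequence of $\mathbf{k}$-vector spaces $V_1,\dots,V_n$ with, for each $i$, one linear map between $V_i$ and $V_{i+1}$ (either direction). The interval module on $[V_p,V_q]$ of the same shape has $\mathbf{k}$ at positions $p,\dots,q$, zero elsewhere, and identity maps between consecutive copies of $\mathbf{k}$. Every zigzag module is a direct sum of interval modules, uniquely up to reordering; the multiplicity $\langle[V_p,V_q]\mid\mathbb{V}\rangle\in\{0,1,2,\dots,\infty\}$ is the number of copies of that interval module (infinite cardinals are not distinguished). For $R=[a,b]\times[c,d]$ with $-\infty\le a<b<c<d\le+\infty$ let $\mathrm{H}\mathbb{X}_{\{a,b,c,d\}}$ be the zigzag module (maps induced by inclusions) $$\mathrm{H}(\mathbb{X}_a^a)\to\mathrm{H}(\mathbb{X}_a^b)\leftarrow\mathrm{H}(\mathbb{X}_b^b)\to\mathrm{H}(\mathbb{X}_b^c)\leftarrow\mathrm{H}(\mathbb{X}_c^c)\to\mathrm{H}(\mathbb{X}_c^d)\leftarrow\mathrm{H}(\mathbb{X}_d^d).$$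 The following are multiplicities in $\mathrm{H}\mathbb{X}_{\{a,b,c,d\}}$ of interval modules with the indicated first and last nonzero nodes: $\mu^{/\backslash}_{\mathrm{H}\mathbb{X}}(R)=\langle[\mathrm{H}(\mathbb{X}_b^b),\mathrm{H}(\mathbb{X}_c^c)]\rangle$, $\mu^{\backslash\backslash}_{\mathrm{H}\mathbb{X}}(R)=\langle[\mathrm{H}(\mathbb{X}_a^b),\mathrm{H}(\mathbb{X}_c^c)]\rangle$, $\mu^{//}_{\mathrm{H}\mathbb{X}}(R)=\langle[\mathrm{H}(\mathbb{X}_b^b),\mathrm{H}(\mathbb{X}_c^d)]\rangle$, $\mu^{\backslash/}_{\mathrm{H}\mathbb{X}}(R)=\langle[\mathrm{H}(\mathbb{X}_a^b),\mathrm{H}(\mathbb{X}_c^d)]\rangle$. Tautness. A normal neighborhood of $\mathbb{X}_q^q$ in $X$ is a neighborhood that contains a closed neighborhood. For a neighborhood $U$ of $\mathbb{X}_q^q$ put $A=U\cap\mathbb{X}^q$, $B=U\cap\mathbb{X}_q$. The levelset $\mathbb{X}_q^q$ is $\mathrm{H}$-taut if for every normal neighborhood $U$ (equivalently, some normal neighborhood $U$) the inclusion-induced maps $\mathrm{H}_k(A,\mathbb{X}_q^q)\to\mathrm{H}_k(U,B)$ are isomorphisms for all degrees $k$. *)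

theory Defs
  imports
    "HOL-Analysis.Homotopy"
    "HOL-Library.Extended_Nat"
    "HOL-Library.Extended_Real"
    "Jordan_Normal_Form.Missing_VectorSpace"
begin

section \<open>Vector spaces\<close>

definition linear_iso ::
  "'k ring \<Rightarrow> ('k, 'v) module \<Rightarrow> ('k, 'w) module \<Rightarrow> ('v \<Rightarrow> 'w) \<Rightarrow> bool" where
  "linear_iso K V W \<phi> \<longleftrightarrow> linear_map K V W \<phi> \<and> bij_betw \<phi> (carrier V) (carrier W)"

definition exact_at ::
  "('k, 'u) module \<Rightarrow> ('u \<Rightarrow> 'v) \<Rightarrow> ('k, 'v) module \<Rightarrow> ('v \<Rightarrow> 'w) \<Rightarrow> ('k, 'w) module \<Rightarrow> bool" where
  "exact_at U f V g W \<longleftrightarrow> f ` carrier U = {v \<in> carrier V. g v = \<zero>\<^bsub>W\<^esub>}"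

text \<open>A module record extends a ring record; the fields \<open>mult\<close> and \<open>one\<close> carry no meaning
  for a module and are filled arbitrarily below.\<close>

definition scalar_space :: "'k ring \<Rightarrow> ('k, 'k) module" where
  "scalar_space K = \<lparr>carrier = carrier K, mult = mult K, one = one K,
     zero = zero K, add = add K, smult = mult K\<rparr>"

definition zero_space :: "'k ring \<Rightarrow> ('k, 'k) module" where
  "zero_space K = (scalar_space K)\<lparr>carrier := {\<zero>\<^bsub>K\<^esub>}\<rparr>"

definition direct_sum_space :: "'i set \<Rightarrow> ('i \<Rightarrow> ('k, 'v) module) \<Rightarrow> ('k, 'i \<Rightarrow> 'v) module" where
  "direct_sum_space I M =
     \<lparr>carrier = {x \<in> (\<Pi>\<^sub>E i\<in>I. carrier (M i)). finite {i \<in> I. x i \<noteq> \<zero>\<^bsub>M i\<^esub>}},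
      mult = (\<lambda>x y. \<lambda>i\<in>I. \<zero>\<^bsub>M i\<^esub>),
      one = (\<lambda>i\<in>I. \<zero>\<^bsub>M i\<^esub>),
      zero = (\<lambda>i\<in>I. \<zero>\<^bsub>M i\<^esub>),
      add = (\<lambda>x y. \<lambda>i\<in>I. x i \<oplus>\<^bsub>M i\<^esub> y i),
      smult = (\<lambda>c x. \<lambda>i\<in>I. c \<odot>\<^bsub>M i\<^esub> x i)\<rparr>"


section \<open>Homology theories\<close>

text \<open>
  The Eilenberg--Steenrod axioms with coefficients in the field \<open>K\<close>, on the category of pairs
  \<open>(X, A)\<close>, \<open>A \<subseteq> topspace X\<close>, of spaces whose points lie in the type \<open>'u\<close>.  \<open>H k X A\<close> is
  \<open>H\<^sub>k(X, A)\<close>, \<open>ind k X A Y B f\<close> is the map induced by \<open>f : (X, A) \<rightarrow> (Y, B)\<close>, and \<open>bd k X A\<close> is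
  the connecting map \<open>H\<^sub>k(X, A) \<rightarrow> H\<^sub>k\<^sub>-\<^sub>1(A)\<close>.
  Inclusions are induced by \<open>id\<close>, and the subspace \<open>A\<close> of \<open>X\<close> is \<open>subtopology X A\<close>.
  That \<open>ind\<close> depends on \<open>f\<close> only through its values on \<open>topspace X\<close> is an instance of the
  homotopy axiom.  As in Eilenberg and Steenrod, the excised set is required to be open.
\<close>

locale homology_theory =
  fixes K :: "'k ring"
    and H :: "int \<Rightarrow> 'u topology \<Rightarrow> 'u set \<Rightarrow> ('k, 'v) module"
    and ind :: "int \<Rightarrow> 'u topology \<Rightarrow> 'u set \<Rightarrow> 'u topology \<Rightarrow> 'u set \<Rightarrow> ('u \<Rightarrow> 'u) \<Rightarrow> 'v \<Rightarrow> 'v"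
    and bd :: "int \<Rightarrow> 'u topology \<Rightarrow> 'u set \<Rightarrow> 'v \<Rightarrow> 'v"
  assumes field: "field K"
    and space: "A \<subseteq> topspace X \<Longrightarrow> vectorspace K (H k X A)"
    and ind_linear:
      "\<lbrakk>A \<subseteq> topspace X; B \<subseteq> topspace Y; continuous_map X Y f; f ` A \<subseteq> B\<rbrakk>
       \<Longrightarrow> linear_map K (H k X A) (H k Y B) (ind k X A Y B f)"
    and bd_linear:
      "A \<subseteq> topspace X \<Longrightarrow> linear_map K (H k X A) (H (k - 1) (subtopology X A) {}) (bd k X A)"
    and ind_id:
      "\<lbrakk>A \<subseteq> topspace X; x \<in> carrier (H k X A)\<rbrakk> \<Longrightarrow> ind k X A X A id x = x"
    and ind_comp:
      "\<lbrakk>A \<subseteq> topspace X; B \<subseteq> topspace Y; C \<subseteq> topspace Z;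
        continuous_map X Y f; f ` A \<subseteq> B; continuous_map Y Z g; g ` B \<subseteq> C;
        x \<in> carrier (H k X A)\<rbrakk>
       \<Longrightarrow> ind k X A Z C (g \<circ> f) x = ind k Y B Z C g (ind k X A Y B f x)"
    and bd_natural:
      "\<lbrakk>A \<subseteq> topspace X; B \<subseteq> topspace Y; continuous_map X Y f; f ` A \<subseteq> B;
        x \<in> carrier (H k X A)\<rbrakk>
       \<Longrightarrow> bd k Y B (ind k X A Y B f x)
           = ind (k - 1) (subtopology X A) {} (subtopology Y B) {} f (bd k X A x)"
    and homotopy:
      "\<lbrakk>A \<subseteq> topspace X; B \<subseteq> topspace Y; homotopic_with (\<lambda>h. h ` A \<subseteq> B) X Y f g;
        x \<in> carrier (H k X A)\<rbrakk>
       \<Longrightarrow> ind k X A Y B f x = ind k X A Y B g x"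
    and exact_space:
      "A \<subseteq> topspace X \<Longrightarrow>
       exact_at (H k (subtopology X A) {}) (ind k (subtopology X A) {} X {} id)
                (H k X {}) (ind k X {} X A id) (H k X A)"
    and exact_pair:
      "A \<subseteq> topspace X \<Longrightarrow>
       exact_at (H k X {}) (ind k X {} X A id)
                (H k X A) (bd k X A) (H (k - 1) (subtopology X A) {})"
    and exact_subspace:
      "A \<subseteq> topspace X \<Longrightarrow>
       exact_at (H k X A) (bd k X A) (H (k - 1) (subtopology X A) {})
                (ind (k - 1) (subtopology X A) {} X {} id) (H (k - 1) X {})"
    and excision:
      "\<lbrakk>A \<subseteq> topspace X; openin X U; X closure_of U \<subseteq> X interior_of A\<rbrakk>
       \<Longrightarrow> linear_iso K (H k (subtopology X (topspace X - U)) (A - U)) (H k X A)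
             (ind k (subtopology X (topspace X - U)) (A - U) X A id)"
    and dimension_nonzero:
      "\<lbrakk>topspace X = {pt}; k \<noteq> 0\<rbrakk> \<Longrightarrow> carrier (H k X {}) = {\<zero>\<^bsub>H k X {}\<^esub>}"
    and dimension_zero:
      "topspace X = {pt} \<Longrightarrow> \<exists>\<phi>. linear_iso K (H 0 X {}) (scalar_space K) \<phi>"


section \<open>Zigzag modules and their interval multiplicities\<close>

text \<open>
  The nodes are \<open>1, \<dots>, zz_len V\<close>.  The arrow \<open>i\<close>, for \<open>1 \<le> i < zz_len V\<close>, joins the nodes
  \<open>i\<close> and \<open>i + 1\<close> and points from \<open>i\<close> to \<open>i + 1\<close> iff \<open>zz_fwd V i\<close>.
\<close>

record ('k, 'v) zigzag =
  zz_len :: nat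
  zz_fwd :: "nat \<Rightarrow> bool"
  zz_space :: "nat \<Rightarrow> ('k, 'v) module"
  zz_map :: "nat \<Rightarrow> 'v \<Rightarrow> 'v"

definition arrow_src :: "(nat \<Rightarrow> bool) \<Rightarrow> nat \<Rightarrow> nat" where
  "arrow_src d i = (if d i then i else Suc i)"

definition arrow_tgt :: "(nat \<Rightarrow> bool) \<Rightarrow> nat \<Rightarrow> nat" where
  "arrow_tgt d i = (if d i then Suc i else i)"

definition zigzag_module :: "'k ring \<Rightarrow> ('k, 'v) zigzag \<Rightarrow> bool" where
  "zigzag_module K V \<longleftrightarrow>
     (\<forall>i\<in>{1..zz_len V}. vectorspace K (zz_space V i)) \<and>
     (\<forall>i\<in>{1..<zz_len V}. linear_map K (zz_space V (arrow_src (zz_fwd V) i))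
                           (zz_space V (arrow_tgt (zz_fwd V) i)) (zz_map V i))"

definition zigzag_isomorphic :: "'k ring \<Rightarrow> ('k, 'v) zigzag \<Rightarrow> ('k, 'w) zigzag \<Rightarrow> bool" where
  "zigzag_isomorphic K V W \<longleftrightarrow>
     zz_len V = zz_len W \<and> (\<forall>i\<in>{1..<zz_len V}. zz_fwd V i = zz_fwd W i) \<and>
     (\<exists>\<phi>. (\<forall>i\<in>{1..zz_len V}. linear_iso K (zz_space V i) (zz_space W i) (\<phi> i)) \<and>
          (\<forall>i\<in>{1..<zz_len V}. \<forall>x\<in>carrier (zz_space V (arrow_src (zz_fwd V) i)).
             \<phi> (arrow_tgt (zz_fwd V) i) (zz_map V i x)
             = zz_map W i (\<phi> (arrow_src (zz_fwd V) i) x)))"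

definition interval_module :: "'k ring \<Rightarrow> nat \<Rightarrow> (nat \<Rightarrow> bool) \<Rightarrow> nat \<Rightarrow> nat \<Rightarrow> ('k, 'k) zigzag" where
  "interval_module K n d p q =
     \<lparr>zz_len = n, zz_fwd = d,
      zz_space = (\<lambda>i. if p \<le> i \<and> i \<le> q then scalar_space K else zero_space K),
      zz_map = (\<lambda>i. if p \<le> i \<and> Suc i \<le> q then id else (\<lambda>_. \<zero>\<^bsub>K\<^esub>))\<rparr>"

definition zigzag_direct_sum ::
  "nat \<Rightarrow> (nat \<Rightarrow> bool) \<Rightarrow> 'i set \<Rightarrow> ('i \<Rightarrow> ('k, 'v) zigzag) \<Rightarrow> ('k, 'i \<Rightarrow> 'v) zigzag" where
  "zigzag_direct_sum n d I M =
     \<lparr>zz_len = n, zz_fwd = d,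
      zz_space = (\<lambda>j. direct_sum_space I (\<lambda>i. zz_space (M i) j)),
      zz_map = (\<lambda>j x. \<lambda>i\<in>I. zz_map (M i) j (x i))\<rparr>"

text \<open>
  A family of interval summands of \<open>V\<close> is indexed by a set \<open>S\<close> of triples \<open>(p, q, l)\<close>, where
  \<open>(p, q, l)\<close> stands for one copy of the interval module on the nodes \<open>p, \<dots>, q\<close> and the label \<open>l\<close>
  only separates copies.  Labels from the type of vectors suffice: a nonzero vector of the summand
  at node \<open>p\<close> can serve as its label.
\<close>

definition interval_decomposition :: "'k ring \<Rightarrow> ('k, 'v) zigzag \<Rightarrow> (nat \<times> nat \<times> 'v) set \<Rightarrow> bool" where
  "interval_decomposition K V S \<longleftrightarrow>
     (\<forall>(p, q, l)\<in>S. 1 \<le> p \<and> p \<le> q \<and> q \<le> zz_len V) \<and>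
     zigzag_isomorphic K V
       (zigzag_direct_sum (zz_len V) (zz_fwd V) S
         (\<lambda>(p, q, l). interval_module K (zz_len V) (zz_fwd V) p q))"

definition ecard :: "'a set \<Rightarrow> enat" where
  "ecard A = (if finite A then enat (card A) else \<infinity>)"

definition multiplicity :: "'k ring \<Rightarrow> ('k, 'v) zigzag \<Rightarrow> nat \<Rightarrow> nat \<Rightarrow> enat" where
  "multiplicity K V p q =
     (THE m. \<exists>S. interval_decomposition K V S \<and> m = ecard {l. (p, q, l) \<in> S})"


section \<open>Levelset zigzags of \<open>\<real>\<close>-spaces\<close>

definition slice :: "'u topology \<Rightarrow> ('u \<Rightarrow> real) \<Rightarrow> ereal \<Rightarrow> ereal \<Rightarrow> 'u set" where
  "slice X f a b = {x \<in> topspace X. a \<le> ereal (f x) \<and> ereal (f x) \<le> b}"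

lemma slice_infinite: "slice X f (-\<infinity>) (-\<infinity>) = {}" "slice X f \<infinity> \<infinity> = {}"
  by (auto simp: slice_def)

definition levelset_node ::
  "'u topology \<Rightarrow> ('u \<Rightarrow> real) \<Rightarrow> ereal \<Rightarrow> ereal \<Rightarrow> ereal \<Rightarrow> ereal \<Rightarrow> nat \<Rightarrow> 'u set" where
  "levelset_node X f a b c d i =
     [slice X f a a, slice X f a b, slice X f b b, slice X f b c,
      slice X f c c, slice X f c d, slice X f d d] ! (i - 1)"

text \<open>The arrows alternate in direction, starting with a forward one.\<close>

definition levelset_zigzag ::
  "(int \<Rightarrow> 'u topology \<Rightarrow> 'u set \<Rightarrow> ('k, 'v) module)
   \<Rightarrow> (int \<Rightarrow> 'u topology \<Rightarrow> 'u set \<Rightarrow> 'u topology \<Rightarrow> 'u set \<Rightarrow> ('u \<Rightarrow> 'u) \<Rightarrow> 'v \<Rightarrow> 'v)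
   \<Rightarrow> int \<Rightarrow> 'u topology \<Rightarrow> ('u \<Rightarrow> real) \<Rightarrow> ereal \<Rightarrow> ereal \<Rightarrow> ereal \<Rightarrow> ereal \<Rightarrow> ('k, 'v) zigzag" where
  "levelset_zigzag H ind j X f a b c d =
     (let N = (\<lambda>i. subtopology X (levelset_node X f a b c d i))
      in \<lparr>zz_len = 7, zz_fwd = odd,
          zz_space = (\<lambda>i. H j (N i) {}),
          zz_map = (\<lambda>i. ind j (N (arrow_src odd i)) {} (N (arrow_tgt odd i)) {} id)\<rparr>)"

lemma (in homology_theory) levelset_zigzag_module:
  assumes "a \<le> b" "b \<le> c" "c \<le> d"
  shows "zigzag_module K (levelset_zigzag H ind j X f a b c d)"
proof -
  have sub: "levelset_node X f a b c d (arrow_src odd i) \<subseteq> levelset_node X f a b c d (arrow_tgt odd i)"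
    if "i \<in> {1..<7}" for i
  proof -
    from that have "i = 1 \<or> i = 2 \<or> i = 3 \<or> i = 4 \<or> i = 5 \<or> i = 6" by auto
    with assms show ?thesis
      by (auto simp: levelset_node_def arrow_src_def arrow_tgt_def slice_def intro: order_trans)
  qed
  have "linear_map K (H j (subtopology X S) {}) (H j (subtopology X T) {})
          (ind j (subtopology X S) {} (subtopology X T) {} id)" if "S \<subseteq> T" for S T
    using that by (intro ind_linear) (auto simp: continuous_map_in_subtopology)
  with sub space show ?thesis
    by (simp add: zigzag_module_def levelset_zigzag_def Let_def)
qed

text \<open>The multiplicity \<open>\<mu>\<close> of the rectangle \<open>[a, b] \<times> [c, d]\<close>, in the four variants.  In the names,
  \<open>s\<close> stands for a slash and \<open>b\<close> for a backslash in the superscript of \<open>\<mu>\<close>.\<close>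

definition "mu_sb K H ind j X f a b c d = multiplicity K (levelset_zigzag H ind j X f a b c d) 3 5"
definition "mu_bb K H ind j X f a b c d = multiplicity K (levelset_zigzag H ind j X f a b c d) 2 5"
definition "mu_ss K H ind j X f a b c d = multiplicity K (levelset_zigzag H ind j X f a b c d) 3 6"
definition "mu_bs K H ind j X f a b c d = multiplicity K (levelset_zigzag H ind j X f a b c d) 2 6"


section \<open>Taut levelsets\<close>

definition normal_neighbourhood :: "'u topology \<Rightarrow> 'u set \<Rightarrow> 'u set \<Rightarrow> bool" where
  "normal_neighbourhood X L U \<longleftrightarrow>
     U \<subseteq> topspace X \<and> (\<exists>W C. openin X W \<and> closedin X C \<and> L \<subseteq> W \<and> W \<subseteq> C \<and> C \<subseteq> U)"

definition levelset_taut ::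
  "'k ring \<Rightarrow> (int \<Rightarrow> 'u topology \<Rightarrow> 'u set \<Rightarrow> ('k, 'v) module)
   \<Rightarrow> (int \<Rightarrow> 'u topology \<Rightarrow> 'u set \<Rightarrow> 'u topology \<Rightarrow> 'u set \<Rightarrow> ('u \<Rightarrow> 'u) \<Rightarrow> 'v \<Rightarrow> 'v)
   \<Rightarrow> 'u topology \<Rightarrow> ('u \<Rightarrow> real) \<Rightarrow> real \<Rightarrow> bool" where
  "levelset_taut K H ind X f q \<longleftrightarrow>
     (let L = slice X f (ereal q) (ereal q)
      in \<forall>U. normal_neighbourhood X L U \<longrightarrow>
           (let A = U \<inter> slice X f (-\<infinity>) (ereal q); B = U \<inter> slice X f (ereal q) \<infinity>
            in \<forall>k. linear_iso K (H k (subtopology X A) L) (H k (subtopology X U) B)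
                     (ind k (subtopology X A) L (subtopology X U) B id)))"

end

theory Submission
  imports Defs
begin

text \<open>
  Two facts carry the proof. First, the multiplicity of an interval that contains the middle node
  \<open>H(X\<^sub>b\<^sup>c)\<close> is the dimension of \<open>(L \<inter> R) / (L' \<inter> R + L \<inter> R')\<close>, where \<open>L' \<subseteq> L\<close> are two consecutive
  steps of the filtration of the middle node induced by the left half of the zigzag, and \<open>R' \<subseteq> R\<close>
  those induced by the right half. This needs interval decompositions of infinite-dimensional
  zigzag modules; they come from bases adapted to these filtrations. Secondly, tautness of the
  levelset at \<open>t\<close>, applied to the neighbourhood \<open>X\<^sub>a\<^sup>b\<close>, says that the square of \<open>X\<^sub>t\<^sup>t\<close>, \<open>X\<^sub>a\<^sup>t\<close>,
  \<open>X\<^sub>t\<^sup>b\<close> and \<open>X\<^sub>a\<^sup>b\<close> is excisive, so that a pair of classes on \<open>X\<^sub>a\<^sup>t\<close> and \<open>X\<^sub>t\<^sup>b\<close> that agree on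
  \<open>X\<^sub>a\<^sup>b\<close> comes from \<open>X\<^sub>t\<^sup>t\<close>.

  To split \<open>[a, b]\<close> at \<open>p\<close>, refine \<open>L' \<subseteq> L\<close> by the subspace \<open>L''\<close> that the rectangle with left side
  \<open>[p, b]\<close> contributes. One of the two resulting pieces belongs to \<open>[p, b]\<close> by definition; the
  map \<open>H(X\<^sub>b\<^sup>c) \<rightarrow> H(X\<^sub>p\<^sup>c)\<close> identifies the other one with the piece of \<open>[a, p]\<close>, by exactness at \<open>p\<close> and
  at \<open>b\<close>. The splitting at \<open>q\<close> is the mirror image.
\<close>

section \<open>Dimension of a quotient of subspaces\<close>

text \<open>Multiplicities may be infinite, so no identity can be obtained by subtracting ranks:
  every equation is either a sum of dimensions along a filtration of one space or an isomorphism of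
  subquotients. \<open>multiplicity\<close> is a definite description, so a decomposition must exist
  and all decompositions must give the same count. Since the count is computed for an arbitrary
  decomposition in terms of the maps alone, its uniqueness comes for free, without a Krull-Schmidt
  theorem. The map \<open>H(X\<^sub>b\<^sup>c) \<rightarrow> H(X\<^sub>p\<^sup>c)\<close> need be
  neither injective nor surjective. It still identifies the two subquotients, because exactness at
  \<open>b\<close> places its kernel inside the lower step coming from the left and makes it
  surjective on the intersections that occur. Exactness at \<open>p\<close> has a different task: it
  shows that the steps for \<open>[a, b]\<close> are pulled back from steps in
  \<open>H(X\<^sub>p\<^sup>p)\<close>.\<close>

context vectorspace
begin

section \<open>Subspaces and spans\<close>

lemma submoduleI:
  assumes "W \<subseteq> carrier V" "\<zero>\<^bsub>V\<^esub> \<in> W"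
    and "\<And>x y. x \<in> W \<Longrightarrow> y \<in> W \<Longrightarrow> x \<oplus>\<^bsub>V\<^esub> y \<in> W"
    and "\<And>c x. c \<in> carrier K \<Longrightarrow> x \<in> W \<Longrightarrow> c \<odot>\<^bsub>V\<^esub> x \<in> W"
  shows "submodule K W V"
  using assms by (simp add: submodule_def module_axioms)

lemma submodule_subset: "submodule K W V \<Longrightarrow> W \<subseteq> carrier V"
  by (simp add: submodule_def)

lemma submodule_zero: "submodule K W V \<Longrightarrow> \<zero>\<^bsub>V\<^esub> \<in> W"
  by (simp add: submodule_def)

lemma submodule_add:
  "submodule K W V \<Longrightarrow> x \<in> W \<Longrightarrow> y \<in> W \<Longrightarrow> x \<oplus>\<^bsub>V\<^esub> y \<in> W"
  by (simp add: submodule_def)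

lemma submodule_smult:
  "submodule K W V \<Longrightarrow> c \<in> carrier K \<Longrightarrow> x \<in> W \<Longrightarrow> c \<odot>\<^bsub>V\<^esub> x \<in> W"
  by (simp add: submodule_def)

lemma submodule_minus:
  assumes "submodule K W V" "x \<in> W" "y \<in> W"
  shows "x \<ominus>\<^bsub>V\<^esub> y \<in> W"
proof -
  have y: "y \<in> carrier V" using assms submodule_subset by blast
  have "\<ominus>\<^bsub>V\<^esub> y = (\<ominus>\<^bsub>K\<^esub> \<one>\<^bsub>K\<^esub>) \<odot>\<^bsub>V\<^esub> y"
    using y smult_minus_1_back by simp
  then have "\<ominus>\<^bsub>V\<^esub> y \<in> W" using assms submodule_smult by simp
  then show ?thesis using assms submodule_add by (simp add: a_minus_def)
qed

lemma submodule_carrier: "submodule K (carrier V) V"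
  by (rule submoduleI) auto

lemma submodule_zero_set: "submodule K {\<zero>\<^bsub>V\<^esub>} V"
  by (rule submoduleI) auto

lemma submodule_Int: "submodule K A V \<Longrightarrow> submodule K B V \<Longrightarrow> submodule K (A \<inter> B) V"
  by (auto simp: submodule_def)

lemma add_minus_cancel:
  "x \<in> carrier V \<Longrightarrow> y \<in> carrier V \<Longrightarrow> y \<oplus>\<^bsub>V\<^esub> (x \<ominus>\<^bsub>V\<^esub> y) = x"
  using M.a_lcomm[of y x "\<ominus>\<^bsub>V\<^esub> y"] unfolding a_minus_def by (simp add: M.r_neg)

lemma add_minus_cancel':
  "x \<in> carrier V \<Longrightarrow> y \<in> carrier V \<Longrightarrow> (x \<oplus>\<^bsub>V\<^esub> y) \<ominus>\<^bsub>V\<^esub> y = x"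
  using M.a_assoc[of x y "\<ominus>\<^bsub>V\<^esub> y"] unfolding a_minus_def by (simp add: M.r_neg)

lemma span_least: "submodule K W V \<Longrightarrow> S \<subseteq> W \<Longrightarrow> span S \<subseteq> W"
  by (rule span_is_subset)

lemma span_subset_span: "T \<subseteq> carrier V \<Longrightarrow> S \<subseteq> span T \<Longrightarrow> span S \<subseteq> span T"
  by (rule span_least[OF span_is_submodule])

lemma span_of_submodule: "submodule K W V \<Longrightarrow> span W = W"
  using span_least[of W W] in_own_span[of W] submodule_subset by blast

lemma span_empty: "span {} = {\<zero>\<^bsub>V\<^esub>}"
  using span_least[OF submodule_zero_set, of "{}"] submodule_zero[OF span_is_submodule, of "{}"] by auto

lemma span_finitary:
  assumes "x \<in> span S"
  shows "\<exists>F. finite F \<and> F \<subseteq> S \<and> x \<in> span F"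
  using assms unfolding span_def by blast

lemma span_Un_decomp:
  assumes "submodule K N V" "S \<subseteq> carrier V" "x \<in> span (N \<union> S)"
  shows "\<exists>n\<in>N. \<exists>w\<in>span S. x = n \<oplus>\<^bsub>V\<^esub> w"
  using assms span_union_is_sum[OF submodule_subset[OF assms(1)] assms(2)] span_of_submodule[OF assms(1)]
  by (auto simp: submodule_sum_def)

lemma span_Un_comp:
  assumes "submodule K N V" "S \<subseteq> carrier V" "n \<in> N" "w \<in> span S"
  shows "n \<oplus>\<^bsub>V\<^esub> w \<in> span (N \<union> S)"
proof -
  have sub: "N \<union> S \<subseteq> carrier V" using assms submodule_subset by blast
  moreover have "w \<in> span (N \<union> S)" using assms span_is_monotone[of S "N \<union> S"] by blast
  moreover have "n \<in> span (N \<union> S)" using assms(3) in_own_span[OF sub] by blast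
  ultimately show ?thesis using submodule_add[OF span_is_submodule] by blast
qed

lemma span_Un_span:
  assumes "S \<subseteq> carrier V" "T \<subseteq> carrier V"
  shows "span (span S \<union> T) = span (S \<union> T)"
proof
  have "span S \<union> T \<subseteq> span (S \<union> T)"
    using span_is_monotone[of S "S \<union> T"] in_own_span[of "S \<union> T"] assms by blast
  then show "span (span S \<union> T) \<subseteq> span (S \<union> T)"
    by (rule span_subset_span[rotated]) (use assms in blast)
  show "span (S \<union> T) \<subseteq> span (span S \<union> T)"
    using span_is_monotone[of "S \<union> T" "span S \<union> T"] in_own_span[OF assms(1)] by blast
qed

text \<open>The sums of this form already make up a subspace containing \<open>y\<close> and
  \<open>S\<close>; this avoids explicit linear combinations.\<close>

lemma in_span_insert:
  assumes "S \<subseteq> carrier V" "y \<in> carrier V" "x \<in> span (insert y S)"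
  shows "\<exists>c\<in>carrier K. \<exists>w\<in>span S. x = w \<oplus>\<^bsub>V\<^esub> c \<odot>\<^bsub>V\<^esub> y"
proof -
  let ?W = "{w \<oplus>\<^bsub>V\<^esub> c \<odot>\<^bsub>V\<^esub> y | w c. w \<in> span S \<and> c \<in> carrier K}"
  note sub = span_is_submodule[OF assms(1)]
  have car: "w \<in> carrier V" if "w \<in> span S" for w using that span_is_subset2 assms(1) by blast
  have "submodule K ?W V"
  proof (rule submoduleI)
    show "?W \<subseteq> carrier V" using car assms(2) by auto
    have "\<zero>\<^bsub>V\<^esub> = \<zero>\<^bsub>V\<^esub> \<oplus>\<^bsub>V\<^esub> \<zero>\<^bsub>K\<^esub> \<odot>\<^bsub>V\<^esub> y" using assms(2) by simp
    then show "\<zero>\<^bsub>V\<^esub> \<in> ?W" using submodule_zero[OF sub] R.zero_closed by blast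
  next
    fix u v assume "u \<in> ?W" "v \<in> ?W"
    then obtain w c w' c' where *: "u = w \<oplus>\<^bsub>V\<^esub> c \<odot>\<^bsub>V\<^esub> y" "v = w' \<oplus>\<^bsub>V\<^esub> c' \<odot>\<^bsub>V\<^esub> y"
      "w \<in> span S" "c \<in> carrier K" "w' \<in> span S" "c' \<in> carrier K" by blast
    have "u \<oplus>\<^bsub>V\<^esub> v = (w \<oplus>\<^bsub>V\<^esub> w') \<oplus>\<^bsub>V\<^esub> (c \<oplus>\<^bsub>K\<^esub> c') \<odot>\<^bsub>V\<^esub> y"
      using * car assms(2) by (simp add: smult_l_distr M.a_ac)
    then show "u \<oplus>\<^bsub>V\<^esub> v \<in> ?W" using * submodule_add[OF sub] R.add.m_closed by blast
  next
    fix a u assume a: "a \<in> carrier K" and "u \<in> ?W"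
    then obtain w c where *: "u = w \<oplus>\<^bsub>V\<^esub> c \<odot>\<^bsub>V\<^esub> y" "w \<in> span S" "c \<in> carrier K" by blast
    have "a \<odot>\<^bsub>V\<^esub> u = a \<odot>\<^bsub>V\<^esub> w \<oplus>\<^bsub>V\<^esub> (a \<otimes>\<^bsub>K\<^esub> c) \<odot>\<^bsub>V\<^esub> y"
      using * a car assms(2) by (simp add: smult_r_distr smult_assoc1)
    then show "a \<odot>\<^bsub>V\<^esub> u \<in> ?W" using * a submodule_smult[OF sub] R.m_closed by blast
  qed
  moreover have "insert y S \<subseteq> ?W"
  proof
    fix z assume "z \<in> insert y S"
    then consider "z = y" | "z \<in> S" by blast
    then show "z \<in> ?W"
    proof cases
      case 1
      have "y = \<zero>\<^bsub>V\<^esub> \<oplus>\<^bsub>V\<^esub> \<one>\<^bsub>K\<^esub> \<odot>\<^bsub>V\<^esub> y" using assms(2) by simp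
      then show ?thesis using 1 submodule_zero[OF sub] R.one_closed by blast
    next
      case 2
      then have "z = z \<oplus>\<^bsub>V\<^esub> \<zero>\<^bsub>K\<^esub> \<odot>\<^bsub>V\<^esub> y" using assms by auto
      then show ?thesis using 2 in_own_span[OF assms(1)] R.zero_closed by blast
    qed
  qed
  ultimately show ?thesis using span_least assms(3) by blast
qed

section \<open>Exchange, and bases relative to a subspace\<close>

lemma smult_cancel_mem:
  assumes "submodule K W V" "c \<in> carrier K" "c \<noteq> \<zero>\<^bsub>K\<^esub>" "y \<in> carrier V" "c \<odot>\<^bsub>V\<^esub> y \<in> W"
  shows "y \<in> W"
proof -
  have "inv\<^bsub>K\<^esub> c \<in> carrier K" "inv\<^bsub>K\<^esub> c \<otimes>\<^bsub>K\<^esub> c = \<one>\<^bsub>K\<^esub>"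
    using assms field_Units by auto
  then have "y = inv\<^bsub>K\<^esub> c \<odot>\<^bsub>V\<^esub> (c \<odot>\<^bsub>V\<^esub> y)"
    using assms by (metis smult_assoc1 smult_one)
  then show ?thesis using assms submodule_smult \<open>inv\<^bsub>K\<^esub> c \<in> carrier K\<close> by metis
qed

text \<open>The coefficient of \<open>y\<close> in \<open>x\<close> is nonzero because
  \<open>x\<close> lies outside \<open>span S\<close>, so the expression for \<open>x\<close> can be
  solved for \<open>y\<close>.\<close>

lemma span_exchange:
  assumes "S \<subseteq> carrier V" "y \<in> carrier V" "x \<in> span (insert y S)" "x \<notin> span S"
  shows "y \<in> span (insert x S)"
proof -
  obtain c w where c: "c \<in> carrier K" and w: "w \<in> span S" and x: "x = w \<oplus>\<^bsub>V\<^esub> c \<odot>\<^bsub>V\<^esub> y"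
    using in_span_insert[OF assms(1-3)] by blast
  have wc: "w \<in> carrier V" using w span_is_subset2 assms(1) by blast
  have xc: "x \<in> carrier V" using x wc c assms(2) by simp
  have sub: "insert x S \<subseteq> carrier V" using assms(1) xc by blast
  have "c \<noteq> \<zero>\<^bsub>K\<^esub>" using x w wc assms(2,4) by auto
  have "c \<odot>\<^bsub>V\<^esub> y = x \<ominus>\<^bsub>V\<^esub> w"
    using x wc c assms(2) add_minus_cancel'[of "c \<odot>\<^bsub>V\<^esub> y" w] by (simp add: M.a_comm)
  moreover have "x \<ominus>\<^bsub>V\<^esub> w \<in> span (insert x S)"
    using span_is_monotone[of S "insert x S"] w in_own_span[OF sub] submodule_minus[OF span_is_submodule[OF sub]]
    by blast
  ultimately show ?thesis
    using smult_cancel_mem[OF span_is_submodule[OF sub] c \<open>c \<noteq> _\<close> assms(2)] by simp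
qed

text \<open>Linear independence in the quotient by \<open>span N\<close>, expressed by vectors of
  \<open>V\<close> itself so that no quotient space has to be formed; \<open>N = {}\<close> gives
  ordinary independence.\<close>

definition rel_indep :: "'c set \<Rightarrow> 'c set \<Rightarrow> bool" where
  "rel_indep N B \<longleftrightarrow> B \<subseteq> carrier V \<and> (\<forall>b\<in>B. b \<notin> span (N \<union> (B - {b})))"

definition rel_basis :: "'c set \<Rightarrow> 'c set \<Rightarrow> 'c set \<Rightarrow> bool" where
  "rel_basis N M B \<longleftrightarrow> rel_indep N B \<and> B \<subseteq> M \<and> span (N \<union> B) = M"

text \<open>The dimension of \<open>M\<close> modulo \<open>N\<close>; by
  \<open>rel_basis_ecard_eq\<close> all choices of a relative basis give the same value.\<close>

definition rdim :: "'c set \<Rightarrow> 'c set \<Rightarrow> enat" where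
  "rdim N M = ecard (SOME B. rel_basis N M B)"

lemma rel_indep_subset: "rel_indep N B \<Longrightarrow> C \<subseteq> B \<Longrightarrow> rel_indep N C"
proof -
  assume *: "rel_indep N B" "C \<subseteq> B"
  have "span (N \<union> (C - {b})) \<subseteq> span (N \<union> (B - {b}))" for b
    by (rule span_is_monotone) (use * in blast)
  then show ?thesis using * unfolding rel_indep_def by blast
qed

lemma rel_indep_notin: "rel_indep N B \<Longrightarrow> N \<subseteq> carrier V \<Longrightarrow> b \<in> B \<Longrightarrow> b \<notin> N"
  using subsetD[OF in_own_span[of "N \<union> (B - {b})"], of b] unfolding rel_indep_def by blast

text \<open>If some \<open>b\<close> of \<open>B\<close> became dependent once \<open>c\<close> is
  added, exchanging the two would put \<open>c\<close> into
  \<open>span (N \<union> B)\<close>.\<close>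

lemma rel_indep_insert:
  assumes "N \<subseteq> carrier V" "rel_indep N B" "c \<in> carrier V" "c \<notin> span (N \<union> B)"
  shows "rel_indep N (insert c B)"
  unfolding rel_indep_def
proof (intro conjI ballI)
  have Bc: "B \<subseteq> carrier V" using assms(2) by (simp add: rel_indep_def)
  show "insert c B \<subseteq> carrier V" using Bc assms(3) by blast
  have "c \<notin> B" using assms(1,4) Bc in_own_span[of "N \<union> B"] by blast
  fix b assume b: "b \<in> insert c B"
  show "b \<notin> span (N \<union> (insert c B - {b}))"
  proof (cases "b = c")
    case True
    then show ?thesis using assms(4) \<open>c \<notin> B\<close> by simp
  next
    case False
    have eq: "N \<union> (insert c B - {b}) = insert c (N \<union> (B - {b}))" using False by blast
    have eq': "insert b (N \<union> (B - {b})) = N \<union> B" using False b by blast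
    have "b \<notin> span (N \<union> (B - {b}))" using False b assms(2) by (simp add: rel_indep_def)
    moreover have "N \<union> (B - {b}) \<subseteq> carrier V" using Bc assms(1) by blast
    ultimately show ?thesis
      using span_exchange[of "N \<union> (B - {b})" c b] assms(3,4) eq eq' by auto
  qed
qed

text \<open>An element of \<open>B\<close> outside \<open>C\<close> is swapped for one of
  \<open>C\<close>; this keeps the size and the independence of \<open>B\<close> and moves it
  towards \<open>C\<close>.\<close>

lemma steinitz:
  assumes "N \<subseteq> carrier V" "finite C" "C \<subseteq> carrier V" "finite B" "rel_indep N B"
    and "B \<subseteq> span (N \<union> C)"
  shows "card B \<le> card C"
  using assms(4-6)
proof (induction "card (B - C)" arbitrary: B rule: less_induct)
  case less
  show ?case
  proof (cases "B \<subseteq> C")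
    case True
    then show ?thesis using assms(2) by (simp add: card_mono)
  next
    case False
    then obtain b where b: "b \<in> B" "b \<notin> C" by blast
    let ?D = "B - {b}"
    have D: "?D \<subseteq> carrier V" "b \<notin> span (N \<union> ?D)" "rel_indep N ?D"
      using less.prems(2) b rel_indep_subset[of N B ?D] by (auto simp: rel_indep_def)
    \<comment> \<open>Otherwise \<open>b\<close> itself would depend on the rest of
      \<open>B\<close>.\<close>
    have "\<not> C \<subseteq> span (N \<union> ?D)"
    proof
      assume "C \<subseteq> span (N \<union> ?D)"
      then have "N \<union> C \<subseteq> span (N \<union> ?D)" using assms(1) D(1) in_own_span[of "N \<union> ?D"] by blast
      then show False using span_subset_span[of "N \<union> ?D"] D less.prems(3) b assms(1) by blast
    qed
    then obtain c where c: "c \<in> C" "c \<notin> span (N \<union> ?D)" by blast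
    have cB: "c \<notin> ?D" using c(2) subsetD[OF in_own_span[of "N \<union> ?D"], of c] D(1) assms(1) by blast
    have ind: "rel_indep N (insert c ?D)"
      using rel_indep_insert[OF assms(1) D(3)] c assms(3) by blast
    have "insert c ?D - C \<subset> B - C" using b c by auto
    then have "card (insert c ?D - C) < card (B - C)"
      using less.prems(1) by (simp add: psubset_card_mono)
    moreover have "insert c ?D \<subseteq> span (N \<union> C)"
      using less.prems(3) c in_own_span[of "N \<union> C"] assms(1,3) by blast
    ultimately have "card (insert c ?D) \<le> card C"
      using less.hyps ind less.prems(1) by blast
    moreover have "card (insert c ?D) = card B"
      using card_insert_disjoint[OF _ cB] card_Suc_Diff1[OF less.prems(1) b(1)] less.prems(1) by simp
    ultimately show ?thesis by simp
  qed
qed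

text \<open>\<open>ecard\<close> has a single infinite value, so only a finite \<open>C\<close>
  needs an argument; an infinite \<open>B\<close> would then contain a finite subset larger than
  \<open>C\<close>.\<close>

lemma rel_basis_ecard_le:
  assumes "N \<subseteq> carrier V" "rel_basis N M B" "rel_basis N M C"
  shows "ecard B \<le> ecard C"
proof (cases "finite C")
  case True
  have C: "C \<subseteq> carrier V" and Bs: "B \<subseteq> span (N \<union> C)" and ind: "rel_indep N B"
    using assms unfolding rel_basis_def rel_indep_def by auto
  have le: "card F \<le> card C" if "finite F" "F \<subseteq> B" for F
    using steinitz[OF assms(1) True C that(1)] rel_indep_subset[OF ind] that Bs by blast
  have "finite B"
  proof (rule ccontr)
    assume "infinite B"
    then obtain F where "F \<subseteq> B" "finite F" "card F = Suc (card C)"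
      using infinite_arbitrarily_large by blast
    then show False using le by fastforce
  qed
  then show ?thesis using True le by (simp add: ecard_def)
qed (simp add: ecard_def)

lemma rel_basis_ecard_eq:
  assumes "N \<subseteq> carrier V" "rel_basis N M B" "rel_basis N M C"
  shows "ecard B = ecard C"
  using rel_basis_ecard_le[OF assms] rel_basis_ecard_le[OF assms(1,3,2)] by simp

lemma rdim_eqI:
  assumes "N \<subseteq> carrier V" "rel_basis N M B"
  shows "rdim N M = ecard B"
  unfolding rdim_def
  by (rule rel_basis_ecard_eq[OF assms(1) _ assms(2)]) (rule someI[of "rel_basis N M", OF assms(2)])

text \<open>Zorn's lemma for independent sets between \<open>B0\<close> and \<open>M\<close>. The
  union of a chain is independent because a dependence involves finitely many vectors, which lie in
  one member of the chain.\<close>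

lemma rel_basis_extend:
  assumes "submodule K M V" "N \<subseteq> M" "rel_indep N B0" "B0 \<subseteq> M"
  shows "\<exists>B. B0 \<subseteq> B \<and> rel_basis N M B"
proof -
  let ?A = "{B. B0 \<subseteq> B \<and> B \<subseteq> M \<and> rel_indep N B}"
  have Mc: "M \<subseteq> carrier V" using assms(1) submodule_subset by blast
  have "\<Union>C \<in> ?A" if C: "C \<noteq> {}" "subset.chain ?A C" for C
  proof -
    have sub: "C \<subseteq> ?A" and lin: "\<And>X Y. X \<in> C \<Longrightarrow> Y \<in> C \<Longrightarrow> X \<subseteq> Y \<or> Y \<subseteq> X"
      using C(2) unfolding subset_chain_def by auto
    have "b \<notin> span (N \<union> (\<Union>C - {b}))" if b: "b \<in> \<Union>C" for b
    proof
      assume "b \<in> span (N \<union> (\<Union>C - {b}))"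
      then obtain F where F: "finite F" "F \<subseteq> N \<union> (\<Union>C - {b})" "b \<in> span F"
        using span_finitary[of b] by auto
      have "finite (insert b (F - N))" "insert b (F - N) \<subseteq> \<Union>C" using F b by auto
      then obtain Y where Y: "Y \<in> C" "insert b (F - N) \<subseteq> Y"
        using finite_subset_Union_chain[of "insert b (F - N)" C ?A] C by blast
      have "F \<subseteq> N \<union> (Y - {b})" using F Y by blast
      then have "b \<in> span (N \<union> (Y - {b}))" using F(3) span_is_monotone by blast
      then show False using Y sub unfolding rel_indep_def by blast
    qed
    moreover have "B0 \<subseteq> \<Union>C" using sub C(1) by auto
    moreover have "\<Union>C \<subseteq> M" using sub by auto
    ultimately show ?thesis using Mc by (auto simp: rel_indep_def)
  qed
  moreover have "?A \<noteq> {}" using assms by blast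
  ultimately have "\<exists>B\<in>?A. \<forall>X\<in>?A. B \<subseteq> X \<longrightarrow> X = B"
    by (intro subset_Zorn_nonempty)
  then obtain B where B: "B \<in> ?A" and max: "\<forall>X\<in>?A. B \<subseteq> X \<longrightarrow> X = B"
    by (rule bexE)
  have "span (N \<union> B) = M"
  proof
    show "span (N \<union> B) \<subseteq> M" using span_least[OF assms(1)] assms(2) B by blast
    show "M \<subseteq> span (N \<union> B)"
    proof
      fix x assume x: "x \<in> M"
      show "x \<in> span (N \<union> B)"
      proof (rule ccontr)
        assume n: "x \<notin> span (N \<union> B)"
        then have "rel_indep N (insert x B)" using rel_indep_insert B x Mc assms(2) by blast
        then have "insert x B = B" using max[THEN bspec, of "insert x B"] B x by blast
        then show False using n subsetD[OF in_own_span[of "N \<union> B"], of x] B Mc assms(2) by blast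
      qed
    qed
  qed
  then show ?thesis using B unfolding rel_basis_def by blast
qed

lemma rel_basis_exists:
  assumes "submodule K M V" "N \<subseteq> M"
  shows "\<exists>B. rel_basis N M B"
  using rel_basis_extend[OF assms, of "{}"] by (auto simp: rel_indep_def)

text \<open>A vector of \<open>P\<close> cannot involve any \<open>c\<close> of \<open>C\<close>:
  solving for \<open>c\<close> would express it by vectors of \<open>P\<close> and the rest of
  \<open>C\<close>.\<close>

lemma rel_indep_span_Int:
  assumes "submodule K P V" "A \<subseteq> P" "rel_indep P C" "x \<in> P" "x \<in> span (A \<union> C)"
  shows "x \<in> span A"
proof -
  have Pc: "P \<subseteq> carrier V" and Cc: "C \<subseteq> carrier V"
    using assms submodule_subset unfolding rel_indep_def by auto
  have step: "x \<in> span A" if "finite F" "F \<subseteq> C" "x \<in> span (A \<union> F)" for F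
    using that
  proof (induction F)
    case (insert c F)
    have Fc: "A \<union> F \<subseteq> carrier V" using Pc Cc assms(2) insert.prems by blast
    have "x \<in> span (A \<union> F)"
    proof (rule ccontr)
      assume "x \<notin> span (A \<union> F)"
      then have "c \<in> span (insert x (A \<union> F))"
        using span_exchange[OF Fc, of c x] insert.prems Cc by auto
      moreover have "insert x (A \<union> F) \<subseteq> P \<union> (C - {c})"
        using insert.hyps insert.prems assms(2,4) by blast
      ultimately have "c \<in> span (P \<union> (C - {c}))" using span_is_monotone by blast
      then show False using assms(3) insert.prems unfolding rel_indep_def by blast
    qed
    then show ?case using insert by blast
  qed simp
  obtain F where F: "finite F" "F \<subseteq> A \<union> C" "x \<in> span F" using assms(5) span_finitary by blast
  have "x \<in> span (A \<union> (F \<inter> C))" using F span_is_monotone[of F "A \<union> (F \<inter> C)"] by blast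
  then show ?thesis using step[of "F \<inter> C"] F by blast
qed

lemma rel_indep_Un:
  assumes "submodule K P V" "N \<subseteq> P" "B \<subseteq> P" "rel_indep N B" "rel_indep P C"
  shows "rel_indep N (B \<union> C)"
  unfolding rel_indep_def
proof (intro conjI ballI)
  have Pc: "P \<subseteq> carrier V" using assms(1) submodule_subset by blast
  show "B \<union> C \<subseteq> carrier V" using assms unfolding rel_indep_def by blast
  have disj: "B \<inter> C = {}" using rel_indep_notin[OF assms(5) Pc] assms(3) by blast
  fix b assume b: "b \<in> B \<union> C"
  show "b \<notin> span (N \<union> (B \<union> C - {b}))"
  proof
    assume *: "b \<in> span (N \<union> (B \<union> C - {b}))"
    show False
    proof (cases "b \<in> C")
      case True
      have "N \<union> (B \<union> C - {b}) \<subseteq> P \<union> (C - {b})" using assms by blast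
      then show False using * True span_is_monotone assms(5) unfolding rel_indep_def by blast
    next
      case False
      have "N \<union> (B \<union> C - {b}) = (N \<union> (B - {b})) \<union> C" using False by blast
      then have "b \<in> span (N \<union> (B - {b}))"
        using rel_indep_span_Int[OF assms(1) _ assms(5), of "N \<union> (B - {b})" b] * assms(2,3) b False
        by auto
      then show False using assms(4) False b unfolding rel_indep_def by blast
    qed
  qed
qed

lemma rel_basis_Un:
  assumes "submodule K M V" "N \<subseteq> carrier V" "P \<subseteq> M" "rel_basis N P B" "rel_basis P M C"
  shows "rel_basis N M (B \<union> C)"
proof -
  have Bc: "N \<union> B \<subseteq> carrier V" "C \<subseteq> carrier V" and sp: "span (N \<union> B) = P" "span (P \<union> C) = M"
    using assms unfolding rel_basis_def rel_indep_def by auto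
  then have P: "submodule K P V" using span_is_submodule by blast
  have "N \<subseteq> P" using sp(1) in_own_span[OF Bc(1)] by blast
  then have "rel_indep N (B \<union> C)"
    using rel_indep_Un[OF P, of N B C] assms unfolding rel_basis_def by blast
  moreover have "span (N \<union> (B \<union> C)) = M"
    using span_Un_span[OF Bc] sp by (simp add: Un_assoc)
  ultimately show ?thesis using assms unfolding rel_basis_def by blast
qed

lemma ecard_Un_disjoint: "A \<inter> B = {} \<Longrightarrow> ecard (A \<union> B) = ecard A + ecard B"
  by (simp add: ecard_def card_Un_disjoint)

lemma rdim_add:
  assumes "submodule K P V" "submodule K M V" "N \<subseteq> P" "P \<subseteq> M"
  shows "rdim N M = rdim N P + rdim P M"
proof -
  have Pc: "P \<subseteq> carrier V" "N \<subseteq> carrier V" using assms submodule_subset by blast+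
  obtain B where B: "rel_basis N P B" using rel_basis_exists assms by blast
  obtain C where C: "rel_basis P M C" using rel_basis_exists assms by blast
  have "B \<inter> C = {}" using B C rel_indep_notin[of P C] Pc unfolding rel_basis_def by blast
  then show ?thesis
    using rdim_eqI[OF Pc(2) rel_basis_Un[OF assms(2) Pc(2) assms(4) B C]]
      rdim_eqI[OF Pc(2) B] rdim_eqI[OF Pc(1) C] ecard_Un_disjoint by metis
qed

text \<open>The isomorphism of \<open>A / (A \<inter> N)\<close> with \<open>(A + N) / N\<close>: a
  basis of \<open>A\<close> relative to \<open>A \<inter> N\<close> is also one of the sum relative
  to \<open>N\<close>.\<close>

lemma rdim_second_iso:
  assumes A: "submodule K A V" and N: "submodule K N V"
  shows "rdim N (span (A \<union> N)) = rdim (A \<inter> N) A"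
proof -
  have Ac: "A \<subseteq> carrier V" "N \<subseteq> carrier V" using assms submodule_subset by blast+
  obtain B where B: "rel_basis (A \<inter> N) A B" using rel_basis_exists[OF A] by blast
  then have Bs: "B \<subseteq> A" "span ((A \<inter> N) \<union> B) = A" "rel_indep (A \<inter> N) B"
    unfolding rel_basis_def by auto
  have "A \<subseteq> span (N \<union> B)" using Bs span_is_monotone[of "(A \<inter> N) \<union> B" "N \<union> B"] by blast
  moreover have "N \<subseteq> span (N \<union> B)" using in_own_span[of "N \<union> B"] Bs Ac by blast
  ultimately have "span (A \<union> N) \<subseteq> span (N \<union> B)"
    using span_subset_span[of "N \<union> B" "A \<union> N"] Bs Ac by blast
  moreover have "span (N \<union> B) \<subseteq> span (A \<union> N)" by (rule span_is_monotone) (use Bs in blast)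
  moreover have "rel_indep N B"
    unfolding rel_indep_def
  proof (intro conjI ballI)
    show "B \<subseteq> carrier V" using Bs Ac by blast
    fix b assume b: "b \<in> B"
    show "b \<notin> span (N \<union> (B - {b}))"
    proof
      assume "b \<in> span (N \<union> (B - {b}))"
      then obtain n w where nw: "n \<in> N" "w \<in> span (B - {b})" "b = n \<oplus>\<^bsub>V\<^esub> w"
        using span_Un_decomp[OF N, of "B - {b}"] Bs Ac by blast
      \<comment> \<open>Both \<open>b\<close> and \<open>w\<close> lie in \<open>A\<close>, hence so
        does \<open>n\<close>, and the relation holds already modulo
        \<open>A \<inter> N\<close>.\<close>
      have wA: "w \<in> A" using nw span_least[OF A, of "B - {b}"] Bs by blast
      have "b \<ominus>\<^bsub>V\<^esub> w = n"
        unfolding nw(3) by (rule add_minus_cancel') (use nw wA Ac in blast)+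
      moreover have "b \<ominus>\<^bsub>V\<^esub> w \<in> A" by (rule submodule_minus[OF A _ wA]) (use b Bs in blast)
      ultimately have "n \<in> A \<inter> N" using nw(1) by simp
      then have "b \<in> span ((A \<inter> N) \<union> (B - {b}))"
        using span_Un_comp[OF submodule_Int[OF A N], of "B - {b}"] nw Bs Ac by blast
      then show False using Bs b unfolding rel_indep_def by blast
    qed
  qed
  ultimately have "rel_basis N (span (A \<union> N)) B"
    unfolding rel_basis_def using Bs in_own_span[of "A \<union> N"] Ac by auto
  then show ?thesis using rdim_eqI B Ac by (metis Int_lower2 subset_trans)
qed

end

section \<open>Subspaces and relative dimension under a linear map\<close>

context linear_map
begin

lemma image_submodule:
  assumes "submodule K M V"
  shows "submodule K (T ` M) W"
proof (rule W.submoduleI)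
  note sub = V.submodule_subset[OF assms]
  show "T ` M \<subseteq> carrier W" using sub by auto
  show "\<zero>\<^bsub>W\<^esub> \<in> T ` M" using V.submodule_zero[OF assms] T0_is_0 by force
  show "x \<oplus>\<^bsub>W\<^esub> y \<in> T ` M" if xy: "x \<in> T ` M" "y \<in> T ` M" for x y
  proof -
    obtain u v where "x = T u" "y = T v" "u \<in> M" "v \<in> M" using xy by blast
    then have "x \<oplus>\<^bsub>W\<^esub> y = T (u \<oplus>\<^bsub>V\<^esub> v)" using sub by (auto simp: subset_eq)
    then show ?thesis using \<open>u \<in> M\<close> \<open>v \<in> M\<close> V.submodule_add[OF assms] by blast
  qed
  show "c \<odot>\<^bsub>W\<^esub> x \<in> T ` M" if c: "c \<in> carrier K" "x \<in> T ` M" for c x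
  proof -
    obtain u where "x = T u" "u \<in> M" using c by blast
    then have "c \<odot>\<^bsub>W\<^esub> x = T (c \<odot>\<^bsub>V\<^esub> u)" using sub c by (auto simp: subset_eq)
    then show ?thesis using \<open>u \<in> M\<close> c V.submodule_smult[OF assms] by blast
  qed
qed

lemma vimage_submodule:
  assumes "submodule K M V" "submodule K N W"
  shows "submodule K {x \<in> M. T x \<in> N} V"
  using V.submodule_subset[OF assms(1)] assms
  by (intro V.submoduleI)
    (auto simp: subset_eq V.submodule_zero V.submodule_add V.submodule_smult
      W.submodule_zero W.submodule_add W.submodule_smult)

lemma span_image:
  assumes "S \<subseteq> carrier V"
  shows "W.module.span (T ` S) = T ` V.module.span S"
proof
  have "T ` S \<subseteq> T ` V.module.span S" using V.module.in_own_span[OF assms] by blast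
  then show "W.module.span (T ` S) \<subseteq> T ` V.module.span S"
    using W.span_least[OF image_submodule[OF V.module.span_is_submodule[OF assms]]] by blast
  have TS: "T ` S \<subseteq> carrier W" using assms by auto
  have "S \<subseteq> {x \<in> carrier V. T x \<in> W.module.span (T ` S)}" using assms W.module.in_own_span[OF TS] by blast
  then show "T ` V.module.span S \<subseteq> W.module.span (T ` S)"
    using V.span_least[OF vimage_submodule[OF V.submodule_carrier W.module.span_is_submodule[OF TS]]] by blast
qed

text \<open>\<open>T\<close> induces an isomorphism between the two quotients, and it carries a
  relative basis to a relative basis.\<close>

lemma rdim_image:
  assumes M: "submodule K M V" and N: "submodule K N W" and NM: "N \<subseteq> T ` M"
  shows "V.rdim {x \<in> M. T x \<in> N} M = W.rdim N (T ` M)"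
proof -
  define N' where "N' = {x \<in> M. T x \<in> N}"
  have sub: "submodule K N' V" unfolding N'_def by (rule vimage_submodule[OF M N])
  have Mc: "M \<subseteq> carrier V" "N \<subseteq> carrier W" "N' \<subseteq> carrier V"
    using V.submodule_subset W.submodule_subset M N sub by auto
  have TN: "T ` N' = N" using NM unfolding N'_def by blast
  obtain B where B: "V.rel_basis N' M B" using V.rel_basis_exists[OF M, of N'] N'_def by auto
  then have Bs: "B \<subseteq> M" "V.module.span (N' \<union> B) = M" "V.rel_indep N' B" unfolding V.rel_basis_def by auto
  have Bc: "B \<subseteq> carrier V" using Bs Mc by blast
  \<comment> \<open>Two vectors of \<open>M\<close> with the same image differ by an element of
    \<open>N'\<close>. Injectivity on \<open>B\<close> and independence of the images both rest on
    this.\<close>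
  have key: "b \<in> V.module.span (N' \<union> S)" if "b \<in> M" "S \<subseteq> M" "y \<in> V.module.span (N' \<union> S)" "T b = T y" for b y S
  proof -
    have ys: "y \<in> M" using V.span_least[OF M, of "N' \<union> S"] that N'_def by blast
    then have c: "b \<in> carrier V" "y \<in> carrier V" using that Mc by auto
    have "T (b \<ominus>\<^bsub>V\<^esub> y) = \<zero>\<^bsub>W\<^esub>" using c that by simp
    then have "b \<ominus>\<^bsub>V\<^esub> y \<in> N'"
      using V.submodule_minus[OF M \<open>b \<in> M\<close> ys] W.submodule_zero[OF N] N'_def by simp
    moreover have "b = y \<oplus>\<^bsub>V\<^esub> (b \<ominus>\<^bsub>V\<^esub> y)" using V.add_minus_cancel[of b y] c by simp
    moreover have sc: "N' \<union> S \<subseteq> carrier V" using Mc that by blast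
    then have "b \<ominus>\<^bsub>V\<^esub> y \<in> V.module.span (N' \<union> S)"
      using \<open>b \<ominus>\<^bsub>V\<^esub> y \<in> N'\<close> V.module.in_own_span[OF sc] by blast
    then have "y \<oplus>\<^bsub>V\<^esub> (b \<ominus>\<^bsub>V\<^esub> y) \<in> V.module.span (N' \<union> S)"
      by (rule V.submodule_add[OF V.module.span_is_submodule[OF sc] that(3)])
    ultimately show ?thesis by simp
  qed
  have inj: "inj_on T B"
  proof (rule inj_onI, rule ccontr)
    fix b b' assume bb: "b \<in> B" "b' \<in> B" "T b = T b'" "b \<noteq> b'"
    have "b' \<in> V.module.span (N' \<union> (B - {b}))"
      using V.module.in_own_span[of "N' \<union> (B - {b})"] bb Bc Mc by blast
    then have "b \<in> V.module.span (N' \<union> (B - {b}))" using key[of b "B - {b}" b'] bb Bs by blast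
    then show False using Bs(3) bb unfolding V.rel_indep_def by blast
  qed
  have "W.rel_indep N (T ` B)"
    unfolding W.rel_indep_def
  proof (intro conjI ballI)
    show "T ` B \<subseteq> carrier W" using Bc by auto
    fix t assume "t \<in> T ` B"
    then obtain b where b: "t = T b" "b \<in> B" by blast
    show "t \<notin> W.module.span (N \<union> (T ` B - {t}))"
    proof
      assume t: "t \<in> W.module.span (N \<union> (T ` B - {t}))"
      have "N \<union> (T ` B - {t}) = T ` (N' \<union> (B - {b}))"
        using b inj Bs TN by (auto simp: inj_on_def image_Un)
      moreover have "N' \<union> (B - {b}) \<subseteq> carrier V" using Bc Mc by blast
      ultimately have "t \<in> T ` V.module.span (N' \<union> (B - {b}))"
        using t span_image[of "N' \<union> (B - {b})"] by simp
      then obtain y where "y \<in> V.module.span (N' \<union> (B - {b}))" "T b = T y" using b by auto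
      then have "b \<in> V.module.span (N' \<union> (B - {b}))" using key[of b "B - {b}" y] b Bs by blast
      then show False using Bs(3) b unfolding V.rel_indep_def by blast
    qed
  qed
  moreover have "W.module.span (N \<union> T ` B) = T ` M"
    using span_image[of "N' \<union> B"] Bs TN Bc Mc by (simp add: image_Un)
  ultimately have "W.rel_basis N (T ` M) (T ` B)" unfolding W.rel_basis_def using Bs by blast
  then have "W.rdim N (T ` M) = ecard (T ` B)" using W.rdim_eqI Mc by blast
  also have "\<dots> = ecard B" using inj by (simp add: ecard_def card_image finite_image_iff)
  also have "\<dots> = V.rdim N' M" using V.rdim_eqI B Mc by simp
  finally show ?thesis by (simp add: N'_def)
qed

end

section \<open>Bases adapted to flags\<close>

context vectorspace
begin

text \<open>Indexed by all naturals and constant from \<open>m\<close> on, which keeps index bounds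
  out of the statements; starting at zero lets an adapted basis be built in layers from the empty
  set.\<close>

definition flag :: "'c set \<Rightarrow> nat \<Rightarrow> (nat \<Rightarrow> 'c set) \<Rightarrow> bool" where
  "flag M m L \<longleftrightarrow> (\<forall>i. submodule K (L i) V) \<and> mono L \<and> L 0 = {\<zero>\<^bsub>V\<^esub>} \<and> (\<forall>i\<ge>m. L i = M)"

definition adapted :: "(nat \<Rightarrow> 'c set) \<Rightarrow> 'c set \<Rightarrow> bool" where
  "adapted L B \<longleftrightarrow> rel_indep {} B \<and> B \<subseteq> \<Union>(range L) \<and> (\<forall>i. span (B \<inter> L i) = L i)"

lemma flag_top: "flag M m L \<Longrightarrow> \<Union>(range L) = M"
proof -
  assume *: "flag M m L"
  have "L i \<subseteq> M" for i
    using monoD[of L i "max i m"] * unfolding flag_def by (metis max.cobounded1 max.cobounded2)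
  moreover have "L m = M" using * unfolding flag_def by simp
  ultimately show ?thesis by blast
qed

lemma adapted_rel_basis:
  assumes "flag M m L" "adapted L B"
  shows "rel_basis {} M B"
proof -
  have "B \<inter> L m = B" "L m = M"
    using assms flag_top[OF assms(1)] unfolding adapted_def flag_def by auto
  then show ?thesis using assms(2) unfolding adapted_def rel_basis_def
    by (metis Int_lower2 sup_bot_left)
qed

lemma rel_indep_nonzero: "rel_indep {} B \<Longrightarrow> \<zero>\<^bsub>V\<^esub> \<notin> B"
  using submodule_zero[OF span_is_submodule, of "B - {\<zero>\<^bsub>V\<^esub>}"] unfolding rel_indep_def by auto

text \<open>A basis of each quotient \<open>L (Suc i) / L i\<close> is chosen and the
  representatives are collected. The hypothesis on \<open>B0\<close> makes its members in
  \<open>L (Suc i)\<close> outside \<open>L i\<close> independent modulo \<open>L i\<close>, so each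
  choice can be made to contain them.\<close>

lemma adapted_extend:
  assumes L: "flag M m L" and W: "submodule K W V" "W \<subseteq> M"
    and B0: "B0 \<subseteq> W" "rel_indep {} B0" "\<And>i. span (B0 \<inter> L i) = W \<inter> L i"
  shows "\<exists>B. B0 \<subseteq> B \<and> adapted L B"
proof -
  have Ls: "submodule K (L i) V" for i using L by (simp add: flag_def)
  have Lc: "L i \<subseteq> carrier V" for i using Ls submodule_subset by blast
  have Lm: "L i \<subseteq> L j" if "i \<le> j" for i j using L that by (simp add: flag_def monoD)
  have L0: "L 0 = {\<zero>\<^bsub>V\<^esub>}" using L by (simp add: flag_def)
  have LM: "L m = M" using L by (simp add: flag_def)
  have B0c: "B0 \<subseteq> carrier V" using B0(2) by (simp add: rel_indep_def)
  have "\<exists>C. B0 \<inter> L (Suc i) - L i \<subseteq> C \<and> rel_basis (L i) (L (Suc i)) C" for i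
  proof (rule rel_basis_extend[OF Ls Lm])
    show "rel_indep (L i) (B0 \<inter> L (Suc i) - L i)"
      unfolding rel_indep_def
    proof (intro conjI ballI)
      show "B0 \<inter> L (Suc i) - L i \<subseteq> carrier V" using B0c by blast
      fix c assume c: "c \<in> B0 \<inter> L (Suc i) - L i"
      define D where "D = B0 \<inter> L (Suc i) - L i - {c}"
      have Dc: "D \<subseteq> carrier V" "D \<subseteq> W" using B0c B0(1) unfolding D_def by blast+
      have "c \<notin> span (L i \<union> D)"
      proof
        assume "c \<in> span (L i \<union> D)"
        then obtain n w where nw: "n \<in> L i" "w \<in> span D" "c = n \<oplus>\<^bsub>V\<^esub> w"
          using span_Un_decomp[OF Ls Dc(1)] by blast
        have wW: "w \<in> W" using nw(2) span_least[OF W(1) Dc(2)] by blast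
        have cW: "c \<in> W" using c B0(1) by blast
        \<comment> \<open>\<open>n\<close> is a difference of vectors of \<open>W\<close>, hence
          lies in the span of \<open>B0 \<inter> L i\<close>, a set that does not contain
          \<open>c\<close>.\<close>
        have "c \<ominus>\<^bsub>V\<^esub> w = n"
          unfolding nw(3)
          by (rule add_minus_cancel') (use nw(1) Lc wW W(1) submodule_subset in blast)+
        moreover have "c \<ominus>\<^bsub>V\<^esub> w \<in> W" by (rule submodule_minus[OF W(1) cW wW])
        ultimately have "n \<in> span (B0 \<inter> L i)" using nw(1) B0(3)[of i] by simp
        then have n: "n \<in> span (B0 - {c})" using span_is_monotone[of "B0 \<inter> L i" "B0 - {c}"] c by blast
        have w: "w \<in> span (B0 - {c})" using nw(2) span_is_monotone[of D "B0 - {c}"] unfolding D_def by blast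
        have "B0 - {c} \<subseteq> carrier V" using B0c by blast
        then have "c \<in> span (B0 - {c})" using submodule_add[OF span_is_submodule n w] nw(3) by simp
        then show False using B0(2) c unfolding rel_indep_def by simp
      qed
      then show "c \<notin> span (L i \<union> (B0 \<inter> L (Suc i) - L i - {c}))" by (simp add: D_def)
    qed
  qed auto
  then obtain C where C: "\<And>i. B0 \<inter> L (Suc i) - L i \<subseteq> C i" "\<And>i. rel_basis (L i) (L (Suc i)) (C i)"
    by metis
  define U where "U i = (\<Union>j<i. C j)" for i
  have U: "rel_basis {} (L i) (U i)" for i
  proof (induction i)
    case 0
    show ?case by (simp add: U_def rel_basis_def rel_indep_def L0 span_empty)
  next
    case (Suc i)
    have "rel_basis {} (L (Suc i)) (U i \<union> C i)"
      by (rule rel_basis_Un[OF Ls _ Lm Suc.IH C(2)]) auto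
    then show ?case by (simp add: U_def lessThan_Suc Un_commute)
  qed
  have disj: "C j \<inter> L i = {}" if "i \<le> j" for i j
    using rel_indep_notin[of "L j" "C j"] C(2)[of j] Lc[of j] Lm[OF that]
    unfolding rel_basis_def by blast
  \<comment> \<open>The layers from \<open>i\<close> on avoid \<open>L i\<close>, so only the layers
    before \<open>i\<close> survive the intersection.\<close>
  have inter: "U m \<inter> L i = U (min i m)" for i
  proof (cases "i \<le> m")
    case True
    have "U m = U i \<union> (\<Union>j\<in>{i..<m}. C j)"
      using True ivl_disj_un_one(2)[of i m] unfolding U_def by (metis UN_Un)
    moreover have "(\<Union>j\<in>{i..<m}. C j) \<inter> L i = {}" using disj[of i] by (auto simp: disjoint_iff)
    moreover have "U i \<subseteq> L i" using U[of i] by (simp add: rel_basis_def)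
    ultimately show ?thesis using True by (simp add: min_def) blast
  next
    case False
    then have "U m \<subseteq> L i" using U[of m] Lm[of m i] by (auto simp: rel_basis_def)
    then show ?thesis using False by (auto simp: min_def)
  qed
  have "adapted L (U m)"
    unfolding adapted_def
  proof (intro conjI allI)
    show "rel_indep {} (U m)" using U by (simp add: rel_basis_def)
    show "U m \<subseteq> \<Union>(range L)" using U[of m] by (auto simp: rel_basis_def)
    fix i
    have "L (min i m) = L i" using L by (auto simp: flag_def min_def)
    then show "span (U m \<inter> L i) = L i"
      unfolding inter using U[of "min i m"] by (simp add: rel_basis_def)
  qed
  moreover have "B0 \<subseteq> U m"
  proof
    fix b assume b: "b \<in> B0"
    then have bm: "b \<in> L m" using B0(1) W(2) LM by blast
    \<comment> \<open>The first step containing \<open>b\<close> is not step 0, as \<open>b\<close>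
      is nonzero; \<open>b\<close> was put into the layer leading to this step.\<close>
    define i where "i = (LEAST i. b \<in> L i)"
    have i: "b \<in> L i" unfolding i_def using bm by (rule LeastI)
    have im: "i \<le> m" unfolding i_def using bm by (rule Least_le)
    have "i \<noteq> 0"
    proof
      assume "i = 0"
      then have "b = \<zero>\<^bsub>V\<^esub>" using i L0 by simp
      then show False using rel_indep_nonzero[OF B0(2)] b by blast
    qed
    then obtain k where k: "i = Suc k" using not0_implies_Suc by blast
    then have "b \<notin> L k" using not_less_Least[of k "\<lambda>i. b \<in> L i"] i_def by simp
    then have "b \<in> C k" using C(1)[of k] b i k by blast
    then show "b \<in> U m" using im k by (auto simp: U_def)
  qed
  ultimately show ?thesis by blast
qed

lemma adapted_exists:
  assumes "flag M m L"
  shows "\<exists>B. adapted L B"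
proof -
  have "\<zero>\<^bsub>V\<^esub> \<in> L i" for i using assms submodule_zero unfolding flag_def by blast
  moreover have "L m = M" using assms by (simp add: flag_def)
  ultimately show ?thesis
    using adapted_extend[OF assms submodule_zero_set, of "{}"] span_empty
    by (auto simp: rel_indep_def)
qed

end

text \<open>In these bases \<open>T\<close> is a partial matching: a basis vector is killed or sent
  to a basis vector, and no two of them to the same one.\<close>

definition basis_compatible ::
  "('k, 'w, 'm) module_scheme \<Rightarrow> ('v \<Rightarrow> 'w) \<Rightarrow> 'v set \<Rightarrow> 'w set \<Rightarrow> bool" where
  "basis_compatible W T B C \<longleftrightarrow>
     (\<forall>b\<in>B. T b = \<zero>\<^bsub>W\<^esub> \<or> T b \<in> C) \<and> inj_on T {b \<in> B. T b \<noteq> \<zero>\<^bsub>W\<^esub>}"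

section \<open>Transport of flags and adapted bases along a linear map\<close>

context linear_map
begin

text \<open>\<open>T\<close> need not be onto, so the flag of images gets one more step at the
  top.\<close>

lemma flag_image:
  assumes "V.flag (carrier V) m L"
  shows "W.flag (carrier W) (Suc m) (\<lambda>i. if i \<le> m then T ` L i else carrier W)"
  unfolding W.flag_def
proof (intro conjI allI)
  have L: "submodule K (L i) V" "L 0 = {\<zero>\<^bsub>V\<^esub>}" "mono L" for i
    using assms by (auto simp: V.flag_def)
  show "submodule K (if i \<le> m then T ` L i else carrier W) W" for i
    using image_submodule[OF L(1)] W.submodule_carrier by auto
  show "mono (\<lambda>i. if i \<le> m then T ` L i else carrier W)"
  proof (rule monoI)
    fix i j :: nat assume "i \<le> j"
    then show "(if i \<le> m then T ` L i else carrier W) \<subseteq> (if j \<le> m then T ` L j else carrier W)"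
      using monoD[OF L(3), of i j] W.submodule_subset[OF image_submodule[OF L(1)], of i] by auto
  qed
qed (use assms in \<open>auto simp: V.flag_def\<close>)

text \<open>The preimage of zero is the kernel, so the flag of preimages gets zero as one more step
  at the bottom.\<close>

lemma flag_vimage:
  assumes "W.flag (carrier W) m L"
  shows "V.flag (carrier V) (Suc m)
    (\<lambda>i. case i of 0 \<Rightarrow> {\<zero>\<^bsub>V\<^esub>} | Suc k \<Rightarrow> {x \<in> carrier V. T x \<in> L k})"
    (is "V.flag _ _ ?L")
  unfolding V.flag_def
proof (intro conjI allI)
  have L: "submodule K (L i) W" "L 0 = {\<zero>\<^bsub>W\<^esub>}" "mono L" for i
    using assms by (auto simp: W.flag_def)
  show s: "submodule K (?L i) V" for i
    using vimage_submodule[OF V.submodule_carrier L(1)] V.submodule_zero_set by (cases i) auto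
  show "mono ?L"
  proof (rule monoI)
    fix i j :: nat assume ij: "i \<le> j"
    show "?L i \<subseteq> ?L j"
    proof (cases i)
      case 0
      then show ?thesis using V.submodule_zero[OF s[of j]] by simp
    next
      case (Suc k)
      then obtain l where "j = Suc l" "k \<le> l" using ij by (cases j) auto
      then show ?thesis using Suc monoD[OF L(3), of k l] by auto
    qed
  qed
  show "Suc m \<le> i \<longrightarrow> ?L i = carrier V" for i
    using assms by (cases i) (auto simp: W.flag_def)
qed simp

text \<open>\<open>B\<close> consists of a basis of the kernel, adapted to the flag cut down to it,
  and of one lift of each element of \<open>B'\<close> in the image. Each lift is taken at the
  lowest possible step; this is what makes the union adapted.\<close>

lemma adapted_pullback:
  assumes L: "V.flag (carrier V) m L"
    and B': "W.adapted (\<lambda>i. if i \<le> m then T ` L i else carrier W) B'"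
  shows "\<exists>B. V.adapted L B \<and> basis_compatible W T B B'"
proof -
  define ker where "ker = {x \<in> carrier V. T x \<in> {\<zero>\<^bsub>W\<^esub>}}"
  have Ls: "submodule K (L i) V" and Lm: "mono L" and L0: "L 0 = {\<zero>\<^bsub>V\<^esub>}"
    and Lt: "i \<ge> m \<Longrightarrow> L i = carrier V" for i
    using L by (auto simp: V.flag_def)
  have Lc: "L i \<subseteq> carrier V" for i using Ls V.submodule_subset by blast
  have ker: "submodule K ker V" unfolding ker_def
    by (rule vimage_submodule[OF V.submodule_carrier W.submodule_zero_set])
  have kerc: "ker \<subseteq> carrier V" unfolding ker_def by blast
  have B'c: "B' \<subseteq> carrier W" and B'i: "W.rel_indep {} B'"
    using B' by (auto simp: W.adapted_def W.rel_indep_def)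
  have B's: "W.module.span (B' \<inter> T ` L i) = T ` L i" if "i \<le> m" for i
  proof -
    have "W.module.span (B' \<inter> (if i \<le> m then T ` L i else carrier W))
      = (if i \<le> m then T ` L i else carrier W)"
      using B' by (simp add: W.adapted_def)
    then show ?thesis using that by simp
  qed
  have "V.flag ker m (\<lambda>i. L i \<inter> ker)"
  proof -
    have "mono (\<lambda>i. L i \<inter> ker)" using Lm unfolding mono_def by blast
    then show ?thesis
      unfolding V.flag_def
      using V.submodule_Int[OF Ls ker] L0 Lt V.submodule_zero[OF ker] kerc by auto
  qed
  then obtain D where D: "V.adapted (\<lambda>i. L i \<inter> ker) D" and Db: "V.rel_basis {} ker D"
    using V.adapted_exists V.adapted_rel_basis by blast
  have "\<exists>x\<in>carrier V. T x = b \<and> (\<forall>i. b \<in> T ` L i \<longrightarrow> x \<in> L i)" if b: "b \<in> B' \<inter> T ` carrier V" for b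
  proof -
    have bm: "b \<in> T ` L m" using b Lt by simp
    define i where "i = (LEAST i. b \<in> T ` L i)"
    have "b \<in> T ` L i" unfolding i_def using bm by (rule LeastI)
    then obtain x where x: "x \<in> L i" "T x = b" by blast
    have "x \<in> L j" if "b \<in> T ` L j" for j
    proof -
      have "i \<le> j" unfolding i_def using that by (rule Least_le)
      then show ?thesis using monoD[OF Lm] x by blast
    qed
    then show ?thesis using x Lc by blast
  qed
  then obtain g where g: "\<And>b. b \<in> B' \<inter> T ` carrier V \<Longrightarrow> g b \<in> carrier V"
    "\<And>b. b \<in> B' \<inter> T ` carrier V \<Longrightarrow> T (g b) = b"
    "\<And>b i. b \<in> B' \<inter> T ` carrier V \<Longrightarrow> b \<in> T ` L i \<Longrightarrow> g b \<in> L i"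
    by metis
  define C where "C = g ` (B' \<inter> T ` carrier V)"
  have Cc: "C \<subseteq> carrier V" using g(1) unfolding C_def by blast
  have TC: "T ` C \<subseteq> B'" using g(2) unfolding C_def by auto
  have injC: "inj_on T C" using g(2) unfolding C_def by (auto simp: inj_on_def)
  have T0: "T x = \<zero>\<^bsub>W\<^esub>" if "x \<in> ker" for x using that by (simp add: ker_def)
  have Cind: "V.rel_indep ker C"
    unfolding V.rel_indep_def
  proof (intro conjI ballI Cc)
    fix c assume c: "c \<in> C"
    show "c \<notin> V.module.span (ker \<union> (C - {c}))"
    proof
      assume *: "c \<in> V.module.span (ker \<union> (C - {c}))"
      have sc: "C - {c} \<subseteq> carrier V" using Cc by blast
      obtain n w where nw: "n \<in> ker" "w \<in> V.module.span (C - {c})" "c = n \<oplus>\<^bsub>V\<^esub> w"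
        using V.span_Un_decomp[OF ker sc *] by blast
      have wc: "w \<in> carrier V" using nw(2) V.module.span_is_subset2[OF sc] by blast
      have nc: "n \<in> carrier V" using nw(1) kerc by blast
      have "T c = T n \<oplus>\<^bsub>W\<^esub> T w" unfolding nw(3) using wc nc by simp
      then have "T c = T w" using wc T0[OF nw(1)] by simp
      then have "T c \<in> W.module.span (T ` (C - {c}))" using nw(2) span_image[OF sc] by blast
      moreover have "T ` (C - {c}) \<subseteq> B' - {T c}" using TC injC c by (auto simp: inj_on_def)
      ultimately have "T c \<in> W.module.span (B' - {T c})" using W.module.span_is_monotone by blast
      then show False using B'i TC c unfolding W.rel_indep_def by auto
    qed
  qed
  have Dker: "D \<subseteq> ker" and Di: "V.rel_indep {} D" using Db by (auto simp: V.rel_basis_def)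
  have Ds: "V.module.span (D \<inter> (L i \<inter> ker)) = L i \<inter> ker" for i
    using D unfolding V.adapted_def by blast
  have "V.adapted L (D \<union> C)"
    unfolding V.adapted_def
  proof (intro conjI allI)
    show "V.rel_indep {} (D \<union> C)" by (rule V.rel_indep_Un[OF ker _ Dker Di Cind]) simp
    show "D \<union> C \<subseteq> \<Union>(range L)" using Dker kerc Cc V.flag_top[OF L] by blast
    fix i
    let ?S = "(D \<union> C) \<inter> L i"
    have Sc: "?S \<subseteq> carrier V" using Lc by blast
    show "V.module.span ?S = L i"
    proof
      show "V.module.span ?S \<subseteq> L i" by (rule V.span_least[OF Ls]) blast
      show "L i \<subseteq> V.module.span ?S"
      proof
        fix x assume x: "x \<in> L i"
        \<comment> \<open>The flag on \<open>W\<close> is given by images only up to index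
          \<open>m\<close>; from there on \<open>L\<close> is constant.\<close>
        define j where "j = min i m"
        have Lj: "L j = L i" unfolding j_def min_def using Lt by auto
        have "T x \<in> W.module.span (B' \<inter> T ` L j)" using x B's[of j] Lj unfolding j_def by auto
        moreover have "B' \<inter> T ` L j \<subseteq> T ` (C \<inter> L i)"
        proof
          fix b assume b: "b \<in> B' \<inter> T ` L j"
          then have b1: "b \<in> B' \<inter> T ` carrier V" using Lc by blast
          then have "g b \<in> C \<inter> L i" using g(3)[OF b1, of i] b Lj unfolding C_def by blast
          then show "b \<in> T ` (C \<inter> L i)" using g(2)[OF b1] by force
        qed
        moreover have CLc: "C \<inter> L i \<subseteq> carrier V" using Cc by blast
        ultimately have "T x \<in> T ` V.module.span (C \<inter> L i)"
          using W.module.span_is_monotone span_image[OF CLc] by blast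
        then obtain u where u: "u \<in> V.module.span (C \<inter> L i)" "T x = T u" by blast
        have uL: "u \<in> L i" using u(1) V.span_least[OF Ls[of i], of "C \<inter> L i"] by blast
        have xu: "x \<in> carrier V" "u \<in> carrier V" using x uL Lc by blast+
        have "T (x \<ominus>\<^bsub>V\<^esub> u) = \<zero>\<^bsub>W\<^esub>" using xu u(2) by simp
        then have "x \<ominus>\<^bsub>V\<^esub> u \<in> L i \<inter> ker"
          using V.submodule_minus[OF Ls x uL] Lc unfolding ker_def by blast
        then have 1: "x \<ominus>\<^bsub>V\<^esub> u \<in> V.module.span ?S"
          using Ds[of i] V.module.span_is_monotone[of "D \<inter> (L i \<inter> ker)" ?S] by blast
        have 2: "u \<in> V.module.span ?S" using u(1) V.module.span_is_monotone[of "C \<inter> L i" ?S] by blast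
        have "u \<oplus>\<^bsub>V\<^esub> (x \<ominus>\<^bsub>V\<^esub> u) \<in> V.module.span ?S"
          by (rule V.submodule_add[OF V.module.span_is_submodule[OF Sc] 2 1])
        then show "x \<in> V.module.span ?S" by (simp only: V.add_minus_cancel[OF xu])
      qed
    qed
  qed
  moreover have "basis_compatible W T (D \<union> C) B'"
    unfolding basis_compatible_def
  proof
    show "\<forall>b\<in>D \<union> C. T b = \<zero>\<^bsub>W\<^esub> \<or> T b \<in> B'" using T0 Dker TC by blast
    have "{b \<in> D \<union> C. T b \<noteq> \<zero>\<^bsub>W\<^esub>} \<subseteq> C" using T0 Dker by blast
    then show "inj_on T {b \<in> D \<union> C. T b \<noteq> \<zero>\<^bsub>W\<^esub>}" using injC inj_on_subset by blast
  qed
  ultimately show ?thesis by blast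
qed

text \<open>The step above zero in the flag of preimages is the kernel, so \<open>B'\<close>
  contains a basis of it and the other elements of \<open>B'\<close> stay independent under
  \<open>T\<close>. Their images are adapted to the traces of \<open>L\<close> on the image of
  \<open>T\<close>, and \<open>adapted_extend\<close> completes them.\<close>

lemma adapted_pushforward:
  assumes L: "W.flag (carrier W) m L"
    and B': "V.adapted (\<lambda>i. case i of 0 \<Rightarrow> {\<zero>\<^bsub>V\<^esub>} | Suc k \<Rightarrow> {x \<in> carrier V. T x \<in> L k}) B'"
  shows "\<exists>B. W.adapted L B \<and> basis_compatible W T B' B"
proof -
  define ker where "ker = {x \<in> carrier V. T x = \<zero>\<^bsub>W\<^esub>}"
  have Ls: "submodule K (L i) W" and L0: "L 0 = {\<zero>\<^bsub>W\<^esub>}" for i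
    using L by (auto simp: W.flag_def)
  have Bi: "V.rel_indep {} B'" and Bc: "B' \<subseteq> carrier V"
    using B' by (auto simp: V.adapted_def V.rel_indep_def)
  have Bs: "V.module.span (B' \<inter> {x \<in> carrier V. T x \<in> L k}) = {x \<in> carrier V. T x \<in> L k}" for k
  proof -
    have "V.module.span (B' \<inter> (case i of 0 \<Rightarrow> {\<zero>\<^bsub>V\<^esub>} | Suc k \<Rightarrow> {x \<in> carrier V. T x \<in> L k}))
      = (case i of 0 \<Rightarrow> {\<zero>\<^bsub>V\<^esub>} | Suc k \<Rightarrow> {x \<in> carrier V. T x \<in> L k})" for i
      using B' by (simp add: V.adapted_def)
    from this[of "Suc k"] show ?thesis by simp
  qed
  have Bker: "V.module.span (B' \<inter> ker) = ker"
    using Bs[of 0] by (simp add: ker_def L0)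
  define C where "C = B' - ker"
  have Cc: "C \<subseteq> carrier V" using Bc unfolding C_def by blast
  \<comment> \<open>The difference of \<open>c\<close> and \<open>y\<close> lies in the kernel,
    hence in the span of \<open>B' \<inter> ker\<close>, which does not involve
    \<open>c\<close>.\<close>
  have key: "c \<in> V.module.span (B' - {c})" if "c \<in> C" "y \<in> V.module.span S" "S \<subseteq> C - {c}" "T c = T y" for c y S
  proof -
    have Sc: "S \<subseteq> carrier V" using that Cc by blast
    have cy: "c \<in> carrier V" "y \<in> carrier V" using that Cc V.module.span_is_subset2[OF Sc] by blast+
    have "T (c \<ominus>\<^bsub>V\<^esub> y) = \<zero>\<^bsub>W\<^esub>" using cy that by simp
    then have "c \<ominus>\<^bsub>V\<^esub> y \<in> ker"       using V.submodule_minus[OF V.submodule_carrier cy] unfolding ker_def by blast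
    moreover have "B' \<inter> ker \<subseteq> B' - {c}" "S \<subseteq> B' - {c}" using that unfolding C_def by blast+
    ultimately have "c \<ominus>\<^bsub>V\<^esub> y \<in> V.module.span (B' - {c})" "y \<in> V.module.span (B' - {c})"
      using Bker V.module.span_is_monotone[of "B' \<inter> ker" "B' - {c}"] V.module.span_is_monotone[of S "B' - {c}"] that(2) by blast+
    moreover have sc: "B' - {c} \<subseteq> carrier V" using Bc by blast
    ultimately have "y \<oplus>\<^bsub>V\<^esub> (c \<ominus>\<^bsub>V\<^esub> y) \<in> V.module.span (B' - {c})"
      by (intro V.submodule_add[OF V.module.span_is_submodule[OF sc]])
    then show ?thesis by (simp only: V.add_minus_cancel[OF cy])
  qed
  have notin: "c \<notin> V.module.span (B' - {c})" if "c \<in> C" for c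
    using that Bi unfolding C_def V.rel_indep_def by simp
  have inj: "inj_on T C"
  proof (rule inj_onI, rule ccontr)
    fix b c assume *: "b \<in> C" "c \<in> C" "T b = T c" "b \<noteq> c"
    have "c \<in> V.module.span {c}" using V.module.in_own_span[of "{c}"] * Cc by blast
    then show False using key[of b c "{c}"] * notin by blast
  qed
  have ind: "W.rel_indep {} (T ` C)"
    unfolding W.rel_indep_def
  proof (intro conjI ballI)
    show "T ` C \<subseteq> carrier W" using Cc by auto
    fix t assume "t \<in> T ` C"
    then obtain c where c: "c \<in> C" "t = T c" by blast
    show "t \<notin> W.module.span ({} \<union> (T ` C - {t}))"
    proof
      assume "t \<in> W.module.span ({} \<union> (T ` C - {t}))"
      moreover have "{} \<union> (T ` C - {t}) = T ` (C - {c})" using c inj by (auto simp: inj_on_def)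
      moreover have "C - {c} \<subseteq> carrier V" using Cc by blast
      ultimately have "t \<in> T ` V.module.span (C - {c})" using span_image[of "C - {c}"] by simp
      then obtain y where "y \<in> V.module.span (C - {c})" "T c = T y" using c by auto
      then show False using key[OF c(1), of y "C - {c}"] notin[OF c(1)] by blast
    qed
  qed
  have im: "submodule K (T ` carrier V) W" by (rule image_submodule[OF V.submodule_carrier])
  have sp: "W.module.span (T ` C \<inter> L i) = T ` carrier V \<inter> L i" for i
  proof
    show "W.module.span (T ` C \<inter> L i) \<subseteq> T ` carrier V \<inter> L i"
      by (rule W.span_least[OF W.submodule_Int[OF im Ls]]) (use Cc in blast)
    show "T ` carrier V \<inter> L i \<subseteq> W.module.span (T ` C \<inter> L i)"
    proof
      fix x assume "x \<in> T ` carrier V \<inter> L i"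
      then obtain y where y: "y \<in> carrier V" "T y \<in> L i" "x = T y" by blast
      let ?S = "B' \<inter> {x \<in> carrier V. T x \<in> L i}"
      have TCc: "T ` C \<inter> L i \<subseteq> carrier W" using Cc by auto
      have Sc: "?S \<subseteq> carrier V" by blast
      have "x \<in> W.module.span (T ` ?S)" using Bs[of i] y span_image[OF Sc] by blast
      moreover have "T ` ?S \<subseteq> W.module.span (T ` C \<inter> L i)"
      proof
        fix t assume "t \<in> T ` ?S"
        then obtain b where b: "b \<in> B'" "T b \<in> L i" "t = T b" by blast
        show "t \<in> W.module.span (T ` C \<inter> L i)"
        proof (cases "b \<in> ker")
          case True
          then show ?thesis using b W.submodule_zero[OF W.module.span_is_submodule[OF TCc]] by (simp add: ker_def)
        next
          case False
          then have "t \<in> T ` C \<inter> L i" using b unfolding C_def by blast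
          then show ?thesis using W.module.in_own_span[OF TCc] by blast
        qed
      qed
      ultimately show "x \<in> W.module.span (T ` C \<inter> L i)"
        using W.span_subset_span[OF TCc] by blast
    qed
  qed
  have "\<exists>B. T ` C \<subseteq> B \<and> W.adapted L B"
    by (rule W.adapted_extend[OF L im W.submodule_subset[OF im] _ ind sp]) (use Cc in blast)
  then obtain B where B: "T ` C \<subseteq> B" "W.adapted L B" by blast
  have "{b \<in> B'. T b \<noteq> \<zero>\<^bsub>W\<^esub>} \<subseteq> C" unfolding C_def ker_def by blast
  then have "inj_on T {b \<in> B'. T b \<noteq> \<zero>\<^bsub>W\<^esub>}" using inj inj_on_subset by blast
  moreover have "T b = \<zero>\<^bsub>W\<^esub> \<or> T b \<in> B" if "b \<in> B'" for b
    using that B(1) Bc unfolding C_def ker_def by blast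
  ultimately show ?thesis using B(2) unfolding basis_compatible_def by blast
qed

end

section \<open>Coordinates\<close>

context vectorspace
begin

text \<open>The coefficient of \<open>b\<close> in the expansion of \<open>v\<close> in the basis
  \<open>B\<close>; splitting off a single basis vector replaces sums over \<open>B\<close>.\<close>

definition coord :: "'c set \<Rightarrow> 'c \<Rightarrow> 'c \<Rightarrow> 'a" where
  "coord B b v = (THE c. c \<in> carrier K \<and> (\<exists>w\<in>span (B - {b}). v = w \<oplus>\<^bsub>V\<^esub> c \<odot>\<^bsub>V\<^esub> b))"

definition basis_of :: "'c set \<Rightarrow> bool" where
  "basis_of B \<longleftrightarrow> rel_basis {} (carrier V) B"

lemma basis_of_iff: "basis_of B \<longleftrightarrow> rel_indep {} B \<and> span B = carrier V"
  by (auto simp: basis_of_def rel_basis_def rel_indep_def)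

context
  fixes B assumes B: "basis_of B"
begin

lemma basis_closed: "B \<subseteq> carrier V"
  using B by (simp add: basis_of_iff rel_indep_def)

lemma basis_notin_span: "b \<in> B \<Longrightarrow> b \<notin> span (B - {b})"
  using B by (simp add: basis_of_iff rel_indep_def)

lemma basis_diff_closed: "B - {b} \<subseteq> carrier V"
  using basis_closed by blast

text \<open>If two coefficients differed, a nonzero multiple of \<open>b\<close> would lie in the
  span of the other basis vectors.\<close>

lemma coordI:
  assumes b: "b \<in> B" and c: "c \<in> carrier K" and w: "w \<in> span (B - {b})"
    and v: "v = w \<oplus>\<^bsub>V\<^esub> c \<odot>\<^bsub>V\<^esub> b"
  shows "coord B b v = c"
  unfolding coord_def
proof (rule the_equality)
  show "c \<in> carrier K \<and> (\<exists>w\<in>span (B - {b}). v = w \<oplus>\<^bsub>V\<^esub> c \<odot>\<^bsub>V\<^esub> b)" using c w v by blast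
  note sub = span_is_submodule[OF basis_diff_closed[of b]]
  have bc: "b \<in> carrier V" using b basis_closed by blast
  fix c' assume "c' \<in> carrier K \<and> (\<exists>w\<in>span (B - {b}). v = w \<oplus>\<^bsub>V\<^esub> c' \<odot>\<^bsub>V\<^esub> b)"
  then obtain w' where c': "c' \<in> carrier K" and w': "w' \<in> span (B - {b})"
    and v': "v = w' \<oplus>\<^bsub>V\<^esub> c' \<odot>\<^bsub>V\<^esub> b" by blast
  have wc: "w \<in> carrier V" "w' \<in> carrier V" using w w' span_is_subset2[OF basis_diff_closed] by blast+
  define e where "e = c' \<oplus>\<^bsub>K\<^esub> \<ominus>\<^bsub>K\<^esub> c"
  have ec: "e \<in> carrier K" using c c' by (simp add: e_def)
  have ce: "c' = e \<oplus>\<^bsub>K\<^esub> c" using c c' by (simp add: e_def R.a_assoc R.l_neg)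
  have "w \<oplus>\<^bsub>V\<^esub> c \<odot>\<^bsub>V\<^esub> b = (w' \<oplus>\<^bsub>V\<^esub> e \<odot>\<^bsub>V\<^esub> b) \<oplus>\<^bsub>V\<^esub> c \<odot>\<^bsub>V\<^esub> b"
    using v v' ce ec c wc bc by (simp add: smult_l_distr M.a_assoc)
  then have "w = w' \<oplus>\<^bsub>V\<^esub> e \<odot>\<^bsub>V\<^esub> b" using wc ec c bc by simp
  then have "w = e \<odot>\<^bsub>V\<^esub> b \<oplus>\<^bsub>V\<^esub> w'" using wc ec bc by (simp add: M.a_comm)
  then have "w \<ominus>\<^bsub>V\<^esub> w' = e \<odot>\<^bsub>V\<^esub> b" using add_minus_cancel'[of "e \<odot>\<^bsub>V\<^esub> b" w'] wc ec bc by simp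
  then have e: "e \<odot>\<^bsub>V\<^esub> b \<in> span (B - {b})" using submodule_minus[OF sub w w'] by simp
  have "e = \<zero>\<^bsub>K\<^esub>" using smult_cancel_mem[OF sub ec _ bc e] basis_notin_span[OF b] by blast
  then show "c' = c" using ce c by simp
qed

lemma coord_decomp:
  assumes "b \<in> B" "v \<in> carrier V"
  shows "\<exists>w\<in>span (B - {b}). v = w \<oplus>\<^bsub>V\<^esub> coord B b v \<odot>\<^bsub>V\<^esub> b" "coord B b v \<in> carrier K"
proof -
  have "v \<in> span (insert b (B - {b}))" using assms B by (simp add: basis_of_iff insert_absorb)
  moreover have "b \<in> carrier V" using assms basis_closed by blast
  ultimately obtain c w where "c \<in> carrier K" "w \<in> span (B - {b})" "v = w \<oplus>\<^bsub>V\<^esub> c \<odot>\<^bsub>V\<^esub> b"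
    using in_span_insert[OF basis_diff_closed] by blast
  then show "\<exists>w\<in>span (B - {b}). v = w \<oplus>\<^bsub>V\<^esub> coord B b v \<odot>\<^bsub>V\<^esub> b" "coord B b v \<in> carrier K"
    using coordI[OF assms(1)] by metis+
qed

lemma coord_add:
  assumes b: "b \<in> B" and u: "u \<in> carrier V" and v: "v \<in> carrier V"
  shows "coord B b (u \<oplus>\<^bsub>V\<^esub> v) = coord B b u \<oplus>\<^bsub>K\<^esub> coord B b v"
proof -
  obtain w x where wx: "w \<in> span (B - {b})" "u = w \<oplus>\<^bsub>V\<^esub> coord B b u \<odot>\<^bsub>V\<^esub> b"
    "x \<in> span (B - {b})" "v = x \<oplus>\<^bsub>V\<^esub> coord B b v \<odot>\<^bsub>V\<^esub> b"
    using coord_decomp[OF b u] coord_decomp[OF b v] by blast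
  have c: "w \<in> carrier V" "x \<in> carrier V" "b \<in> carrier V"
    using wx span_is_subset2[OF basis_diff_closed] b basis_closed by blast+
  note k = coord_decomp(2)[OF b u] coord_decomp(2)[OF b v]
  have "u \<oplus>\<^bsub>V\<^esub> v = (w \<oplus>\<^bsub>V\<^esub> coord B b u \<odot>\<^bsub>V\<^esub> b) \<oplus>\<^bsub>V\<^esub> (x \<oplus>\<^bsub>V\<^esub> coord B b v \<odot>\<^bsub>V\<^esub> b)"
    using wx(2,4) by simp
  also have "\<dots> = (w \<oplus>\<^bsub>V\<^esub> x) \<oplus>\<^bsub>V\<^esub> (coord B b u \<oplus>\<^bsub>K\<^esub> coord B b v) \<odot>\<^bsub>V\<^esub> b"
    using c k by (simp add: smult_l_distr M.a_ac)
  finally show ?thesis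
    using k submodule_add[OF span_is_submodule[OF basis_diff_closed] wx(1,3)]
    by (intro coordI[OF b]) auto
qed

lemma coord_smult:
  assumes b: "b \<in> B" and v: "v \<in> carrier V" and a: "a \<in> carrier K"
  shows "coord B b (a \<odot>\<^bsub>V\<^esub> v) = a \<otimes>\<^bsub>K\<^esub> coord B b v"
proof -
  obtain w where w: "w \<in> span (B - {b})" "v = w \<oplus>\<^bsub>V\<^esub> coord B b v \<odot>\<^bsub>V\<^esub> b"
    using coord_decomp[OF b v] by blast
  have c: "w \<in> carrier V" "b \<in> carrier V"
    using w span_is_subset2[OF basis_diff_closed] b basis_closed by blast+
  note k = coord_decomp(2)[OF b v]
  have "a \<odot>\<^bsub>V\<^esub> v = a \<odot>\<^bsub>V\<^esub> (w \<oplus>\<^bsub>V\<^esub> coord B b v \<odot>\<^bsub>V\<^esub> b)" using w(2) by simp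
  also have "\<dots> = a \<odot>\<^bsub>V\<^esub> w \<oplus>\<^bsub>V\<^esub> (a \<otimes>\<^bsub>K\<^esub> coord B b v) \<odot>\<^bsub>V\<^esub> b"
    using c k a by (simp add: smult_r_distr smult_assoc1)
  finally show ?thesis
    using k a submodule_smult[OF span_is_submodule[OF basis_diff_closed] a w(1)]
    by (intro coordI[OF b]) auto
qed

lemma coord_self: "b \<in> B \<Longrightarrow> coord B b b = \<one>\<^bsub>K\<^esub>"
  using submodule_zero[OF span_is_submodule[OF basis_diff_closed]] basis_closed
  by (intro coordI[where w = "\<zero>\<^bsub>V\<^esub>"]) auto

lemma coord_other: "b \<in> B \<Longrightarrow> b' \<in> B \<Longrightarrow> b' \<noteq> b \<Longrightarrow> coord B b b' = \<zero>\<^bsub>K\<^esub>"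
  using in_own_span[OF basis_diff_closed[of b]] basis_closed
  by (intro coordI[where w = b']) (auto simp: subset_iff)

lemma coord_zero: "b \<in> B \<Longrightarrow> coord B b \<zero>\<^bsub>V\<^esub> = \<zero>\<^bsub>K\<^esub>"
  using submodule_zero[OF span_is_submodule[OF basis_diff_closed]] basis_closed
  by (intro coordI[where w = "\<zero>\<^bsub>V\<^esub>"]) auto

text \<open>An induction principle: a property whose vectors form a subspace needs to be checked on
  the basis only.\<close>

lemma basis_induct:
  assumes "submodule K W V" "B \<subseteq> W" "v \<in> carrier V"
  shows "v \<in> W"
  using span_least[OF assms(1,2)] assms(3) B by (auto simp: basis_of_iff)

lemma coord_finite_support:
  assumes "v \<in> carrier V"
  shows "finite {b \<in> B. coord B b v \<noteq> \<zero>\<^bsub>K\<^esub>}"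
proof -
  let ?W = "{v \<in> carrier V. finite {b \<in> B. coord B b v \<noteq> \<zero>\<^bsub>K\<^esub>}}"
  have "submodule K ?W V"
  proof (rule submoduleI)
    show "\<zero>\<^bsub>V\<^esub> \<in> ?W" by (auto simp: coord_zero cong: conj_cong)
  next
    fix u v assume *: "u \<in> ?W" "v \<in> ?W"
    have "{b \<in> B. coord B b (u \<oplus>\<^bsub>V\<^esub> v) \<noteq> \<zero>\<^bsub>K\<^esub>}
        \<subseteq> {b \<in> B. coord B b u \<noteq> \<zero>\<^bsub>K\<^esub>} \<union> {b \<in> B. coord B b v \<noteq> \<zero>\<^bsub>K\<^esub>}"
      using * by (auto simp: coord_add)
    from finite_subset[OF this] show "u \<oplus>\<^bsub>V\<^esub> v \<in> ?W" using * by simp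
  next
    fix a v assume *: "a \<in> carrier K" "v \<in> ?W"
    have "{b \<in> B. coord B b (a \<odot>\<^bsub>V\<^esub> v) \<noteq> \<zero>\<^bsub>K\<^esub>} \<subseteq> {b \<in> B. coord B b v \<noteq> \<zero>\<^bsub>K\<^esub>}"
      using * by (auto simp: coord_smult)
    from finite_subset[OF this] show "a \<odot>\<^bsub>V\<^esub> v \<in> ?W" using * by simp
  qed auto
  moreover have "B \<subseteq> ?W"
  proof
    fix b assume b: "b \<in> B"
    then have "{b' \<in> B. coord B b' b \<noteq> \<zero>\<^bsub>K\<^esub>} \<subseteq> {b}" using coord_other by blast
    from finite_subset[OF this] show "b \<in> ?W" using b basis_closed by auto
  qed
  ultimately show ?thesis using basis_induct[OF _ _ assms] by blast
qed

lemma coord_eq_zeroD: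
  assumes "v \<in> carrier V" "\<And>b. b \<in> B \<Longrightarrow> coord B b v = \<zero>\<^bsub>K\<^esub>"
  shows "v = \<zero>\<^bsub>V\<^esub>"
proof -
  have step: "v \<in> span {}" if "finite F" "F \<subseteq> B" "v \<in> span F" for F
    using that
  proof (induction F)
    case (insert b F)
    have Fc: "F \<subseteq> carrier V" and b: "b \<in> B" "b \<in> carrier V"
      using insert.prems basis_closed by blast+
    obtain c w where cw: "c \<in> carrier K" "w \<in> span F" "v = w \<oplus>\<^bsub>V\<^esub> c \<odot>\<^bsub>V\<^esub> b"
      using in_span_insert[OF Fc b(2) insert.prems(2)] by blast
    have "w \<in> span (B - {b})" using cw(2) span_is_monotone[of F "B - {b}"] insert by blast
    then have "c = \<zero>\<^bsub>K\<^esub>" using coordI[OF b(1) cw(1) _ cw(3)] assms(2)[OF b(1)] by simp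
    moreover have "w \<in> carrier V" using cw(2) span_is_subset2[OF Fc] by blast
    ultimately have "v = w" using cw(3) b(2) by simp
    then show ?case using insert cw(2) by simp
  qed simp
  have "v \<in> span B" using assms(1) B by (simp add: basis_of_iff)
  then obtain F where "finite F" "F \<subseteq> B" "v \<in> span F" using span_finitary[of v B] by auto
  then show ?thesis using step[of F] span_empty by simp
qed

lemma coord_inject:
  assumes "u \<in> carrier V" "v \<in> carrier V" "\<And>b. b \<in> B \<Longrightarrow> coord B b u = coord B b v"
  shows "u = v"
proof -
  have c: "u \<ominus>\<^bsub>V\<^esub> v \<in> carrier V" using assms by simp
  have "coord B b (u \<ominus>\<^bsub>V\<^esub> v) = \<zero>\<^bsub>K\<^esub>" if "b \<in> B" for b
  proof -
    have "coord B b v \<oplus>\<^bsub>K\<^esub> coord B b (u \<ominus>\<^bsub>V\<^esub> v) = coord B b v"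
      using coord_add[OF that assms(2) c] assms that by (simp add: add_minus_cancel)
    then show ?thesis
      using coord_decomp(2)[OF that c] coord_decomp(2)[OF that assms(2)] by simp
  qed
  then have "u \<ominus>\<^bsub>V\<^esub> v = \<zero>\<^bsub>V\<^esub>" using coord_eq_zeroD[OF c] by blast
  then show ?thesis using add_minus_cancel[OF assms(1,2)] assms(2) by simp
qed

lemma coord_surj:
  assumes "\<And>b. b \<in> B \<Longrightarrow> a b \<in> carrier K" "finite {b \<in> B. a b \<noteq> \<zero>\<^bsub>K\<^esub>}"
  shows "\<exists>v\<in>carrier V. \<forall>b\<in>B. coord B b v = a b"
proof -
  have "\<exists>v\<in>carrier V. \<forall>b\<in>B. coord B b v = a b"
    if "finite F" "\<forall>b\<in>B. a b \<in> carrier K" "\<forall>b\<in>B - F. a b = \<zero>\<^bsub>K\<^esub>" for F and a :: "'c \<Rightarrow> 'a"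
    using that
  proof (induction F arbitrary: a)
    case empty
    then show ?case using coord_zero by (intro bexI[of _ "\<zero>\<^bsub>V\<^esub>"]) auto
  next
    case (insert x F)
    have "\<exists>v\<in>carrier V. \<forall>b\<in>B. coord B b v = (a(x := \<zero>\<^bsub>K\<^esub>)) b"
      by (rule insert.IH) (use insert.prems in auto)
    then obtain v where v: "v \<in> carrier V" "\<forall>b\<in>B. coord B b v = (a(x := \<zero>\<^bsub>K\<^esub>)) b" by blast
    show ?case
    proof (cases "x \<in> B")
      case False
      then show ?thesis using v by (intro bexI[of _ v]) auto
    next
      case True
      have x: "x \<in> carrier V" "a x \<in> carrier K" using True basis_closed insert.prems by blast+
      have "coord B b (v \<oplus>\<^bsub>V\<^esub> a x \<odot>\<^bsub>V\<^esub> x) = a b" if "b \<in> B" for b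
        using v x that True coord_self[OF True] coord_other[OF that True] insert.prems(1)
        by (cases "b = x") (auto simp: coord_add coord_smult)
      then show ?thesis using v x by (intro bexI[of _ "v \<oplus>\<^bsub>V\<^esub> a x \<odot>\<^bsub>V\<^esub> x"]) auto
    qed
  qed
  from this[OF assms(2), of a] show ?thesis using assms by blast
qed

end

end

section \<open>Coordinates of an image under a map compatible with the bases\<close>

context linear_map
begin

context
  fixes B C assumes B: "V.basis_of B" and C: "W.basis_of C" and comp: "basis_compatible W T B C"
begin

lemma coord_image_submodule:
  assumes "c \<in> C" "b \<in> B"
  shows "submodule K {v \<in> carrier V. W.coord C c (T v) = V.coord B b v} V"
  using assms B C by (intro V.submoduleI)
    (auto simp: W.coord_add V.coord_add W.coord_smult V.coord_smult W.coord_zero V.coord_zero)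

text \<open>Both sides are linear in \<open>v\<close>, so basis vectors suffice; compatibility
  ensures that no other basis vector is sent to \<open>T b\<close>.\<close>

lemma coord_image:
  assumes "b \<in> B" "T b \<in> C" "v \<in> carrier V"
  shows "W.coord C (T b) (T v) = V.coord B b v"
proof -
  have "W.coord C (T b) (T x) = V.coord B b x" if "x \<in> B" for x
  proof (cases "x = b")
    case True
    then show ?thesis using assms V.coord_self[OF B] W.coord_self[OF C] by simp
  next
    case False
    have "\<zero>\<^bsub>W\<^esub> \<notin> C" using W.rel_indep_nonzero[of C] C by (simp add: W.basis_of_iff)
    then have Tb: "T b \<noteq> \<zero>\<^bsub>W\<^esub>" using assms(2) by metis
    have "T x = \<zero>\<^bsub>W\<^esub> \<or> T x \<in> C \<and> T x \<noteq> T b"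
      using comp False that assms Tb unfolding basis_compatible_def inj_on_def by auto
    then show ?thesis
      using V.coord_other[OF B assms(1) that] False W.coord_other[OF C assms(2)]
        W.coord_zero[OF C assms(2)] by auto
  qed
  then show ?thesis
    using V.basis_induct[OF B coord_image_submodule[OF assms(2,1)] _ assms(3)] V.basis_closed[OF B]
    by blast
qed

lemma coord_image_zero:
  assumes "c \<in> C" "c \<notin> T ` B" "v \<in> carrier V"
  shows "W.coord C c (T v) = \<zero>\<^bsub>K\<^esub>"
proof -
  have "submodule K {v \<in> carrier V. W.coord C c (T v) = \<zero>\<^bsub>K\<^esub>} V"
    using assms(1) C by (intro V.submoduleI) (auto simp: W.coord_add W.coord_smult W.coord_zero)
  moreover have "W.coord C c (T x) = \<zero>\<^bsub>K\<^esub>" if "x \<in> B" for x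
    using comp that assms W.coord_zero[OF C assms(1)] W.coord_other[OF C assms(1), of "T x"]
    unfolding basis_compatible_def by force
  ultimately show ?thesis
    using V.basis_induct[OF B _ _ assms(3)] V.basis_closed[OF B] by blast
qed

end

end

section \<open>Bars of a system of partial matchings\<close>

text \<open>Follows matched elements backwards from a node and returns the node and the element
  where the path begins. The matchings have indices from 1 on, so a path from one of the nodes
  \<open>1, \<dots>, n\<close> never runs into node 0.\<close>

primrec path_start :: "(nat \<Rightarrow> 'v \<Rightarrow> 'v \<Rightarrow> bool) \<Rightarrow> nat \<Rightarrow> 'v \<Rightarrow> nat \<times> 'v" where
  "path_start R 0 b = (0, b)"
| "path_start R (Suc i) b =
     (if \<exists>a. R i a b then path_start R i (THE a. R i a b) else (Suc i, b))"

text \<open>The first argument bounds the number of remaining arrows; on nodes \<open>1, \<dots>, n\<close> it is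
  \<open>n - i\<close>.\<close>

primrec path_end :: "(nat \<Rightarrow> 'v \<Rightarrow> 'v \<Rightarrow> bool) \<Rightarrow> nat \<Rightarrow> nat \<Rightarrow> 'v \<Rightarrow> nat" where
  "path_end R 0 i b = i"
| "path_end R (Suc k) i b =
     (if \<exists>a. R i b a then path_end R k (Suc i) (THE a. R i b a) else i)"

definition alive :: "nat \<times> nat \<times> 'v \<Rightarrow> nat \<Rightarrow> bool" where
  "alive s i \<longleftrightarrow> fst s \<le> i \<and> i \<le> fst (snd s)"

text \<open>A bar is the triple of first node, last node and first element of a maximal path of matched
  elements; the three components are constant along a path.\<close>

lemma bars_of_partial_matchings:
  fixes E :: "nat \<Rightarrow> 'v set" and R :: "nat \<Rightarrow> 'v \<Rightarrow> 'v \<Rightarrow> bool"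
  assumes R: "\<And>i a b. R i a b \<Longrightarrow> 1 \<le> i \<and> i < n \<and> a \<in> E i \<and> b \<in> E (Suc i)"
    and right_unique: "\<And>i a b b'. R i a b \<Longrightarrow> R i a b' \<Longrightarrow> b = b'"
    and left_unique: "\<And>i a a' b. R i a b \<Longrightarrow> R i a' b \<Longrightarrow> a = a'"
  shows "\<exists>(S :: (nat \<times> nat \<times> 'v) set) \<sigma>. (\<forall>(p, q, l)\<in>S. 1 \<le> p \<and> p \<le> q \<and> q \<le> n) \<and>
    (\<forall>i\<in>{1..n}. bij_betw (\<sigma> i) (E i) {s \<in> S. alive s i}) \<and>
    (\<forall>i\<in>{1..<n}. \<forall>a\<in>E i. \<forall>b\<in>E (Suc i). \<sigma> i a = \<sigma> (Suc i) b \<longleftrightarrow> R i a b)"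
proof -
  define st where "st = path_start R"
  define en where "en i b = path_end R (n - i) i b" for i b
  define \<sigma> where "\<sigma> i b = (fst (st i b), en i b, snd (st i b))" for i b
  define S where "S = {\<sigma> i b | i b. i \<in> {1..n} \<and> b \<in> E i}"
  have st_Suc: "st (Suc i) b = st i a" if "R i a b" for i a b
  proof -
    have "(THE a. R i a b) = a" using that left_unique by blast
    then show ?thesis using that unfolding st_def by auto
  qed
  have st_new: "st (Suc i) b = (Suc i, b)" if "\<nexists>a. R i a b" for i b
    using that unfolding st_def by simp
  have en_Suc: "en i a = en (Suc i) b" if "R i a b" for i a b
  proof -
    have "n - i = Suc (n - Suc i)" using R[OF that] by auto
    moreover have "(THE b. R i a b) = b" using that right_unique by blast
    ultimately show ?thesis using that unfolding en_def by auto
  qed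
  have en_new: "en i a = i" if "\<nexists>b. R i a b" for i a
    using that unfolding en_def by (cases "n - i") auto
  have st_le: "fst (st i b) \<le> i" for i b
  proof (induction i arbitrary: b)
    case 0
    show ?case by (simp add: st_def)
  next
    case (Suc i)
    show ?case using Suc st_Suc st_new by (cases "\<exists>a. R i a b") (force simp: le_Suc_eq)+
  qed
  have st_ge: "1 \<le> fst (st i b)" if "1 \<le> i" for i b
    using that
  proof (induction i arbitrary: b)
    case (Suc i)
    show ?case using Suc.IH st_Suc st_new R by (cases "\<exists>a. R i a b") force+
  qed simp
  have "i \<le> path_end R k i b \<and> path_end R k i b \<le> i + k" for k i b
  proof (induction k arbitrary: i b)
    case (Suc k)
    from Suc[of "Suc i" "THE a. R i b a"] show ?case by auto
  qed simp
  then have en_bounds: "i \<le> en i b" "i \<le> n \<Longrightarrow> en i b \<le> n" for i b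
    unfolding en_def by (auto simp: le_diff_conv2) (metis le_add_diff_inverse)
  \<comment> \<open>At a given node the start of a path determines the element, because matched
    elements are unique to the right.\<close>
  have st_inj: "b = b'" if "st i b = st i b'" for i b b'
    using that
  proof (induction i arbitrary: b b')
    case 0
    then show ?case by (simp add: st_def)
  next
    case (Suc i)
    show ?case
    proof (cases "(\<exists>a. R i a b) \<or> (\<exists>a. R i a b')")
      case False
      then show ?thesis using Suc.prems st_new by auto
    next
      case True
      \<comment> \<open>A path through node \<open>i\<close> begins at a node at most
        \<open>i\<close>, so it is none of those beginning at \<open>Suc i\<close>.\<close>
      have n: "st i a \<noteq> (Suc i, c)" for a c using st_le[of i a] by auto
      have "(\<exists>a. R i a b) \<and> (\<exists>a. R i a b')"
        using True Suc.prems st_Suc st_new n by metis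
      then obtain a a' where "R i a b" "R i a' b'" by blast
      then show ?thesis using Suc st_Suc right_unique by metis
    qed
  qed
  have \<sigma>_Suc: "\<sigma> i a = \<sigma> (Suc i) b" if "R i a b" for i a b
    using st_Suc[OF that] en_Suc[OF that] by (simp add: \<sigma>_def)
  have \<sigma>_inj: "b = b'" if "\<sigma> i b = \<sigma> i b'" for i b b'
    by (rule st_inj[of i]) (use that in \<open>simp add: \<sigma>_def prod_eq_iff\<close>)
  have alive_\<sigma>: "alive (\<sigma> i b) i" for i b
    using st_le en_bounds(1) by (simp add: alive_def \<sigma>_def)
  have pred: "\<exists>a. R i a b" if "alive (\<sigma> (Suc i) b) i" for i b
    using that st_new[of i b] by (force simp: alive_def \<sigma>_def)
  have succ: "\<exists>b. R i a b" if "alive (\<sigma> i a) (Suc i)" for i a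
    using that en_new[of i a] by (force simp: alive_def \<sigma>_def)
  \<comment> \<open>A bar alive at \<open>i\<close> passes through an element of \<open>E i\<close>:
    its path is followed forwards here and backwards in the next claim.\<close>
  have up: "\<exists>b'\<in>E i. \<sigma> i b' = \<sigma> j b" if "j \<le> i" "b \<in> E j" "alive (\<sigma> j b) i" for i j b
    using that
  proof (induction i rule: dec_induct)
    case (step k)
    have "alive (\<sigma> j b) k" using step alive_\<sigma>[of j b] by (simp add: alive_def)
    then obtain b' where b': "b' \<in> E k" "\<sigma> k b' = \<sigma> j b" using step by blast
    then obtain c where "R k b' c" using succ[of k b'] step by auto
    then show ?case using \<sigma>_Suc R b' by metis
  qed blast
  have down: "\<exists>b'\<in>E i. \<sigma> i b' = \<sigma> j b" if "i \<le> j" "b \<in> E j" "alive (\<sigma> j b) i" for i j b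
    using that
  proof (induction i rule: inc_induct)
    case (step k)
    have "alive (\<sigma> j b) (Suc k)" using step alive_\<sigma>[of j b] by (simp add: alive_def)
    then obtain b' where b': "b' \<in> E (Suc k)" "\<sigma> (Suc k) b' = \<sigma> j b" using step by blast
    then obtain c where "R k c b'" using pred[of k b'] step by auto
    then show ?case using \<sigma>_Suc R b' by metis
  qed blast
  have range: "1 \<le> p \<and> p \<le> q \<and> q \<le> n" if pql: "(p, q, l) \<in> S" for p q l
  proof -
    obtain i b where "(p, q, l) = \<sigma> i b" "i \<in> {1..n}" using pql unfolding S_def by blast
    then show ?thesis
      using st_ge[of i b] st_le[of i b] en_bounds[of i b] by (auto simp: \<sigma>_def)
  qed
  have bij: "bij_betw (\<sigma> i) (E i) {s \<in> S. alive s i}" if i: "i \<in> {1..n}" for i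
    unfolding bij_betw_def
  proof
    show "inj_on (\<sigma> i) (E i)" using \<sigma>_inj by (auto intro: inj_onI)
    show "\<sigma> i ` E i = {s \<in> S. alive s i}"
    proof
      show "\<sigma> i ` E i \<subseteq> {s \<in> S. alive s i}" using alive_\<sigma> i unfolding S_def by blast
      show "{s \<in> S. alive s i} \<subseteq> \<sigma> i ` E i"
      proof
        fix s assume "s \<in> {s \<in> S. alive s i}"
        then obtain j b where "s = \<sigma> j b" "b \<in> E j" "alive (\<sigma> j b) i" unfolding S_def by blast
        then show "s \<in> \<sigma> i ` E i" using up[of j i b] down[of i j b] linear[of i j] by force
      qed
    qed
  qed
  have eq_iff: "\<sigma> i a = \<sigma> (Suc i) b \<longleftrightarrow> R i a b" for i a b
  proof
    assume eq: "\<sigma> i a = \<sigma> (Suc i) b"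
    then have "alive (\<sigma> (Suc i) b) i" using alive_\<sigma>[of i a] by simp
    then obtain a' where a': "R i a' b" using pred by blast
    then show "R i a b" using \<sigma>_Suc[OF a'] \<sigma>_inj eq by metis
  qed (rule \<sigma>_Suc)
  show ?thesis
  proof (rule exI[of _ S], rule exI[of _ \<sigma>], intro conjI ballI)
    show "case s of (p, q, l) \<Rightarrow> 1 \<le> p \<and> p \<le> q \<and> q \<le> n" if "s \<in> S" for s
      using range that by (cases s) simp
  qed (use bij eq_iff in simp_all)
qed

section \<open>The direct sum of the interval modules of a set of bars\<close>

abbreviation bar_sum :: "'k ring \<Rightarrow> nat \<Rightarrow> (nat \<Rightarrow> bool) \<Rightarrow> (nat \<times> nat \<times> 'v) set
    \<Rightarrow> ('k, nat \<times> nat \<times> 'v \<Rightarrow> 'k) zigzag" where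
  "bar_sum K n d S \<equiv> zigzag_direct_sum n d S (\<lambda>(p, q, l). interval_module K n d p q)"

lemma bar_sum_sel:
  "zz_len (bar_sum K n d S) = n" "zz_fwd (bar_sum K n d S) = d"
  by (simp_all add: zigzag_direct_sum_def)

text \<open>\<open>scalar_space\<close> and \<open>zero_space\<close> differ only in their carriers,
  so the direct sum can be described by finitely supported families of scalars that vanish on the
  bars not alive at \<open>j\<close>.\<close>

lemma bar_space:
  fixes K :: "'k ring" (structure) and S :: "(nat \<times> nat \<times> 'v) set"
  assumes "field K"
  shows
  "carrier (zz_space (bar_sum K n d S) j) =
     {x \<in> extensional S. (\<forall>s\<in>S. x s \<in> carrier K) \<and> (\<forall>s\<in>S. \<not> alive s j \<longrightarrow> x s = \<zero>) \<and>
       finite {s \<in> S. x s \<noteq> \<zero>}}" (is ?C)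
  "x \<oplus>\<^bsub>zz_space (bar_sum K n d S) j\<^esub> y = (\<lambda>s\<in>S. x s \<oplus> y s)" (is ?A)
  "\<zero>\<^bsub>zz_space (bar_sum K n d S) j\<^esub> = (\<lambda>s\<in>S. \<zero>)" (is ?Z)
  "c \<odot>\<^bsub>zz_space (bar_sum K n d S) j\<^esub> x = (\<lambda>s\<in>S. c \<otimes> x s)" (is ?M)
  "zz_map (bar_sum K n d S) j x = (\<lambda>s\<in>S. if alive s j \<and> alive s (Suc j) then x s else \<zero>)" (is ?F)
proof -
  interpret field K by fact
  have sp: "zz_space ((\<lambda>(p, q, l). interval_module K n d p q) s) j
      = (if alive s j then scalar_space K else zero_space K)" for s :: "nat \<times> nat \<times> 'v"
    by (cases s) (simp add: interval_module_def alive_def)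
  have z: "\<zero>\<^bsub>if b then scalar_space K else zero_space K\<^esub> = \<zero>"
    "x \<oplus>\<^bsub>if b then scalar_space K else zero_space K\<^esub> y = x \<oplus> y"
    "x \<odot>\<^bsub>if b then scalar_space K else zero_space K\<^esub> y = x \<otimes> y"
    "carrier (if b then scalar_space K else zero_space K) = (if b then carrier K else {\<zero>})"
    for b x y by (auto simp: scalar_space_def zero_space_def)
  show ?C
    unfolding zigzag_direct_sum_def zigzag.simps direct_sum_space_def partial_object.simps sp z
    by (auto simp: PiE_iff split: if_splits)
  show ?A ?Z ?M
    unfolding zigzag_direct_sum_def zigzag.simps direct_sum_space_def ring.simps module.simps sp z
    by auto
  have mp: "zz_map ((\<lambda>(p, q, l). interval_module K n d p q) s) j
      = (if alive s j \<and> alive s (Suc j) then id else (\<lambda>_. \<zero>))" for s :: "nat \<times> nat \<times> 'v"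
    by (cases s) (auto simp: interval_module_def alive_def)
  show ?F
    unfolding zigzag_direct_sum_def zigzag.simps mp by (auto simp: fun_eq_iff)
qed

lemma bar_space_vectorspace:
  fixes K :: "'k ring" (structure)
  assumes "field K"
  shows "vectorspace K (zz_space (bar_sum K n d S) j)"
proof -
  interpret field K by fact
  note bs = bar_space[OF assms]
  show ?thesis
  proof (rule vs_criteria)
    show "field K" by fact
    have fin: "finite {s \<in> S. x s \<oplus> y s \<noteq> \<zero>}"
      if "finite {s \<in> S. x s \<noteq> \<zero>}" "finite {s \<in> S. y s \<noteq> \<zero>}" for x y
      by (rule finite_subset[OF _ finite_UnI[OF that]]) auto
    have finm: "finite {s \<in> S. c \<otimes> x s \<noteq> \<zero>}"
      if "finite {s \<in> S. x s \<noteq> \<zero>}" "c \<in> carrier K" for x c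
      by (rule finite_subset[OF _ that(1)]) (use that(2) in auto)
    show "\<forall>v\<in>carrier (zz_space (bar_sum K n d S) j). \<exists>w\<in>carrier (zz_space (bar_sum K n d S) j).
        v \<oplus>\<^bsub>zz_space (bar_sum K n d S) j\<^esub> w = \<zero>\<^bsub>zz_space (bar_sum K n d S) j\<^esub>"
    proof
      fix v assume v: "v \<in> carrier (zz_space (bar_sum K n d S) j)"
      have "finite {s \<in> S. \<ominus> v s \<noteq> \<zero>}"
        by (rule finite_subset[of _ "{s \<in> S. v s \<noteq> \<zero>}"]) (use v in \<open>auto simp: bs\<close>)
      then show "\<exists>w\<in>carrier (zz_space (bar_sum K n d S) j).
          v \<oplus>\<^bsub>zz_space (bar_sum K n d S) j\<^esub> w = \<zero>\<^bsub>zz_space (bar_sum K n d S) j\<^esub>"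
        using v by (intro bexI[of _ "\<lambda>s\<in>S. \<ominus> v s"])
          (auto simp: bs fun_eq_iff r_neg cong: conj_cong)
    qed
    show "\<forall>v w. v \<in> carrier (zz_space (bar_sum K n d S) j) \<and> w \<in> carrier (zz_space (bar_sum K n d S) j)
        \<longrightarrow> v \<oplus>\<^bsub>zz_space (bar_sum K n d S) j\<^esub> w \<in> carrier (zz_space (bar_sum K n d S) j)"
      using fin by (auto simp: bs cong: conj_cong)
    show "\<forall>c v. c \<in> carrier K \<and> v \<in> carrier (zz_space (bar_sum K n d S) j)
        \<longrightarrow> c \<odot>\<^bsub>zz_space (bar_sum K n d S) j\<^esub> v \<in> carrier (zz_space (bar_sum K n d S) j)"
      using finm by (auto simp: bs cong: conj_cong)
  qed (auto simp: bs extensional_def fun_eq_iff restrict_def a_ac m_ac l_distr r_distr cong: conj_cong)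
qed

section \<open>Existence of interval decompositions\<close>

lemma linear_mapI:
  assumes "vectorspace K V" "vectorspace K W"
    and "\<And>x. x \<in> carrier V \<Longrightarrow> T x \<in> carrier W"
    and "\<And>x y. x \<in> carrier V \<Longrightarrow> y \<in> carrier V \<Longrightarrow> T (x \<oplus>\<^bsub>V\<^esub> y) = T x \<oplus>\<^bsub>W\<^esub> T y"
    and "\<And>c x. c \<in> carrier K \<Longrightarrow> x \<in> carrier V \<Longrightarrow> T (c \<odot>\<^bsub>V\<^esub> x) = c \<odot>\<^bsub>W\<^esub> T x"
  shows "linear_map K V W T"
  using assms
  by (auto simp: linear_map_def mod_hom_def mod_hom_axioms_def module_hom_def vectorspace_def)

text \<open>Basis vectors correspond to the bars alive at \<open>i\<close>, and the coordinate along
  a basis vector becomes the value at its bar.\<close>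

lemma bar_coordinates_iso:
  fixes K :: "'k ring" (structure) and X :: "('k, 'v) module"
    and S :: "(nat \<times> nat \<times> 'w) set"
  assumes K: "field K" and X: "vectorspace K X" and E: "vectorspace.basis_of K X E"
    and \<sigma>: "bij_betw \<sigma> E {s \<in> S. alive s i}"
  defines "\<phi> \<equiv> \<lambda>v. \<lambda>s\<in>S. if alive s i then vectorspace.coord K X E (inv_into E \<sigma> s) v else \<zero>"
  shows "linear_iso K X (zz_space (bar_sum K n d S) i) \<phi>"
proof -
  interpret K: field K by fact
  interpret X: vectorspace K X by fact
  note bs = bar_space[OF K]
  define \<tau> where "\<tau> = inv_into E \<sigma>"
  have \<tau>E: "\<tau> s \<in> E" and \<sigma>\<tau>: "\<sigma> (\<tau> s) = s" if "s \<in> S" "alive s i" for s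
    using that \<sigma> unfolding \<tau>_def bij_betw_def
    by (metis (mono_tags, lifting) inv_into_into mem_Collect_eq, metis (mono_tags, lifting) f_inv_into_f mem_Collect_eq)
  have \<tau>\<sigma>: "\<tau> (\<sigma> b) = b" and \<sigma>S: "\<sigma> b \<in> S" "alive (\<sigma> b) i" if "b \<in> E" for b
    using that \<sigma> unfolding \<tau>_def bij_betw_def by (auto simp: inv_into_f_f)
  have \<phi>: "\<phi> v s = (if alive s i then X.coord E (\<tau> s) v else \<zero>)" if "s \<in> S" for v s
    using that by (simp add: \<phi>_def \<tau>_def)
  have "finite {s \<in> S. \<phi> v s \<noteq> \<zero>}" if v: "v \<in> carrier X" for v
  proof (rule finite_subset)
    show "{s \<in> S. \<phi> v s \<noteq> \<zero>} \<subseteq> \<sigma> ` {b \<in> E. X.coord E b v \<noteq> \<zero>}"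
    proof
      fix s assume "s \<in> {s \<in> S. \<phi> v s \<noteq> \<zero>}"
      then have s: "s \<in> S" "alive s i" "X.coord E (\<tau> s) v \<noteq> \<zero>" by (auto simp: \<phi> split: if_splits)
      then show "s \<in> \<sigma> ` {b \<in> E. X.coord E b v \<noteq> \<zero>}"
        using \<tau>E[OF s(1,2)] by (intro image_eqI[of _ _ "\<tau> s"]) (auto simp: \<sigma>\<tau>)
    qed
    show "finite (\<sigma> ` {b \<in> E. X.coord E b v \<noteq> \<zero>})" using X.coord_finite_support[OF E v] by simp
  qed
  moreover have "\<phi> v \<in> extensional S" for v by (simp add: \<phi>_def)
  moreover have "\<phi> v s \<in> carrier K" if "v \<in> carrier X" "s \<in> S" for v s
    using that by (simp add: \<phi> X.coord_decomp(2)[OF E] \<tau>E)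
  ultimately have closed: "\<phi> v \<in> carrier (zz_space (bar_sum K n d S) i)" if "v \<in> carrier X" for v
    using that by (auto simp: bs \<phi>)
  have lin: "linear_map K X (zz_space (bar_sum K n d S) i) \<phi>"
  proof (rule linear_mapI[OF X bar_space_vectorspace[OF K] closed])
    show "\<phi> (x \<oplus>\<^bsub>X\<^esub> y) = \<phi> x \<oplus>\<^bsub>zz_space (bar_sum K n d S) i\<^esub> \<phi> y"
      if "x \<in> carrier X" "y \<in> carrier X" for x y
      using that by (auto simp: bs \<phi>_def \<tau>_def[symmetric] X.coord_add[OF E] \<tau>E fun_eq_iff)
    show "\<phi> (c \<odot>\<^bsub>X\<^esub> x) = c \<odot>\<^bsub>zz_space (bar_sum K n d S) i\<^esub> \<phi> x"
      if "c \<in> carrier K" "x \<in> carrier X" for c x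
      using that by (auto simp: bs \<phi>_def \<tau>_def[symmetric] X.coord_smult[OF E] \<tau>E fun_eq_iff)
  qed
  have "inj_on \<phi> (carrier X)"
  proof (rule inj_onI)
    fix u v assume uv: "u \<in> carrier X" "v \<in> carrier X" "\<phi> u = \<phi> v"
    have "X.coord E b u = X.coord E b v" if "b \<in> E" for b
      using fun_cong[OF uv(3), of "\<sigma> b"] \<sigma>S[OF that] \<tau>\<sigma>[OF that] by (simp add: \<phi>)
    then show "u = v" using X.coord_inject[OF E uv(1,2)] by blast
  qed
  moreover have "carrier (zz_space (bar_sum K n d S) i) \<subseteq> \<phi> ` carrier X"
  proof
    fix x assume "x \<in> carrier (zz_space (bar_sum K n d S) i)"
    then have x: "x \<in> extensional S" "\<And>s. s \<in> S \<Longrightarrow> x s \<in> carrier K"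
      "\<And>s. s \<in> S \<Longrightarrow> \<not> alive s i \<Longrightarrow> x s = \<zero>" "finite {s \<in> S. x s \<noteq> \<zero>}"
      by (auto simp: bs)
    have "finite {b \<in> E. x (\<sigma> b) \<noteq> \<zero>}"
    proof (rule finite_imageD)
      show "finite (\<sigma> ` {b \<in> E. x (\<sigma> b) \<noteq> \<zero>})"
        by (rule finite_subset[OF _ x(4)]) (use \<sigma>S in auto)
      show "inj_on \<sigma> {b \<in> E. x (\<sigma> b) \<noteq> \<zero>}"
        using \<sigma> unfolding bij_betw_def by (auto intro: inj_on_subset)
    qed
    then obtain v where v: "v \<in> carrier X" "\<forall>b\<in>E. X.coord E b v = x (\<sigma> b)"
      using X.coord_surj[OF E, of "\<lambda>b. x (\<sigma> b)"] x(2) \<sigma>S by blast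
    have "\<phi> v = x"
    proof (rule extensionalityI[of _ S])
      show "\<phi> v s = x s" if "s \<in> S" for s
        using that v(2) \<tau>E[OF that] \<sigma>\<tau>[OF that] x(3)[OF that] by (simp add: \<phi>)
    qed (use x(1) in \<open>auto simp: \<phi>_def\<close>)
    then show "x \<in> \<phi> ` carrier X" using v(1) by blast
  qed
  ultimately show ?thesis
    using lin closed unfolding linear_iso_def bij_betw_def by blast
qed

text \<open>The flag carried along is the filtration of a node by images and preimages from the part
  of the zigzag to its left. A forward arrow transports it by images and a backward arrow by
  preimages; \<open>adapted_pullback\<close> and \<open>adapted_pushforward\<close> are the
  corresponding steps for bases.\<close>

lemma compatible_bases_exist:
  assumes V: "zigzag_module K V" and n: "0 < zz_len V"
  shows "\<exists>E. (\<forall>i\<in>{1..zz_len V}. vectorspace.basis_of K (zz_space V i) (E i)) \<and>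
    (\<forall>i\<in>{1..<zz_len V}. basis_compatible (zz_space V (arrow_tgt (zz_fwd V) i)) (zz_map V i)
        (E (arrow_src (zz_fwd V) i)) (E (arrow_tgt (zz_fwd V) i)))"
proof -
  define X where "X = zz_space V"
  define f where "f = zz_map V"
  define src where "src = arrow_src (zz_fwd V)"
  define tgt where "tgt = arrow_tgt (zz_fwd V)"
  have vs: "vectorspace K (X i)" if "1 \<le> i" "i \<le> zz_len V" for i
    using V that by (simp add: zigzag_module_def X_def)
  have lin: "linear_map K (X (src i)) (X (tgt i)) (f i)" if "1 \<le> i" "i < zz_len V" for i
    using V that by (simp add: zigzag_module_def X_def f_def src_def tgt_def)
  define good where "good k E \<longleftrightarrow> (\<forall>i\<in>{1..k}. vectorspace.basis_of K (X i) (E i)) \<and>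
    (\<forall>i\<in>{1..<k}. basis_compatible (X (tgt i)) (f i) (E (src i)) (E (tgt i)))" for k E
  have good_Suc: "good (Suc k) (E(Suc k := B'))"
    if "1 \<le> k" "good k E" "vectorspace.basis_of K (X (Suc k)) B'"
      "basis_compatible (X (tgt k)) (f k) ((E(Suc k := B')) (src k)) ((E(Suc k := B')) (tgt k))"
    for k E B'
  proof -
    have "src i \<noteq> Suc k" "tgt i \<noteq> Suc k"
      if "i < k" for i using that by (auto simp: src_def tgt_def arrow_src_def arrow_tgt_def)
    then show ?thesis using that unfolding good_def by (auto simp: less_Suc_eq le_Suc_eq)
  qed
  \<comment> \<open>The bases are chosen from the last node backwards: whatever basis the arrow \<open>k\<close> forces on
    node \<open>k\<close>, it must extend to the left, and being adapted to a flag is enough for that.\<close>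
  have "\<exists>L m. vectorspace.flag K (X k) (carrier (X k)) m L \<and>
      (\<forall>B. vectorspace.adapted K (X k) L B \<longrightarrow> (\<exists>E. E k = B \<and> good k E))"
    if "1 \<le> k" "k \<le> zz_len V" for k
    using that
  proof (induction k rule: nat_induct_at_least)
    case base
    interpret X: vectorspace K "X 1" using vs[of 1] base by simp
    \<comment> \<open>Nothing lies to the left of the first node, so its flag has only the trivial
      steps.\<close>
    define L where "L i = (if i = 0 then {\<zero>\<^bsub>X 1\<^esub>} else carrier (X 1))" for i :: nat
    have L: "X.flag (carrier (X 1)) 1 L"
      unfolding X.flag_def L_def
      using X.submodule_zero_set X.submodule_carrier X.submodule_zero[OF X.submodule_carrier]
      by (auto simp: mono_def)
    have g: "good 1 (\<lambda>_. B)" if "X.adapted L B" for B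
      using X.adapted_rel_basis[OF L that] by (simp add: good_def X.basis_of_def del: One_nat_def)
    have "\<exists>E. E 1 = B \<and> good 1 E" if "X.adapted L B" for B
      by (rule exI[of _ "\<lambda>_. B"]) (use g[OF that] in simp)
    then have "X.flag (carrier (X 1)) 1 L \<and> (\<forall>B. X.adapted L B \<longrightarrow> (\<exists>E. E 1 = B \<and> good 1 E))"
      using L by simp
    then show ?case by (intro exI)
  next
    case (Suc k)
    have k: "1 \<le> k" "k < zz_len V" using Suc by auto
    obtain L m where L: "vectorspace.flag K (X k) (carrier (X k)) m L"
      and ext: "\<And>B. vectorspace.adapted K (X k) L B \<Longrightarrow> \<exists>E. E k = B \<and> good k E"
      using Suc by auto
    interpret Y: vectorspace K "X (Suc k)" using vs[of "Suc k"] k by simp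
    interpret f: linear_map K "X (src k)" "X (tgt k)" "f k" by (rule lin[OF k])
    show ?case
    proof (cases "zz_fwd V k")
      case True
      then have st: "src k = k" "tgt k = Suc k"
        by (auto simp: src_def tgt_def arrow_src_def arrow_tgt_def)
      define L' where "L' i = (if i \<le> m then f k ` L i else carrier (X (Suc k)))" for i
      have L': "Y.flag (carrier (X (Suc k))) (Suc m) L'"
        using f.flag_image[of m L] L unfolding st L'_def .
      have "\<exists>E. E (Suc k) = B' \<and> good (Suc k) E" if B': "Y.adapted L' B'" for B'
      proof -
        obtain B where B: "vectorspace.adapted K (X k) L B"
          "basis_compatible (X (Suc k)) (f k) B B'"
          using f.adapted_pullback[of m L B'] L B' unfolding st L'_def by blast
        obtain E where "E k = B" "good k E" using ext[OF B(1)] by blast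
        then have "good (Suc k) (E(Suc k := B'))"
          using good_Suc[OF k(1), of E B'] Y.adapted_rel_basis[OF L' B'] B(2)
          by (simp add: st Y.basis_of_def)
        then show ?thesis by (intro exI[of _ "E(Suc k := B')"]) simp
      qed
      then show ?thesis using L' by blast
    next
      case False
      then have st: "src k = Suc k" "tgt k = k"
        by (auto simp: src_def tgt_def arrow_src_def arrow_tgt_def)
      define L' where "L' i = (case i of 0 \<Rightarrow> {\<zero>\<^bsub>X (Suc k)\<^esub>}
        | Suc j \<Rightarrow> {x \<in> carrier (X (Suc k)). f k x \<in> L j})" for i
      have L': "Y.flag (carrier (X (Suc k))) (Suc m) L'"
        using f.flag_vimage[of m L] L unfolding st L'_def .
      have "\<exists>E. E (Suc k) = B' \<and> good (Suc k) E" if B': "Y.adapted L' B'" for B'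
      proof -
        obtain B where B: "vectorspace.adapted K (X k) L B"
          "basis_compatible (X k) (f k) B' B"
          using f.adapted_pushforward[of m L B'] L B' unfolding st L'_def by blast
        obtain E where "E k = B" "good k E" using ext[OF B(1)] by blast
        then have "good (Suc k) (E(Suc k := B'))"
          using good_Suc[OF k(1), of E B'] Y.adapted_rel_basis[OF L' B'] B(2)
          by (simp add: st Y.basis_of_def)
        then show ?thesis by (intro exI[of _ "E(Suc k := B')"]) simp
      qed
      then show ?thesis using L' by blast
    qed
  qed
  from this[of "zz_len V"] n obtain L m where
    L: "vectorspace.flag K (X (zz_len V)) (carrier (X (zz_len V))) m L" and
    ext: "\<And>B. vectorspace.adapted K (X (zz_len V)) L B \<Longrightarrow> \<exists>E. E (zz_len V) = B \<and> good (zz_len V) E"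
    by auto
  obtain B where "vectorspace.adapted K (X (zz_len V)) L B"
    using vectorspace.adapted_exists[OF vs L] n by auto
  then obtain E where "good (zz_len V) E" using ext by blast
  then show ?thesis unfolding good_def X_def f_def src_def tgt_def by blast
qed

text \<open>Each arrow, in either direction, matches basis vectors of node \<open>i\<close> with
  basis vectors of node \<open>Suc i\<close>. The maximal paths of these matchings are the bars, and
  the basis coordinates give the isomorphism with their direct sum.\<close>

theorem interval_decomposition_exists:
  fixes K :: "'k ring" (structure) and V :: "('k, 'v) zigzag"
  assumes K: "field K" and V: "zigzag_module K V" and n: "0 < zz_len V"
  shows "\<exists>S. interval_decomposition K V S"
proof -
  define n where "n = zz_len V"
  define d where "d = zz_fwd V"
  define X where "X = zz_space V"
  define f where "f = zz_map V"
  have vs: "vectorspace K (X i)" if "1 \<le> i" "i \<le> n" for i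
    using V that by (simp add: zigzag_module_def X_def n_def)
  have lin: "linear_map K (X (arrow_src d i)) (X (arrow_tgt d i)) (f i)" if "1 \<le> i" "i < n" for i
    using V that by (simp add: zigzag_module_def X_def f_def d_def n_def)
  obtain E where basis: "\<And>i. 1 \<le> i \<Longrightarrow> i \<le> n \<Longrightarrow> vectorspace.basis_of K (X i) (E i)"
    and comp: "\<And>i. 1 \<le> i \<Longrightarrow> i < n \<Longrightarrow> basis_compatible (X (arrow_tgt d i)) (f i)
        (E (arrow_src d i)) (E (arrow_tgt d i))"
    using compatible_bases_exist[OF V n] unfolding n_def d_def X_def f_def
    by (metis atLeastAtMost_iff atLeastLessThan_iff)
  have node: "1 \<le> arrow_src d i" "arrow_src d i \<le> n" "1 \<le> arrow_tgt d i" "arrow_tgt d i \<le> n"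
    if "1 \<le> i" "i < n" for i using that by (auto simp: arrow_src_def arrow_tgt_def)
  \<comment> \<open>Read from left to right, whatever the direction of the arrow.\<close>
  define R where "R i a b \<longleftrightarrow> 1 \<le> i \<and> i < n \<and> a \<in> E i \<and> b \<in> E (Suc i) \<and>
    (if d i then f i a = b else f i b = a)" for i a b
  have nz: "\<zero>\<^bsub>X i\<^esub> \<notin> E i" if "1 \<le> i" "i \<le> n" for i
    using vectorspace.rel_indep_nonzero[OF vs[OF that]] basis[OF that]
    by (simp add: vectorspace.basis_of_iff[OF vs[OF that]])
  \<comment> \<open>Compatibility gives injectivity only on vectors that are not killed; being sent
    to a basis vector, which is nonzero, guarantees this.\<close>
  have inj: "a = a'" if "1 \<le> i" "i < n" "a \<in> E (arrow_src d i)" "a' \<in> E (arrow_src d i)"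
    "f i a = f i a'" "f i a \<in> E (arrow_tgt d i)" for i a a'
  proof -
    have "f i a \<noteq> \<zero>\<^bsub>X (arrow_tgt d i)\<^esub>" using nz[OF node(3,4)[OF that(1,2)]] that(6) by auto
    moreover have "inj_on (f i) {b \<in> E (arrow_src d i). f i b \<noteq> \<zero>\<^bsub>X (arrow_tgt d i)\<^esub>}"
      using comp[OF that(1,2)] by (simp add: basis_compatible_def)
    ultimately show ?thesis using that(3-5) by (auto dest: inj_onD)
  qed
  have Ru: "b = b'" if "R i a b" "R i a b'" for i a b b'
    using that inj[of i b b'] unfolding R_def arrow_src_def arrow_tgt_def by (auto split: if_splits)
  have Rv: "a = a'" if "R i a b" "R i a' b" for i a a' b
    using that inj[of i a a'] unfolding R_def arrow_src_def arrow_tgt_def by (auto split: if_splits)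
  have "\<exists>(S :: (nat \<times> nat \<times> 'v) set) \<sigma>. (\<forall>(p, q, l)\<in>S. 1 \<le> p \<and> p \<le> q \<and> q \<le> n) \<and>
    (\<forall>i\<in>{1..n}. bij_betw (\<sigma> i) (E i) {s \<in> S. alive s i}) \<and>
    (\<forall>i\<in>{1..<n}. \<forall>a\<in>E i. \<forall>b\<in>E (Suc i). \<sigma> i a = \<sigma> (Suc i) b \<longleftrightarrow> R i a b)"
  proof (rule bars_of_partial_matchings[of R n E])
    show "1 \<le> i \<and> i < n \<and> a \<in> E i \<and> b \<in> E (Suc i)" if "R i a b" for i a b
      using that by (simp add: R_def)
  qed (rule Ru Rv; assumption)+
  then obtain S :: "(nat \<times> nat \<times> 'v) set" and \<sigma> where S: "\<forall>(p, q, l)\<in>S. 1 \<le> p \<and> p \<le> q \<and> q \<le> n"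
    and \<sigma>': "\<forall>i\<in>{1..n}. bij_betw (\<sigma> i) (E i) {s \<in> S. alive s i}"
    and \<sigma>R': "\<forall>i\<in>{1..<n}. \<forall>a\<in>E i. \<forall>b\<in>E (Suc i). \<sigma> i a = \<sigma> (Suc i) b \<longleftrightarrow> R i a b"
    by (elim exE conjE) (erule (2) that)
  have \<sigma>: "bij_betw (\<sigma> i) (E i) {s \<in> S. alive s i}" if "1 \<le> i" "i \<le> n" for i
    using \<sigma>' that by simp
  have \<sigma>R: "\<sigma> i a = \<sigma> (Suc i) b \<longleftrightarrow> R i a b"
    if "1 \<le> i" "i < n" "a \<in> E i" "b \<in> E (Suc i)" for i a b
    using \<sigma>R' that by simp
  define \<tau> where "\<tau> i = inv_into (E i) (\<sigma> i)" for i
  have \<tau>E: "\<tau> i s \<in> E i" and \<sigma>\<tau>: "\<sigma> i (\<tau> i s) = s" if "1 \<le> i" "i \<le> n" "s \<in> S" "alive s i" for i s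
    using that(3,4) \<sigma>[OF that(1,2)] unfolding \<tau>_def bij_betw_def
    by (metis (mono_tags, lifting) inv_into_into mem_Collect_eq, metis (mono_tags, lifting) f_inv_into_f mem_Collect_eq)
  define \<phi> where "\<phi> i = (\<lambda>v. \<lambda>s\<in>S. if alive s i
      then vectorspace.coord K (X i) (E i) (\<tau> i s) v else \<zero>)" for i
  have iso: "linear_iso K (X i) (zz_space (bar_sum K n d S) i) (\<phi> i)" if "1 \<le> i" "i \<le> n" for i
    unfolding \<phi>_def \<tau>_def by (rule bar_coordinates_iso[OF K vs[OF that] basis[OF that] \<sigma>[OF that]])
  have "\<phi> (arrow_tgt d i) (f i x) = zz_map (bar_sum K n d S) i (\<phi> (arrow_src d i) x)"
    if i: "1 \<le> i" "i < n" and x: "x \<in> carrier (X (arrow_src d i))" for i x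
  proof
    fix s :: "nat \<times> nat \<times> 'v"
    let ?s = "arrow_src d i" and ?t = "arrow_tgt d i"
    interpret f: linear_map K "X ?s" "X ?t" "f i" by (rule lin[OF i])
    note bs = basis[OF node(1,2)[OF i]] basis[OF node(3,4)[OF i]] comp[OF i]
    have both: "alive s i \<and> alive s (Suc i) \<longleftrightarrow> alive s ?s \<and> alive s ?t"
      by (auto simp: arrow_src_def arrow_tgt_def)
    have rel: "f i a = b \<longleftrightarrow> \<sigma> ?s a = \<sigma> ?t b" if "a \<in> E ?s" "b \<in> E ?t" for a b
      using \<sigma>R[OF i] that i unfolding R_def arrow_src_def arrow_tgt_def by (metis (full_types))
    consider "s \<notin> S" | "s \<in> S" "\<not> alive s ?t" | "s \<in> S" "alive s ?t" "alive s ?s"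
      | "s \<in> S" "alive s ?t" "\<not> alive s ?s" by blast
    then show "\<phi> ?t (f i x) s = zz_map (bar_sum K n d S) i (\<phi> ?s x) s"
    proof cases
      case 3
      \<comment> \<open>A bar present at both ends carries matched basis vectors, along which the
        coordinates agree.\<close>
      note \<tau>s = \<tau>E[OF node(1,2)[OF i] 3(1,3)] and \<tau>t = \<tau>E[OF node(3,4)[OF i] 3(1,2)]
      have "f i (\<tau> ?s s) = \<tau> ?t s"
        using rel[OF \<tau>s \<tau>t] \<sigma>\<tau>[OF node(1,2)[OF i] 3(1,3)] \<sigma>\<tau>[OF node(3,4)[OF i] 3(1,2)] by simp
      then show ?thesis
        using f.coord_image[OF bs \<tau>s _ x] \<tau>t 3 both by (simp add: \<phi>_def bar_space[OF K])
    next
      case 4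
      \<comment> \<open>A bar missing at the source has, at the target, a basis vector to which no
        basis vector is sent.\<close>
      note \<tau>t = \<tau>E[OF node(3,4)[OF i] 4(1,2)]
      have "\<tau> ?t s \<notin> f i ` E ?s"
      proof
        assume "\<tau> ?t s \<in> f i ` E ?s"
        then obtain a where a: "a \<in> E ?s" "f i a = \<tau> ?t s" by auto
        then have "\<sigma> ?s a = s" using rel[OF a(1) \<tau>t] \<sigma>\<tau>[OF node(3,4)[OF i] 4(1,2)] by simp
        then show False using \<sigma>[OF node(1,2)[OF i]] a(1) 4 unfolding bij_betw_def by auto
      qed
      then show ?thesis
        using f.coord_image_zero[OF bs \<tau>t _ x] 4 both by (simp add: \<phi>_def bar_space[OF K])
    qed (use both in \<open>auto simp: \<phi>_def bar_space[OF K]\<close>)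
  qed
  then have "zigzag_isomorphic K V (bar_sum K n d S)"
    unfolding zigzag_isomorphic_def bar_sum_sel
    using iso by (intro conjI exI[of _ \<phi>]) (auto simp: n_def d_def X_def f_def)
  then show ?thesis
    using S unfolding interval_decomposition_def n_def d_def by blast
qed

section \<open>Coordinate subspaces of a decomposed zigzag module\<close>

text \<open>An arbitrary interval decomposition with a chosen isomorphism, so that a count derived
  here is valid for all decompositions at once.\<close>

locale barcode =
  fixes K :: "'k ring" (structure) and V :: "('k, 'v) zigzag"
    and S :: "(nat \<times> nat \<times> 'w) set" and \<phi> :: "nat \<Rightarrow> 'v \<Rightarrow> nat \<times> nat \<times> 'w \<Rightarrow> 'k"
  assumes field_K: "field K" and zigzag: "zigzag_module K V"
    and iso: "\<And>i. 1 \<le> i \<Longrightarrow> i \<le> zz_len V \<Longrightarrow>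
      linear_iso K (zz_space V i) (zz_space (bar_sum K (zz_len V) (zz_fwd V) S) i) (\<phi> i)"
    and comm: "\<And>i x. 1 \<le> i \<Longrightarrow> i < zz_len V \<Longrightarrow> x \<in> carrier (zz_space V (arrow_src (zz_fwd V) i)) \<Longrightarrow>
      \<phi> (arrow_tgt (zz_fwd V) i) (zz_map V i x)
      = zz_map (bar_sum K (zz_len V) (zz_fwd V) S) i (\<phi> (arrow_src (zz_fwd V) i) x)"
begin

definition node :: "nat \<Rightarrow> bool" where
  "node i \<longleftrightarrow> 1 \<le> i \<and> i \<le> zz_len V"

definition supp :: "nat \<Rightarrow> 'v \<Rightarrow> (nat \<times> nat \<times> 'w) set" where
  "supp i x = {s \<in> S. \<phi> i x s \<noteq> \<zero>}"

text \<open>These subspaces turn intersections, spans, images and preimages into Boolean operations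
  on sets of bars. \<open>T\<close> may be any set of triples, which allows complements.\<close>

definition coord_space :: "nat \<Rightarrow> (nat \<times> nat \<times> 'w) set \<Rightarrow> 'v set" where
  "coord_space i T = {x \<in> carrier (zz_space V i). supp i x \<subseteq> T}"

lemma space: "node i \<Longrightarrow> vectorspace K (zz_space V i)"
  using zigzag by (simp add: zigzag_module_def node_def)

lemma
  assumes i: "node i" and x: "x \<in> carrier (zz_space V i)"
  shows \<phi>_closed: "s \<in> S \<Longrightarrow> \<phi> i x s \<in> carrier K"
    and \<phi>_ext: "\<phi> i x \<in> extensional S"
    and supp_alive: "s \<in> supp i x \<Longrightarrow> alive s i"
    and supp_finite: "finite (supp i x)"
proof -
  have "\<phi> i x \<in> carrier (zz_space (bar_sum K (zz_len V) (zz_fwd V) S) i)"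
    using iso[of i] i x by (auto simp: linear_iso_def bij_betw_def node_def)
  then show "s \<in> S \<Longrightarrow> \<phi> i x s \<in> carrier K" "\<phi> i x \<in> extensional S"
    "s \<in> supp i x \<Longrightarrow> alive s i" "finite (supp i x)"
    by (auto simp: bar_space[OF field_K] supp_def)
qed

lemma \<phi>_linear:
  assumes "node i"
  shows "linear_map K (zz_space V i) (zz_space (bar_sum K (zz_len V) (zz_fwd V) S) i) (\<phi> i)"
  using iso[of i] assms by (auto simp: linear_iso_def node_def)

lemma \<phi>_add:
  assumes "node i" "x \<in> carrier (zz_space V i)" "y \<in> carrier (zz_space V i)" "s \<in> S"
  shows "\<phi> i (x \<oplus>\<^bsub>zz_space V i\<^esub> y) s = \<phi> i x s \<oplus> \<phi> i y s"
proof -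
  interpret l: linear_map K "zz_space V i" "zz_space (bar_sum K (zz_len V) (zz_fwd V) S) i" "\<phi> i"
    by (rule \<phi>_linear[OF assms(1)])
  show ?thesis using assms by (simp add: bar_space[OF field_K])
qed

lemma \<phi>_smult:
  assumes "node i" "x \<in> carrier (zz_space V i)" "c \<in> carrier K" "s \<in> S"
  shows "\<phi> i (c \<odot>\<^bsub>zz_space V i\<^esub> x) s = c \<otimes> \<phi> i x s"
proof -
  interpret l: linear_map K "zz_space V i" "zz_space (bar_sum K (zz_len V) (zz_fwd V) S) i" "\<phi> i"
    by (rule \<phi>_linear[OF assms(1)])
  show ?thesis using assms by (simp add: bar_space[OF field_K])
qed

lemma \<phi>_zero:
  assumes "node i" "s \<in> S"
  shows "\<phi> i \<zero>\<^bsub>zz_space V i\<^esub> s = \<zero>"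
proof -
  interpret l: linear_map K "zz_space V i" "zz_space (bar_sum K (zz_len V) (zz_fwd V) S) i" "\<phi> i"
    by (rule \<phi>_linear[OF assms(1)])
  show ?thesis using assms by (simp add: bar_space[OF field_K])
qed

lemma \<phi>_inject:
  assumes "node i" "x \<in> carrier (zz_space V i)" "y \<in> carrier (zz_space V i)"
    and "\<And>s. s \<in> S \<Longrightarrow> \<phi> i x s = \<phi> i y s"
  shows "x = y"
proof -
  have "\<phi> i x = \<phi> i y"
    using assms \<phi>_ext[OF assms(1)] by (intro extensionalityI[of _ S]) auto
  then show ?thesis
    using iso[of i] assms by (auto simp: linear_iso_def bij_betw_def node_def dest: inj_onD)
qed

lemma \<phi>_surj:
  assumes "node i" "\<And>s. s \<in> S \<Longrightarrow> z s \<in> carrier K" "finite {s \<in> S. z s \<noteq> \<zero>}"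
    and "\<And>s. s \<in> S \<Longrightarrow> z s \<noteq> \<zero> \<Longrightarrow> alive s i"
  shows "\<exists>x\<in>carrier (zz_space V i). \<forall>s\<in>S. \<phi> i x s = z s"
proof -
  have "{s \<in> S. restrict z S s \<noteq> \<zero>} = {s \<in> S. z s \<noteq> \<zero>}" by auto
  moreover have "\<forall>s\<in>S. \<not> alive s i \<longrightarrow> z s = \<zero>" using assms(4) by blast
  ultimately have "restrict z S \<in> carrier (zz_space (bar_sum K (zz_len V) (zz_fwd V) S) i)"
    using assms(1-3) by (auto simp: bar_space[OF field_K])
  moreover have "\<phi> i ` carrier (zz_space V i)
      = carrier (zz_space (bar_sum K (zz_len V) (zz_fwd V) S) i)"
    using iso[of i] assms(1) by (simp add: linear_iso_def bij_betw_def node_def)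
  ultimately obtain x where "x \<in> carrier (zz_space V i)" "\<phi> i x = restrict z S"
    by (metis (no_types, lifting) imageE)
  then show ?thesis by (intro bexI[of _ x]) auto
qed

lemma coord_space_submodule:
  assumes i: "node i"
  shows "submodule K (coord_space i T) (zz_space V i)"
proof -
  interpret vectorspace K "zz_space V i" by (rule space[OF i])
  show ?thesis
  proof (rule submoduleI)
    show "\<zero>\<^bsub>zz_space V i\<^esub> \<in> coord_space i T"
      by (auto simp: coord_space_def supp_def \<phi>_zero[OF i])
    show "x \<oplus>\<^bsub>zz_space V i\<^esub> y \<in> coord_space i T"
      if "x \<in> coord_space i T" "y \<in> coord_space i T" for x y
      using that by (fastforce simp: coord_space_def supp_def \<phi>_add[OF i])
    show "c \<odot>\<^bsub>zz_space V i\<^esub> x \<in> coord_space i T"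
      if "c \<in> carrier K" "x \<in> coord_space i T" for c x
      using that by (fastforce simp: coord_space_def supp_def \<phi>_smult[OF i])
  qed (auto simp: coord_space_def)
qed

lemma coord_space_UNIV: "coord_space i UNIV = carrier (zz_space V i)"
  by (simp add: coord_space_def)

lemma coord_space_empty:
  assumes i: "node i"
  shows "coord_space i {} = {\<zero>\<^bsub>zz_space V i\<^esub>}"
proof -
  interpret vectorspace K "zz_space V i" by (rule space[OF i])
  have "x = \<zero>\<^bsub>zz_space V i\<^esub>" if "x \<in> coord_space i {}" for x
    using that by (intro \<phi>_inject[OF i]) (auto simp: coord_space_def supp_def \<phi>_zero[OF i])
  then show ?thesis using submodule_zero[OF coord_space_submodule[OF i, of "{}"]] by blast
qed

lemma coord_space_Int: "coord_space i T \<inter> coord_space i T' = coord_space i (T \<inter> T')"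
  by (auto simp: coord_space_def)

text \<open>The family of coordinates is cut into its parts on \<open>T\<close> and off
  \<open>T\<close>, and \<open>\<phi>_surj\<close> realises each part by a vector.\<close>

lemma coord_space_split:
  assumes i: "node i" and x: "x \<in> carrier (zz_space V i)"
  shows "\<exists>y\<in>coord_space i T. \<exists>z\<in>coord_space i (supp i x - T). x = y \<oplus>\<^bsub>zz_space V i\<^esub> z"
proof -
  interpret K: field K by (rule field_K)
  interpret vectorspace K "zz_space V i" by (rule space[OF i])
  have part: "\<exists>y\<in>carrier (zz_space V i). \<forall>s\<in>S. \<phi> i y s = (if P s then \<phi> i x s else \<zero>)" for P
    by (rule \<phi>_surj[OF i])
      (use \<phi>_closed[OF i x] supp_alive[OF i x] supp_finite[OF i x] in
        \<open>auto simp: supp_def split: if_splits elim!: rev_finite_subset\<close>)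
  obtain y where y: "y \<in> carrier (zz_space V i)" "\<forall>s\<in>S. \<phi> i y s = (if s \<in> T then \<phi> i x s else \<zero>)"
    using part[of "\<lambda>s. s \<in> T"] by blast
  obtain z where z: "z \<in> carrier (zz_space V i)" "\<forall>s\<in>S. \<phi> i z s = (if s \<notin> T then \<phi> i x s else \<zero>)"
    using part[of "\<lambda>s. s \<notin> T"] by blast
  have "x = y \<oplus>\<^bsub>zz_space V i\<^esub> z"
    by (rule \<phi>_inject[OF i x]) (use y z \<phi>_closed[OF i x] in \<open>auto simp: \<phi>_add[OF i]\<close>)
  moreover have "y \<in> coord_space i T" "z \<in> coord_space i (supp i x - T)"
    using y z by (auto simp: coord_space_def supp_def split: if_splits)
  ultimately show ?thesis by blast
qed

lemma coord_space_span_Un: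
  assumes i: "node i"
  shows "module.span K (zz_space V i) (coord_space i T \<union> coord_space i T') = coord_space i (T \<union> T')"
proof -
  interpret vectorspace K "zz_space V i" by (rule space[OF i])
  let ?U = "coord_space i T \<union> coord_space i T'"
  have Uc: "?U \<subseteq> carrier (zz_space V i)" by (auto simp: coord_space_def)
  show ?thesis
  proof
    show "span ?U \<subseteq> coord_space i (T \<union> T')"
      by (rule span_least[OF coord_space_submodule[OF i]]) (auto simp: coord_space_def)
    show "coord_space i (T \<union> T') \<subseteq> span ?U"
    proof
      fix x assume x: "x \<in> coord_space i (T \<union> T')"
      obtain y z where yz: "y \<in> coord_space i T" "z \<in> coord_space i (supp i x - T)"
        "x = y \<oplus>\<^bsub>zz_space V i\<^esub> z"
        using coord_space_split[OF i, of x T] x by (auto simp: coord_space_def)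
      have "z \<in> coord_space i T'" using yz(2) x by (auto simp: coord_space_def)
      then show "x \<in> span ?U"
        using yz in_own_span[OF Uc] submodule_add[OF span_is_submodule[OF Uc], of y z] by auto
    qed
  qed
qed

lemma arrow_node:
  assumes "1 \<le> j" "j < zz_len V"
  shows "node (arrow_src (zz_fwd V) j)" "node (arrow_tgt (zz_fwd V) j)"
  using assms by (auto simp: node_def arrow_src_def arrow_tgt_def)

lemma arrow_closed:
  assumes "1 \<le> j" "j < zz_len V" "x \<in> carrier (zz_space V (arrow_src (zz_fwd V) j))"
  shows "zz_map V j x \<in> carrier (zz_space V (arrow_tgt (zz_fwd V) j))"
proof -
  interpret linear_map K "zz_space V (arrow_src (zz_fwd V) j)"
    "zz_space V (arrow_tgt (zz_fwd V) j)" "zz_map V j"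
    using zigzag assms by (simp add: zigzag_module_def)
  show ?thesis using assms(3) by simp
qed

text \<open>The map of the direct sum asks for a bar alive at both ends, but a coordinate at the
  source is already zero when the bar is not alive there.\<close>

lemma \<phi>_arrow:
  assumes "1 \<le> j" "j < zz_len V" "x \<in> carrier (zz_space V (arrow_src (zz_fwd V) j))" "s \<in> S"
  shows "\<phi> (arrow_tgt (zz_fwd V) j) (zz_map V j x) s
    = (if alive s (arrow_tgt (zz_fwd V) j) then \<phi> (arrow_src (zz_fwd V) j) x s else \<zero>)"
proof -
  have "\<phi> (arrow_src (zz_fwd V) j) x s = \<zero>" if "\<not> alive s (arrow_src (zz_fwd V) j)"
    using supp_alive[OF arrow_node(1)[OF assms(1,2)] assms(3), of s] that assms(4)
    by (auto simp: supp_def)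
  moreover have "alive s j \<and> alive s (Suc j) \<longleftrightarrow>
      alive s (arrow_src (zz_fwd V) j) \<and> alive s (arrow_tgt (zz_fwd V) j)"
    by (auto simp: arrow_src_def arrow_tgt_def)
  ultimately show ?thesis
    using assms comm[OF assms(1-3)] by (auto simp: bar_space[OF field_K])
qed

lemma supp_arrow:
  assumes "1 \<le> j" "j < zz_len V" "x \<in> carrier (zz_space V (arrow_src (zz_fwd V) j))"
  shows "supp (arrow_tgt (zz_fwd V) j) (zz_map V j x)
    = supp (arrow_src (zz_fwd V) j) x \<inter> {s. alive s (arrow_tgt (zz_fwd V) j)}"
  by (auto simp: supp_def \<phi>_arrow[OF assms] split: if_splits)

text \<open>Coordinates on bars not alive at the target are killed by the arrow, so they are
  unconstrained.\<close>

lemma coord_space_vimage: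
  assumes "1 \<le> j" "j < zz_len V"
  shows "{x \<in> carrier (zz_space V (arrow_src (zz_fwd V) j)).
      zz_map V j x \<in> coord_space (arrow_tgt (zz_fwd V) j) T}
    = coord_space (arrow_src (zz_fwd V) j) (T \<union> {s. \<not> alive s (arrow_tgt (zz_fwd V) j)})"
  using supp_arrow[OF assms] arrow_closed[OF assms] by (auto simp: coord_space_def)

text \<open>Only bars alive at the source can be hit; conversely, a vector supported on such bars
  lifts with the same coordinates.\<close>

lemma coord_space_image:
  assumes j: "1 \<le> j" "j < zz_len V"
  shows "zz_map V j ` coord_space (arrow_src (zz_fwd V) j) T
    = coord_space (arrow_tgt (zz_fwd V) j) (T \<inter> {s. alive s (arrow_src (zz_fwd V) j)})"
    (is "_ ` coord_space ?a T = coord_space ?b ?T")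
proof
  show "zz_map V j ` coord_space ?a T \<subseteq> coord_space ?b ?T"
    using supp_arrow[OF j] arrow_closed[OF j] supp_alive[OF arrow_node(1)[OF j]]
    by (auto simp: coord_space_def)
  show "coord_space ?b ?T \<subseteq> zz_map V j ` coord_space ?a T"
  proof
    fix y assume "y \<in> coord_space ?b ?T"
    then have y: "y \<in> carrier (zz_space V ?b)" "supp ?b y \<subseteq> ?T" by (auto simp: coord_space_def)
    note b = arrow_node(2)[OF j] and a = arrow_node(1)[OF j]
    have "\<exists>x\<in>carrier (zz_space V ?a). \<forall>s\<in>S. \<phi> ?a x s = \<phi> ?b y s"
    proof (rule \<phi>_surj[OF a \<phi>_closed[OF b y(1)]])
      show "finite {s \<in> S. \<phi> ?b y s \<noteq> \<zero>}" using supp_finite[OF b y(1)] by (simp add: supp_def)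
      show "alive s ?a" if "s \<in> S" "\<phi> ?b y s \<noteq> \<zero>" for s
        using y(2) that unfolding supp_def by blast
    qed
    then obtain x where x: "x \<in> carrier (zz_space V ?a)" "\<forall>s\<in>S. \<phi> ?a x s = \<phi> ?b y s"
      by blast
    have "zz_map V j x = y"
    proof (rule \<phi>_inject[OF b arrow_closed[OF j x(1)] y(1)])
      show "\<phi> ?b (zz_map V j x) s = \<phi> ?b y s" if "s \<in> S" for s
      proof -
        have "\<phi> ?b y s = \<zero>" if "\<not> alive s ?b"
          using supp_alive[OF b y(1), of s] that \<open>s \<in> S\<close> unfolding supp_def by blast
        then show ?thesis using x(2) that by (simp add: \<phi>_arrow[OF j x(1)])
      qed
    qed
    moreover have "x \<in> coord_space ?a T" using x y(2) by (auto simp: coord_space_def supp_def)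
    ultimately show "y \<in> zz_map V j ` coord_space ?a T" by blast
  qed
qed

text \<open>The unit vectors of the bars in \<open>T - T'\<close> alive at \<open>i\<close> form a
  basis relative to \<open>coord_space i T'\<close>.\<close>

lemma coord_space_rdim:
  assumes i: "node i" and T: "T' \<subseteq> T"
  shows "vectorspace.rdim K (zz_space V i) (coord_space i T') (coord_space i T)
    = ecard {s \<in> S. alive s i \<and> s \<in> T - T'}"
proof -
  interpret K: field K by (rule field_K)
  interpret vectorspace K "zz_space V i" by (rule space[OF i])
  define U where "U = {s \<in> S. alive s i \<and> s \<in> T - T'}"
  have "\<exists>x\<in>carrier (zz_space V i). \<forall>t\<in>S. \<phi> i x t = (if t = s then \<one> else \<zero>)" if "s \<in> U" for s
  proof (rule \<phi>_surj[OF i])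
    show "finite {t \<in> S. (if t = s then \<one> else \<zero>) \<noteq> \<zero>}" by (rule finite_subset[of _ "{s}"]) auto
  qed (use that in \<open>auto simp: U_def split: if_splits\<close>)
  then obtain e where e: "\<And>s. s \<in> U \<Longrightarrow> e s \<in> carrier (zz_space V i)"
    "\<And>s t. s \<in> U \<Longrightarrow> t \<in> S \<Longrightarrow> \<phi> i (e s) t = (if t = s then \<one> else \<zero>)"
    by metis
  have supp_e: "supp i (e s) = {s}" if "s \<in> U" for s
    using e(2)[OF that] that by (auto simp: supp_def U_def split: if_splits)
  have inj: "inj_on e U"
    by (rule inj_onI) (metis supp_e singleton_inject)
  define B where "B = e ` U"
  have Bc: "B \<subseteq> carrier (zz_space V i)" using e(1) by (auto simp: B_def)
  have Cc: "coord_space i T' \<subseteq> carrier (zz_space V i)" by (auto simp: coord_space_def)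
  have "rel_indep (coord_space i T') B"
    unfolding rel_indep_def
  proof (intro conjI ballI Bc)
    fix b assume "b \<in> B"
    then obtain s where s: "s \<in> U" "b = e s" by (auto simp: B_def)
    have "B - {b} \<subseteq> coord_space i (- {s})"
    proof
      fix b' assume "b' \<in> B - {b}"
      then obtain t where t: "t \<in> U" "b' = e t" "t \<noteq> s" using s by (auto simp: B_def)
      then show "b' \<in> coord_space i (- {s})" using supp_e e(1) by (simp add: coord_space_def)
    qed
    moreover have "coord_space i T' \<subseteq> coord_space i (- {s})"
      using s by (auto simp: coord_space_def U_def)
    ultimately have "span (coord_space i T' \<union> (B - {b})) \<subseteq> coord_space i (- {s})"
      by (intro span_least[OF coord_space_submodule[OF i]]) blast
    moreover have "b \<notin> coord_space i (- {s})" using s supp_e by (simp add: coord_space_def)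
    ultimately show "b \<notin> span (coord_space i T' \<union> (B - {b}))" by blast
  qed
  moreover have BT: "B \<subseteq> coord_space i T" using e(1) supp_e by (auto simp: B_def coord_space_def U_def)
  moreover have "span (coord_space i T' \<union> B) = coord_space i T"
  proof
    show "span (coord_space i T' \<union> B) \<subseteq> coord_space i T"
      by (rule span_least[OF coord_space_submodule[OF i]]) (use BT T in \<open>auto simp: coord_space_def\<close>)
    have sc: "coord_space i T' \<union> B \<subseteq> carrier (zz_space V i)" using Bc Cc by blast
    note sub = span_is_submodule[OF sc]
    \<comment> \<open>Induction over the finitely many bars of the support of \<open>x\<close>
      outside \<open>T'\<close>.\<close>
    have step: "x \<in> span (coord_space i T' \<union> B)" if "finite F" "F \<subseteq> U" "x \<in> coord_space i (T' \<union> F)" for F x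
      using that
    proof (induction F arbitrary: x)
      case empty
      then show ?case using in_own_span[OF sc] by auto
    next
      case (insert s F)
      have x: "x \<in> carrier (zz_space V i)" "supp i x \<subseteq> insert s (T' \<union> F)"
        using insert.prems by (auto simp: coord_space_def)
      obtain y z where yz: "y \<in> coord_space i (T' \<union> F)" "z \<in> coord_space i (supp i x - (T' \<union> F))"
        "x = y \<oplus>\<^bsub>zz_space V i\<^esub> z"
        using coord_space_split[OF i x(1), of "T' \<union> F"] by blast
      have s: "s \<in> U" "s \<in> S" using insert.prems by (auto simp: U_def)
      have z: "z \<in> carrier (zz_space V i)" "supp i z \<subseteq> {s}"
        using yz(2) x(2) by (auto simp: coord_space_def)
      note zs = \<phi>_closed[OF i z(1) s(2)]
      have "z = \<phi> i z s \<odot>\<^bsub>zz_space V i\<^esub> e s"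
      proof (rule \<phi>_inject[OF i z(1)])
        show "\<phi> i z t = \<phi> i (\<phi> i z s \<odot>\<^bsub>zz_space V i\<^esub> e s) t" if "t \<in> S" for t
          using z(2) that e s zs by (auto simp: \<phi>_smult[OF i] supp_def)
      qed (use e(1) s zs in simp)
      moreover have "e s \<in> span (coord_space i T' \<union> B)" using in_own_span[OF sc] s by (auto simp: B_def)
      ultimately have "z \<in> span (coord_space i T' \<union> B)" using submodule_smult[OF sub zs] by metis
      moreover have "y \<in> span (coord_space i T' \<union> B)"
        by (rule insert.IH[OF _ yz(1)]) (use insert.prems in blast)
      ultimately show ?case using submodule_add[OF sub] yz(3) by simp
    qed
    show "coord_space i T \<subseteq> span (coord_space i T' \<union> B)"
    proof
      fix x assume x: "x \<in> coord_space i T"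
      then have xc: "x \<in> carrier (zz_space V i)" by (simp add: coord_space_def)
      show "x \<in> span (coord_space i T' \<union> B)"
      proof (rule step[of "supp i x - T'"])
        show "supp i x - T' \<subseteq> U"
          using x supp_alive[OF i xc] by (auto simp: U_def coord_space_def supp_def)
      qed (use supp_finite[OF i xc] xc in \<open>auto simp: coord_space_def\<close>)
    qed
  qed
  ultimately have "rel_basis (coord_space i T') (coord_space i T) B" by (simp add: rel_basis_def)
  then have "rdim (coord_space i T') (coord_space i T) = ecard B" by (rule rdim_eqI[OF Cc])
  also have "\<dots> = ecard U" using inj by (simp add: B_def ecard_def card_image finite_image_iff)
  finally show ?thesis by (simp add: U_def)
qed

end

section \<open>Multiplicities as dimensions of subquotients\<close>

text \<open>The dimension of the graded piece for two filtrations at once: both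
  \<open>L' \<inter> R\<close> and \<open>L \<inter> R'\<close> are divided out, since a bar is
  counted only if it avoids both lower steps.\<close>

definition bar_dim ::
  "'k ring \<Rightarrow> ('k, 'v) module \<Rightarrow> 'v set \<Rightarrow> 'v set \<Rightarrow> 'v set \<Rightarrow> 'v set \<Rightarrow> enat" where
  "bar_dim K W L L' R R' =
     vectorspace.rdim K W (module.span K W (L' \<inter> R \<union> L \<inter> R')) (L \<inter> R)"

text \<open>
  For \<open>g : A \<rightarrow> Y\<close> and \<open>h : Z \<rightarrow> Y\<close>, the quotient of \<open>birth_hi\<close> by \<open>birth_lo\<close> is the part of \<open>Z\<close> spanned
  by the bars of \<open>A \<rightarrow> Y \<leftarrow> Z\<close> that start at the node \<open>Y\<close> (if \<open>e\<close>) or at the node \<open>Z\<close> (if not \<open>e\<close>).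
\<close>

definition birth_hi ::
  "bool \<Rightarrow> ('k, 'w) module \<Rightarrow> ('k, 'v) module \<Rightarrow> ('v \<Rightarrow> 'w) \<Rightarrow> 'v set" where
  "birth_hi e Y Z h = (if e then carrier Z else {x \<in> carrier Z. h x = \<zero>\<^bsub>Y\<^esub>})"

definition birth_lo ::
  "bool \<Rightarrow> ('k, 'u) module \<Rightarrow> ('k, 'v) module \<Rightarrow> ('u \<Rightarrow> 'w) \<Rightarrow> ('v \<Rightarrow> 'w) \<Rightarrow> 'v set" where
  "birth_lo e A Z g h = (if e then {x \<in> carrier Z. h x \<in> g ` carrier A} else {\<zero>\<^bsub>Z\<^esub>})"

text \<open>The two sides of the zigzag enter symmetrically, which reduces the splitting at
  \<open>q\<close> to the splitting at \<open>p\<close>.\<close>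

lemma bar_dim_commute: "bar_dim K W L L' R R' = bar_dim K W R R' L L'"
  by (simp add: bar_dim_def Int_commute Un_commute)

text \<open>All subspaces involved are coordinate subspaces, so what remains is to see which bars
  through node 4 lie in both \<open>L - L'\<close> and \<open>R - R'\<close>.\<close>

lemma (in barcode) bar_count:
  fixes e e' :: bool
  assumes len: "zz_len V = 7" and fwd: "zz_fwd V = odd"
  defines "p \<equiv> (if e then 2 else 3 :: nat)" and "q \<equiv> (if e' then 6 else 5 :: nat)"
    and "hl \<equiv> birth_hi e (zz_space V 2) (zz_space V 3) (zz_map V 2)"
    and "ll \<equiv> birth_lo e (zz_space V 1) (zz_space V 3) (zz_map V 1) (zz_map V 2)"
    and "hr \<equiv> birth_hi e' (zz_space V 6) (zz_space V 5) (zz_map V 5)"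
    and "lr \<equiv> birth_lo e' (zz_space V 7) (zz_space V 5) (zz_map V 6) (zz_map V 5)"
  shows "ecard {l. (p, q, l) \<in> S} = bar_dim K (zz_space V 4)
    (zz_map V 3 ` hl) (zz_map V 3 ` ll) (zz_map V 4 ` hr) (zz_map V 4 ` lr)"
proof -
  define A :: "nat \<Rightarrow> (nat \<times> nat \<times> 'w) set" where "A i = {s. alive s i}" for i
  have n: "node 1" "node 2" "node 3" "node 4" "node 5" "node 6" "node 7"
    by (simp_all add: node_def len)
  have st: "arrow_src (zz_fwd V) 1 = 1" "arrow_tgt (zz_fwd V) 1 = 2"
    "arrow_src (zz_fwd V) 2 = 3" "arrow_tgt (zz_fwd V) 2 = 2"
    "arrow_src (zz_fwd V) 3 = 3" "arrow_tgt (zz_fwd V) 3 = 4"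
    "arrow_src (zz_fwd V) 4 = 5" "arrow_tgt (zz_fwd V) 4 = 4"
    "arrow_src (zz_fwd V) 5 = 5" "arrow_tgt (zz_fwd V) 5 = 6"
    "arrow_src (zz_fwd V) 6 = 7" "arrow_tgt (zz_fwd V) 6 = 6"
    by (simp_all add: fwd arrow_src_def arrow_tgt_def)
  have cA: "{s. \<not> alive s i} = - A i" for i by (auto simp: A_def)
  have im: "zz_map V j ` coord_space (arrow_src (zz_fwd V) j) T
      = coord_space (arrow_tgt (zz_fwd V) j) (T \<inter> A (arrow_src (zz_fwd V) j))"
    if "1 \<le> j" "j < 7" for j T
    using coord_space_image[of j T] that len by (simp add: A_def)
  have pre: "{x \<in> carrier (zz_space V (arrow_src (zz_fwd V) j)).
        zz_map V j x \<in> coord_space (arrow_tgt (zz_fwd V) j) T}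
      = coord_space (arrow_src (zz_fwd V) j) (T \<union> - A (arrow_tgt (zz_fwd V) j))"
    if "1 \<le> j" "j < 7" for j T
    using coord_space_vimage[of j T] that len by (simp add: cA)
  have hl: "hl = coord_space 3 (if e then UNIV else - A 2)"
    using pre[of 2 "{}"]
    by (simp add: hl_def birth_hi_def st coord_space_UNIV coord_space_empty n)
  have ll: "ll = coord_space 3 (if e then A 1 \<union> - A 2 else {})"
    using pre[of 2 "A 1"] im[of 1 UNIV]
    by (simp add: ll_def birth_lo_def st coord_space_UNIV coord_space_empty n del: One_nat_def)
  have hr: "hr = coord_space 5 (if e' then UNIV else - A 6)"
    using pre[of 5 "{}"]
    by (simp add: hr_def birth_hi_def st coord_space_UNIV coord_space_empty n)
  have lr: "lr = coord_space 5 (if e' then A 7 \<union> - A 6 else {})"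
    using pre[of 5 "A 7"] im[of 6 UNIV]
    by (simp add: lr_def birth_lo_def st coord_space_UNIV coord_space_empty n)
  define L where "L = (if e then UNIV else - A 2) \<inter> A 3"
  define L' where "L' = (if e then A 1 \<union> - A 2 else {}) \<inter> A 3"
  define R where "R = (if e' then UNIV else - A 6) \<inter> A 5"
  define R' where "R' = (if e' then A 7 \<union> - A 6 else {}) \<inter> A 5"
  have sub: "L' \<inter> R \<union> L \<inter> R' \<subseteq> L \<inter> R"
    using n by (auto simp: L_def L'_def R_def R'_def)
  have "bar_dim K (zz_space V 4)
      (zz_map V 3 ` hl) (zz_map V 3 ` ll) (zz_map V 4 ` hr) (zz_map V 4 ` lr)
    = bar_dim K (zz_space V 4) (coord_space 4 L) (coord_space 4 L') (coord_space 4 R) (coord_space 4 R')"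
    using im[of 3] im[of 4] by (simp add: hl ll hr lr st L_def L'_def R_def R'_def)
  also have "\<dots> = ecard {s \<in> S. alive s 4 \<and> s \<in> L \<inter> R - (L' \<inter> R \<union> L \<inter> R')}"
    unfolding bar_dim_def coord_space_Int coord_space_span_Un[OF n(4)]
    by (rule coord_space_rdim[OF n(4) sub])
  also have "{s \<in> S. alive s 4 \<and> s \<in> L \<inter> R - (L' \<inter> R \<union> L \<inter> R')} = (\<lambda>l. (p, q, l)) ` {l. (p, q, l) \<in> S}"
  proof -
    \<comment> \<open>For a bar alive at 4, being alive at 3 but not at 2 makes 3 its first node,
      and being alive at 2 and 3 but not at 1 makes it 2. Nodes 5, 6 and 7 determine the last node
      in the same way.\<close>
    have "alive s 4 \<and> s \<in> L - L' \<and> s \<in> R - R' \<longleftrightarrow> fst s = p \<and> fst (snd s) = q" for s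
      by (auto simp: alive_def A_def L_def L'_def R_def R'_def p_def q_def)
    then have "{s \<in> S. alive s 4 \<and> s \<in> L \<inter> R - (L' \<inter> R \<union> L \<inter> R')}
        = {s \<in> S. fst s = p \<and> fst (snd s) = q}" by blast
    then show ?thesis by force
  qed
  also have "ecard \<dots> = ecard {l. (p, q, l) \<in> S}"
    by (simp add: ecard_def card_image finite_image_iff inj_on_def)
  finally show ?thesis by simp
qed

text \<open>Every decomposition yields the same count, expressed by the maps of \<open>V\<close>
  alone; together with existence this evaluates the definite description in
  \<open>multiplicity\<close>.\<close>

theorem multiplicity_eq_bar_dim:
  assumes K: "field K" and V: "zigzag_module K V"
    and len: "zz_len V = 7" and fwd: "zz_fwd V = odd"
  shows "multiplicity K V (if e then 2 else 3) (if e' then 6 else 5) = bar_dim K (zz_space V 4)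
    (zz_map V 3 ` birth_hi e (zz_space V 2) (zz_space V 3) (zz_map V 2))
    (zz_map V 3 ` birth_lo e (zz_space V 1) (zz_space V 3) (zz_map V 1) (zz_map V 2))
    (zz_map V 4 ` birth_hi e' (zz_space V 6) (zz_space V 5) (zz_map V 5))
    (zz_map V 4 ` birth_lo e' (zz_space V 7) (zz_space V 5) (zz_map V 6) (zz_map V 5))"
    (is "multiplicity K V ?p ?q = ?d")
proof -
  have count: "ecard {l. (?p, ?q, l) \<in> S} = ?d" if S: "interval_decomposition K V S" for S
  proof -
    obtain \<phi> where iso:
      "\<forall>i\<in>{1..zz_len V}. linear_iso K (zz_space V i) (zz_space (bar_sum K (zz_len V) (zz_fwd V) S) i) (\<phi> i)"
      and comm: "\<forall>i\<in>{1..<zz_len V}. \<forall>x\<in>carrier (zz_space V (arrow_src (zz_fwd V) i)).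
         \<phi> (arrow_tgt (zz_fwd V) i) (zz_map V i x)
         = zz_map (bar_sum K (zz_len V) (zz_fwd V) S) i (\<phi> (arrow_src (zz_fwd V) i) x)"
      using S unfolding interval_decomposition_def zigzag_isomorphic_def by blast
    interpret barcode K V S \<phi>
      by (rule barcode.intro[OF K V]) (use iso comm in auto)
    show ?thesis by (rule bar_count[OF len fwd])
  qed
  obtain S where "interval_decomposition K V S"
    using interval_decomposition_exists[OF K V] len by auto
  then show ?thesis
    unfolding multiplicity_def by (rule_tac the_equality) (use count in auto)
qed

section \<open>Additivity and transfer of \<open>bar_dim\<close>\<close>

lemma (in vectorspace) bar_dim_submodules:
  assumes L: "submodule K L V" "submodule K L' V" and R: "submodule K R V" "submodule K R' V"
    and le: "L' \<subseteq> L" "R' \<subseteq> R"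
  shows "submodule K (span (L' \<inter> R \<union> L \<inter> R')) V" "span (L' \<inter> R \<union> L \<inter> R') \<subseteq> L \<inter> R"
proof -
  show "submodule K (span (L' \<inter> R \<union> L \<inter> R')) V"
    by (rule span_is_submodule) (use submodule_subset[OF R(1)] submodule_subset[OF L(1)] in blast)
  show "span (L' \<inter> R \<union> L \<inter> R') \<subseteq> L \<inter> R"
    by (rule span_least[OF submodule_Int[OF L(1) R(1)]]) (use le in blast)
qed

text \<open>The first summand is the quotient of \<open>L \<inter> R\<close> by \<open>P\<close>.
  The second is \<open>P / N\<close>: by the second isomorphism theorem it is
  \<open>L'' \<inter> R\<close> modulo its intersection with \<open>N\<close>, and the modular law
  computes that intersection.\<close>

lemma bar_dim_add:
  assumes W: "vectorspace K W"
    and L: "submodule K L W" "submodule K L'' W" "submodule K L' W"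
    and R: "submodule K R W" "submodule K R' W"
    and le: "L' \<subseteq> L''" "L'' \<subseteq> L" "R' \<subseteq> R"
  shows "bar_dim K W L L' R R' = bar_dim K W L L'' R R' + bar_dim K W L'' L' R R'"
proof -
  interpret vectorspace K W by (rule W)
  define N where "N = span (L' \<inter> R \<union> L \<inter> R')"
  define P where "P = span (L'' \<inter> R \<union> L \<inter> R')"
  note sub = submodule_subset[OF L(1)] submodule_subset[OF L(2)] submodule_subset[OF R(1)]
  have N: "submodule K N W" and P: "submodule K P W" "P \<subseteq> L \<inter> R"
    using bar_dim_submodules[OF L(1,3) R] bar_dim_submodules[OF L(1,2) R] le
    by (auto simp: N_def P_def)
  have A: "submodule K (L'' \<inter> R) W" by (rule submodule_Int[OF L(2) R(1)])
  have NP: "N \<subseteq> P" unfolding N_def P_def by (rule span_is_monotone) (use le in blast)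
  have "P = span ((L'' \<inter> R) \<union> N)"
  proof
    have "N \<subseteq> carrier W" by (rule submodule_subset[OF N])
    then have c: "(L'' \<inter> R) \<union> N \<subseteq> carrier W" using sub by blast
    have "L' \<inter> R \<union> L \<inter> R' \<subseteq> N" unfolding N_def by (rule in_own_span) (use sub le in blast)
    then show "P \<subseteq> span ((L'' \<inter> R) \<union> N)" unfolding P_def by (intro span_is_monotone) blast
    have "L'' \<inter> R \<union> L \<inter> R' \<subseteq> P" unfolding P_def by (rule in_own_span) (use sub le in blast)
    then show "span ((L'' \<inter> R) \<union> N) \<subseteq> P" by (intro span_least[OF P(1)]) (use NP in blast)
  qed
  then have "rdim N P = rdim (L'' \<inter> R \<inter> N) (L'' \<inter> R)" using rdim_second_iso[OF A N] by simp
  also have "L'' \<inter> R \<inter> N = span (L' \<inter> R \<union> L'' \<inter> R')"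
  proof
    show "L'' \<inter> R \<inter> N \<subseteq> span (L' \<inter> R \<union> L'' \<inter> R')"
    proof
      fix x assume x: "x \<in> L'' \<inter> R \<inter> N"
      have c: "L \<inter> R' \<subseteq> carrier W" "L'' \<inter> R' \<subseteq> carrier W" "L' \<inter> R \<subseteq> carrier W" using sub le by blast+
      obtain u w where uw: "u \<in> L' \<inter> R" "w \<in> L \<inter> R'" "x = u \<oplus>\<^bsub>W\<^esub> w"
        using span_Un_decomp[OF submodule_Int[OF L(3) R(1)] c(1), of x] x
          span_of_submodule[OF submodule_Int[OF L(1) R(2)]] by (auto simp: N_def)
      have uc: "u \<in> carrier W" "w \<in> carrier W" using uw c by blast+
      \<comment> \<open>\<open>x\<close> and \<open>u\<close> lie in \<open>L''\<close>, hence so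
        does \<open>w\<close>, which a priori is only known to lie in \<open>L\<close>.\<close>
      have "x \<ominus>\<^bsub>W\<^esub> u = w"
        unfolding uw(3) using add_minus_cancel'[OF uc(2,1)] by (simp only: M.a_comm[OF uc])
      moreover have "x \<ominus>\<^bsub>W\<^esub> u \<in> L''" by (rule submodule_minus[OF L(2)]) (use x uw le in blast)+
      ultimately have w: "w \<in> span (L'' \<inter> R')"
        using uw(2) span_of_submodule[OF submodule_Int[OF L(2) R(2)]] by simp
      show "x \<in> span (L' \<inter> R \<union> L'' \<inter> R')"
        unfolding uw(3) by (rule span_Un_comp[OF submodule_Int[OF L(3) R(1)] c(2) uw(1) w])
    qed
    show "span (L' \<inter> R \<union> L'' \<inter> R') \<subseteq> L'' \<inter> R \<inter> N"
    proof (rule span_least[OF submodule_Int[OF A N]])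
      have "L' \<inter> R \<union> L \<inter> R' \<subseteq> N" unfolding N_def by (rule in_own_span) (use sub le in blast)
      then show "L' \<inter> R \<union> L'' \<inter> R' \<subseteq> L'' \<inter> R \<inter> N" using le by blast
    qed
  qed
  finally have "rdim N P = bar_dim K W L'' L' R R'" by (simp add: bar_dim_def)
  then show ?thesis
    using rdim_add[OF P(1) submodule_Int[OF L(1) R(1)] NP P(2)]
    by (simp add: bar_dim_def N_def P_def add.commute)
qed

text \<open>Modelled on the homology of \<open>X\<^sub>b\<^sup>b\<close>,
  \<open>X\<^sub>p\<^sup>b\<close>, \<open>X\<^sub>b\<^sup>c\<close> and
  \<open>X\<^sub>p\<^sup>c\<close>; \<open>exact\<close> is the Mayer-Vietoris property at
  \<open>b\<close>.\<close>

locale exact_square =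
  b: linear_map K B PB b_pb + c: linear_map K B BC b_bc +
  p: linear_map K PB PC p_pc + q: linear_map K BC PC b_pc
  for K :: "'k ring" and B :: "('k, 'v) module" and PB :: "('k, 'v) module"
    and BC :: "('k, 'v) module" and PC :: "('k, 'v) module" and b_pb b_bc p_pc b_pc +
  assumes square: "x \<in> carrier B \<Longrightarrow> p_pc (b_pb x) = b_pc (b_bc x)"
    and exact: "\<lbrakk>u \<in> carrier PB; w \<in> carrier BC; p_pc u = b_pc w\<rbrakk>
      \<Longrightarrow> \<exists>x\<in>carrier B. b_pb x = u \<and> b_bc x = w"
begin

text \<open>By exactness \<open>b_pc\<close> maps the intersections in \<open>BC\<close> onto those
  in \<open>PC\<close>, and its kernel consists of images of vectors of \<open>B\<close> that vanish
  in \<open>PB\<close>. These images lie in the lower step \<open>L'\<close>, so the map loses no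
  dimension of the subquotient.\<close>

lemma bar_dim_transfer:
  assumes f: "linear_map K P PB f" and g: "linear_map K C BC g"
    and U: "submodule K U P" "submodule K U' P" "U' \<subseteq> U"
    and S: "submodule K S C" "submodule K S' C" "S' \<subseteq> S"
  defines "pb \<equiv> \<lambda>W. {x \<in> carrier B. b_pb x \<in> f ` W}"
  shows "bar_dim K BC (b_bc ` pb U) (b_bc ` pb U') (g ` S) (g ` S')
    = bar_dim K PC ((\<lambda>z. p_pc (f z)) ` U) ((\<lambda>z. p_pc (f z)) ` U')
        ((\<lambda>w. b_pc (g w)) ` S) ((\<lambda>w. b_pc (g w)) ` S')"
proof -
  interpret f: linear_map K P PB f by (rule f)
  interpret g: linear_map K C BC g by (rule g)
  have pbs: "submodule K (b_bc ` pb W) BC" if "submodule K W P" for W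
    unfolding pb_def
    by (rule c.image_submodule, rule b.vimage_submodule[OF b.V.submodule_carrier f.image_submodule[OF that]])
  \<comment> \<open>A vector in both images on the right comes from vectors of \<open>PB\<close> and
    \<open>BC\<close> that agree in \<open>PC\<close>, and exactness lifts this pair to
    \<open>B\<close>.\<close>
  have image: "b_pc ` (b_bc ` pb W \<inter> g ` Q) = (\<lambda>z. p_pc (f z)) ` W \<inter> (\<lambda>w. b_pc (g w)) ` Q"
    if W: "W \<subseteq> carrier P" and Q: "Q \<subseteq> carrier C" for W Q
  proof
    show "b_pc ` (b_bc ` pb W \<inter> g ` Q) \<subseteq> (\<lambda>z. p_pc (f z)) ` W \<inter> (\<lambda>w. b_pc (g w)) ` Q"
    proof
      fix y assume "y \<in> b_pc ` (b_bc ` pb W \<inter> g ` Q)"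
      then obtain x w where xw: "x \<in> pb W" "w \<in> Q" "b_bc x = g w" "y = b_pc (b_bc x)" by auto
      then obtain z where "z \<in> W" "b_pb x = f z" "x \<in> carrier B" by (auto simp: pb_def)
      then have "y = p_pc (f z)" using square[of x] xw(4) by simp
      moreover have "y = b_pc (g w)" using xw by simp
      ultimately show "y \<in> (\<lambda>z. p_pc (f z)) ` W \<inter> (\<lambda>w. b_pc (g w)) ` Q"
        using \<open>z \<in> W\<close> xw(2) by blast
    qed
    show "(\<lambda>z. p_pc (f z)) ` W \<inter> (\<lambda>w. b_pc (g w)) ` Q \<subseteq> b_pc ` (b_bc ` pb W \<inter> g ` Q)"
    proof
      fix y assume "y \<in> (\<lambda>z. p_pc (f z)) ` W \<inter> (\<lambda>w. b_pc (g w)) ` Q"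
      then obtain z w where zw: "z \<in> W" "w \<in> Q" "y = p_pc (f z)" "y = b_pc (g w)" by auto
      have "f z \<in> carrier PB" "g w \<in> carrier BC" using zw W Q by auto
      then obtain x where "x \<in> carrier B" "b_pb x = f z" "b_bc x = g w"
        using exact[of "f z" "g w"] zw by auto
      then show "y \<in> b_pc ` (b_bc ` pb W \<inter> g ` Q)" using zw by (force simp: pb_def)
    qed
  qed
  have Uc: "U \<subseteq> carrier P" "U' \<subseteq> carrier P" "S \<subseteq> carrier C" "S' \<subseteq> carrier C"
    using f.V.submodule_subset g.V.submodule_subset U S by auto
  have pbm: "pb U' \<subseteq> pb U" using U(3) by (auto simp: pb_def)
  define L where "L = b_bc ` pb U"
  define L' where "L' = b_bc ` pb U'"
  define R where "R = g ` S"
  define R' where "R' = g ` S'"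
  define N where "N = module.span K BC (L' \<inter> R \<union> L \<inter> R')"
  have Ls: "submodule K L BC" "submodule K L' BC" "submodule K R BC" "submodule K R' BC"
    using pbs U S g.image_submodule by (auto simp: L_def L'_def R_def R'_def)
  have le: "L' \<subseteq> L" "R' \<subseteq> R" using pbm S(3) by (auto simp: L_def L'_def R_def R'_def)
  have N: "submodule K N BC" "N \<subseteq> L \<inter> R"
    using c.W.bar_dim_submodules[OF Ls le] by (auto simp: N_def)
  have NM: "L' \<inter> R \<union> L \<inter> R' \<subseteq> carrier BC" using c.W.submodule_subset Ls by auto
  have "b_pc ` N = module.span K PC (b_pc ` (L' \<inter> R \<union> L \<inter> R'))"
    unfolding N_def using q.span_image[OF NM] by simp
  also have "b_pc ` (L' \<inter> R \<union> L \<inter> R') = (\<lambda>z. p_pc (f z)) ` U' \<inter> (\<lambda>w. b_pc (g w)) ` S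
      \<union> (\<lambda>z. p_pc (f z)) ` U \<inter> (\<lambda>w. b_pc (g w)) ` S'"
    using image Uc by (simp add: image_Un L_def L'_def R_def R'_def)
  finally have N': "module.span K PC ((\<lambda>z. p_pc (f z)) ` U' \<inter> (\<lambda>w. b_pc (g w)) ` S
      \<union> (\<lambda>z. p_pc (f z)) ` U \<inter> (\<lambda>w. b_pc (g w)) ` S') = b_pc ` N" by simp
  have M': "b_pc ` (L \<inter> R) = (\<lambda>z. p_pc (f z)) ` U \<inter> (\<lambda>w. b_pc (g w)) ` S"
    using image Uc by (simp add: L_def R_def)
  have "{x \<in> L \<inter> R. b_pc x \<in> b_pc ` N} = N"
  proof
    show "N \<subseteq> {x \<in> L \<inter> R. b_pc x \<in> b_pc ` N}" using N by auto
    show "{x \<in> L \<inter> R. b_pc x \<in> b_pc ` N} \<subseteq> N"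
    proof
      fix u assume "u \<in> {x \<in> L \<inter> R. b_pc x \<in> b_pc ` N}"
      then obtain n where u: "u \<in> L" "u \<in> R" and n: "n \<in> N" "b_pc u = b_pc n" by auto
      have uc: "u \<in> carrier BC" "n \<in> carrier BC"
        using u n c.W.submodule_subset[OF Ls(1)] c.W.submodule_subset[OF N(1)] by auto
      define v where "v = u \<ominus>\<^bsub>BC\<^esub> n"
      have vc: "v \<in> carrier BC"
        unfolding v_def by (rule c.W.submodule_minus[OF c.W.submodule_carrier uc])
      \<comment> \<open>A kernel vector agrees in \<open>PC\<close> with the zero of
        \<open>PB\<close>, so it comes from a vector of \<open>B\<close> that dies in
        \<open>PB\<close>.\<close>
      have "b_pc v = \<zero>\<^bsub>PC\<^esub>" using uc n(2) by (simp add: v_def)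
      then obtain x where x: "x \<in> carrier B" "b_pb x = \<zero>\<^bsub>PB\<^esub>" "b_bc x = v"
        using exact[of "\<zero>\<^bsub>PB\<^esub>" v] vc by auto
      have "\<zero>\<^bsub>PB\<^esub> \<in> f ` U'"
        by (rule b.W.submodule_zero[OF f.image_submodule[OF U(2)]])
      then have "x \<in> pb U'" using x by (simp add: pb_def)
      then have "v \<in> L'" using x(3) by (auto simp: L'_def)
      moreover have "v \<in> R"
        unfolding v_def by (rule c.W.submodule_minus[OF Ls(3) u(2)]) (use n N in blast)
      ultimately have "v \<in> N" unfolding N_def using c.W.module.in_own_span[OF NM] by blast
      then have "n \<oplus>\<^bsub>BC\<^esub> v \<in> N" by (rule c.W.submodule_add[OF N(1) n(1)])
      then show "u \<in> N" unfolding v_def by (simp only: c.W.add_minus_cancel[OF uc])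
    qed
  qed
  moreover have "vectorspace.rdim K BC {x \<in> L \<inter> R. b_pc x \<in> b_pc ` N} (L \<inter> R) = vectorspace.rdim K PC (b_pc ` N) (b_pc ` (L \<inter> R))"
    by (rule q.rdim_image[OF c.W.submodule_Int[OF Ls(1,3)] q.image_submodule[OF N(1)]])
      (use N(2) in blast)
  ultimately show ?thesis
    unfolding bar_dim_def N' M'[symmetric] by (simp add: N_def L_def L'_def R_def R'_def)
qed

end

section \<open>Mayer--Vietoris exactness at taut levelsets\<close>

context homology_theory
begin

abbreviation sub_homology :: "'u topology \<Rightarrow> int \<Rightarrow> 'u set \<Rightarrow> ('k, 'v) module" where
  "sub_homology X k S \<equiv> H k (subtopology X S) {}"

abbreviation incl :: "'u topology \<Rightarrow> int \<Rightarrow> 'u set \<Rightarrow> 'u set \<Rightarrow> 'v \<Rightarrow> 'v" where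
  "incl X k S T \<equiv> ind k (subtopology X S) {} (subtopology X T) {} id"

lemma continuous_map_subtopology_id: "S \<subseteq> T \<Longrightarrow> continuous_map (subtopology X S) (subtopology X T) id"
  by (auto simp: continuous_map_in_subtopology)

lemma incl_linear:
  "S \<subseteq> T \<Longrightarrow> linear_map K (sub_homology X k S) (sub_homology X k T) (incl X k S T)"
  by (rule ind_linear) (auto simp: continuous_map_subtopology_id)

lemma ind_id_comp:
  assumes "A \<subseteq> topspace X" "B \<subseteq> topspace Y" "C \<subseteq> topspace Z"
    and "continuous_map X Y id" "A \<subseteq> B" "continuous_map Y Z id" "B \<subseteq> C"
    and "x \<in> carrier (H k X A)"
  shows "ind k Y B Z C id (ind k X A Y B id x) = ind k X A Z C id x"
  using ind_comp[of A X B Y C Z id id x k] assms by simp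

lemma incl_comp:
  "S \<subseteq> T \<Longrightarrow> T \<subseteq> U \<Longrightarrow> x \<in> carrier (sub_homology X k S)
    \<Longrightarrow> incl X k T U (incl X k S T x) = incl X k S U x"
  by (rule ind_id_comp) (auto simp: continuous_map_subtopology_id)

text \<open>Exactness of the Mayer-Vietoris sequence at the sum of the homologies of
  \<open>A\<close> and \<open>B\<close>, namely the inclusion that functoriality does not
  supply.\<close>

definition mayer_vietoris :: "'u topology \<Rightarrow> int \<Rightarrow> 'u set \<Rightarrow> 'u set \<Rightarrow> bool" where
  "mayer_vietoris X k A B \<longleftrightarrow>
     (\<forall>\<alpha>\<in>carrier (sub_homology X k A). \<forall>\<beta>\<in>carrier (sub_homology X k B).
        incl X k A (A \<union> B) \<alpha> = incl X k B (A \<union> B) \<beta> \<longrightarrow>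
        (\<exists>\<gamma>\<in>carrier (sub_homology X k (A \<inter> B)).
           incl X k (A \<inter> B) A \<gamma> = \<alpha> \<and> incl X k (A \<inter> B) B \<gamma> = \<beta>))"

lemma mayer_vietoris_commute: "mayer_vietoris X k A B \<Longrightarrow> mayer_vietoris X k B A"
  unfolding mayer_vietoris_def by (metis Int_commute Un_commute)

text \<open>A chase through the long exact sequences of \<open>(A, A \<inter> B)\<close> and
  \<open>(A \<union> B, B)\<close>: injectivity of the excision map in degree \<open>k\<close> lifts
  \<open>\<alpha>\<close> to the intersection, and surjectivity in degree \<open>k + 1\<close>
  corrects the lift.\<close>

lemma excisive_mayer_vietoris:
  assumes sub: "A \<subseteq> topspace X" "B \<subseteq> topspace X"
    and iso: "\<And>k. linear_iso K (H k (subtopology X A) (A \<inter> B)) (H k (subtopology X (A \<union> B)) B)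
      (ind k (subtopology X A) (A \<inter> B) (subtopology X (A \<union> B)) B id)"
  shows "mayer_vietoris X k A B"
  unfolding mayer_vietoris_def
proof (intro ballI impI)
  define C where "C = A \<inter> B"
  define U where "U = A \<union> B"
  have inc: "C \<subseteq> A" "C \<subseteq> B" "A \<subseteq> U" "B \<subseteq> U" by (auto simp: C_def U_def)
  have top: "topspace (subtopology X A) = A" "topspace (subtopology X B) = B"
    "topspace (subtopology X U) = U" "topspace (subtopology X C) = C"
    using sub by (auto simp: C_def U_def)
  have sX: "C \<subseteq> topspace X" "U \<subseteq> topspace X" using sub by (auto simp: C_def U_def)
  have ss: "subtopology (subtopology X A) C = subtopology X C"
    "subtopology (subtopology X U) B = subtopology X B"
    using inc by (simp_all add: subtopology_subtopology Int_absorb1)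
  define E where "E n = ind n (subtopology X A) C (subtopology X U) B id" for n
  have E: "linear_iso K (H n (subtopology X A) C) (H n (subtopology X U) B) (E n)" for n
    using iso unfolding E_def C_def U_def by simp
  fix \<alpha> \<beta> assume a: "\<alpha> \<in> carrier (sub_homology X k A)" and b: "\<beta> \<in> carrier (sub_homology X k B)"
    and "incl X k A (A \<union> B) \<alpha> = incl X k B (A \<union> B) \<beta>"
  then have ab: "incl X k A U \<alpha> = incl X k B U \<beta>" by (simp add: U_def)
  interpret CA: linear_map K "sub_homology X k C" "sub_homology X k A" "incl X k C A"
    by (rule incl_linear[OF inc(1)])
  interpret CB: linear_map K "sub_homology X k C" "sub_homology X k B" "incl X k C B"
    by (rule incl_linear[OF inc(2)])
  interpret AU: linear_map K "sub_homology X k A" "sub_homology X k U" "incl X k A U"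
    by (rule incl_linear[OF inc(3)])
  interpret BU: linear_map K "sub_homology X k B" "sub_homology X k U" "incl X k B U"
    by (rule incl_linear[OF inc(4)])
  interpret E: linear_map K "H k (subtopology X A) C" "H k (subtopology X U) B" "E k"
    using E by (simp add: linear_iso_def)
  interpret jA: linear_map K "sub_homology X k A" "H k (subtopology X A) C"
    "ind k (subtopology X A) {} (subtopology X A) C id"
    by (rule ind_linear) (use inc top sX sub in auto)
  have exA: "incl X k C A ` carrier (sub_homology X k C)
      = {v \<in> carrier (sub_homology X k A).
          ind k (subtopology X A) {} (subtopology X A) C id v = \<zero>\<^bsub>H k (subtopology X A) C\<^esub>}"
    using exact_space[of C "subtopology X A" k] inc sX sub top by (simp add: exact_at_def ss)
  have exU: "incl X k B U ` carrier (sub_homology X k B)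
      = {v \<in> carrier (sub_homology X k U).
          ind k (subtopology X U) {} (subtopology X U) B id v = \<zero>\<^bsub>H k (subtopology X U) B\<^esub>}"
    using exact_space[of B "subtopology X U" k] inc sX sub top by (simp add: exact_at_def ss)
  have exA': "bd (k + 1) (subtopology X A) C ` carrier (H (k + 1) (subtopology X A) C)
      = {v \<in> carrier (sub_homology X k C). incl X k C A v = \<zero>\<^bsub>sub_homology X k A\<^esub>}"
    using exact_subspace[of C "subtopology X A" "k + 1"] inc sX sub top by (simp add: exact_at_def ss)
  have exU': "bd (k + 1) (subtopology X U) B ` carrier (H (k + 1) (subtopology X U) B)
      = {v \<in> carrier (sub_homology X k B). incl X k B U v = \<zero>\<^bsub>sub_homology X k U\<^esub>}"
    using exact_subspace[of B "subtopology X U" "k + 1"] inc sX sub top by (simp add: exact_at_def ss)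
  \<comment> \<open>The image of \<open>\<alpha>\<close> in the homology of \<open>(U, B)\<close>
    vanishes, since in \<open>U\<close> the class equals one that comes from
    \<open>B\<close>.\<close>
  define j\<alpha> where "j\<alpha> = ind k (subtopology X A) {} (subtopology X A) C id \<alpha>"
  have jc: "j\<alpha> \<in> carrier (H k (subtopology X A) C)" using a by (simp add: j\<alpha>_def)
  have "E k j\<alpha> = ind k (subtopology X A) {} (subtopology X U) B id \<alpha>"
    unfolding E_def j\<alpha>_def
    by (rule ind_id_comp) (use a inc top sX sub continuous_map_subtopology_id[OF inc(3)] in auto)
  also have "\<dots> = ind k (subtopology X U) {} (subtopology X U) B id (incl X k A U \<alpha>)"
    by (rule ind_id_comp[symmetric]) (use a inc top sX sub continuous_map_subtopology_id[OF inc(3)] in auto)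
  also have "\<dots> = \<zero>\<^bsub>H k (subtopology X U) B\<^esub>" using exU b unfolding ab by blast
  finally have "E k j\<alpha> = E k \<zero>\<^bsub>H k (subtopology X A) C\<^esub>" by simp
  moreover have "inj_on (E k) (carrier (H k (subtopology X A) C))"
    using E[of k] by (simp add: linear_iso_def bij_betw_def)
  ultimately have "j\<alpha> = \<zero>\<^bsub>H k (subtopology X A) C\<^esub>"
    using inj_onD[of "E k" _ j\<alpha> "\<zero>\<^bsub>H k (subtopology X A) C\<^esub>"] jc by simp
  then have "\<alpha> \<in> incl X k C A ` carrier (sub_homology X k C)" using exA a by (simp add: j\<alpha>_def)
  then obtain g0 where g0: "g0 \<in> carrier (sub_homology X k C)" "incl X k C A g0 = \<alpha>" by auto
  \<comment> \<open>\<open>g0\<close> need not restrict to \<open>\<beta>\<close> on \<open>B\<close>, but the error \<open>b'\<close> dies in \<open>A \<union> B\<close> and is therefore a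
    boundary, by excision the boundary of a class of \<open>(A, A \<inter> B)\<close>.\<close>
  define b' where "b' = \<beta> \<ominus>\<^bsub>sub_homology X k B\<^esub> incl X k C B g0"
  have g0B: "incl X k C B g0 \<in> carrier (sub_homology X k B)" using g0(1) by simp
  have b'c: "b' \<in> carrier (sub_homology X k B)"
    unfolding b'_def by (rule CB.W.submodule_minus[OF CB.W.submodule_carrier b g0B])
  have "incl X k B U (incl X k C B g0) = incl X k A U (incl X k C A g0)"
    using incl_comp[OF inc(2,4) g0(1)] incl_comp[OF inc(1,3) g0(1)] by simp
  then have "incl X k B U b' = \<zero>\<^bsub>sub_homology X k U\<^esub>"
    using b g0B g0(2) ab by (simp add: b'_def)
  then have "b' \<in> bd (k + 1) (subtopology X U) B ` carrier (H (k + 1) (subtopology X U) B)"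
    using exU' b'c by simp
  moreover have "carrier (H (k + 1) (subtopology X U) B) = E (k + 1) ` carrier (H (k + 1) (subtopology X A) C)"
    using E[of "k + 1"] by (simp add: linear_iso_def bij_betw_def)
  ultimately obtain d where d: "d \<in> carrier (H (k + 1) (subtopology X A) C)"
    "b' = bd (k + 1) (subtopology X U) B (E (k + 1) d)" by auto
  define g1 where "g1 = bd (k + 1) (subtopology X A) C d"
  have g1: "g1 \<in> carrier (sub_homology X k C)" "incl X k C A g1 = \<zero>\<^bsub>sub_homology X k A\<^esub>"
    using exA' d(1) unfolding g1_def by blast+
  have "b' = incl X k C B g1"
    using bd_natural[of C "subtopology X A" B "subtopology X U" id d "k + 1"] d inc top sX sub
      continuous_map_subtopology_id[OF inc(3)] by (simp add: E_def g1_def ss)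
  then have "incl X k C B (g0 \<oplus>\<^bsub>sub_homology X k C\<^esub> g1) = \<beta>"
    using g0(1) g1(1) CB.W.add_minus_cancel[OF b g0B] by (simp add: b'_def)
  moreover have "incl X k C A (g0 \<oplus>\<^bsub>sub_homology X k C\<^esub> g1) = \<alpha>"
    using g0 g1 a by simp
  ultimately show "\<exists>\<gamma>\<in>carrier (sub_homology X k (A \<inter> B)).
      incl X k (A \<inter> B) A \<gamma> = \<alpha> \<and> incl X k (A \<inter> B) B \<gamma> = \<beta>"
    using g0(1) g1(1) unfolding C_def[symmetric]
    by (intro bexI[of _ "g0 \<oplus>\<^bsub>sub_homology X k C\<^esub> g1"]) auto
qed

text \<open>The slice from \<open>a\<close> to \<open>b\<close> is closed, and by the strict
  inequalities the open set where \<open>f\<close> lies strictly between \<open>a\<close> and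
  \<open>b\<close> contains the levelset at \<open>t\<close>. So the slice is a normal
  neighbourhood, and \<open>t\<close> cuts it into the two slices of the claim.\<close>

lemma taut_mayer_vietoris:
  assumes f: "continuous_map X euclideanreal f" and taut: "levelset_taut K H ind X f t"
    and ab: "a < ereal t" "ereal t < b"
  shows "mayer_vietoris X k (slice X f a (ereal t)) (slice X f (ereal t) b)"
proof (rule excisive_mayer_vietoris)
  let ?t = "ereal t" and ?U = "slice X f a b"
  \<comment> \<open>Reading \<open>f\<close> in the extended reals treats finite and infinite ends
    alike.\<close>
  have cont: "continuous_map X euclidean (\<lambda>x. ereal (f x))"
    using continuous_map_compose[OF f, of euclidean ereal] by (simp add: comp_def continuous_on_ereal)
  define W where "W = {x \<in> topspace X. ereal (f x) \<in> {a<..<b}}"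
  have "openin X W"
    unfolding W_def by (rule openin_continuous_map_preimage[OF cont]) simp
  moreover have "?U = {x \<in> topspace X. ereal (f x) \<in> {a..b}}" by (auto simp: slice_def)
  then have "closedin X ?U"
    using closedin_continuous_map_preimage[OF cont, of "{a..b}"] by simp
  moreover have "slice X f ?t ?t \<subseteq> W" using ab by (auto simp: slice_def W_def)
  moreover have "W \<subseteq> ?U" by (auto simp: slice_def W_def)
  ultimately have "normal_neighbourhood X (slice X f ?t ?t) ?U"
    unfolding normal_neighbourhood_def slice_def by blast
  then have iso: "linear_iso K (H k (subtopology X (?U \<inter> slice X f (-\<infinity>) ?t)) (slice X f ?t ?t))
      (H k (subtopology X ?U) (?U \<inter> slice X f ?t \<infinity>))
      (ind k (subtopology X (?U \<inter> slice X f (-\<infinity>) ?t)) (slice X f ?t ?t)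
        (subtopology X ?U) (?U \<inter> slice X f ?t \<infinity>) id)" for k
    using taut unfolding levelset_taut_def Let_def by blast
  have "y \<le> b" if "y \<le> ?t" for y using ab(2) that by (meson less_imp_le order_trans)
  moreover have "a \<le> y" if "?t \<le> y" for y using ab(1) that by (meson less_imp_le order_trans)
  ultimately have "?U \<inter> slice X f (-\<infinity>) ?t = slice X f a ?t" "?U \<inter> slice X f ?t \<infinity> = slice X f ?t b"
    "slice X f a ?t \<inter> slice X f ?t b = slice X f ?t ?t"
    "slice X f a ?t \<union> slice X f ?t b = ?U"
    by (auto simp: slice_def simp del: ereal_less_eq(3))
  with iso show "linear_iso K
      (H k (subtopology X (slice X f a ?t)) (slice X f a ?t \<inter> slice X f ?t b))
      (H k (subtopology X (slice X f a ?t \<union> slice X f ?t b)) (slice X f ?t b))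
      (ind k (subtopology X (slice X f a ?t)) (slice X f a ?t \<inter> slice X f ?t b)
        (subtopology X (slice X f a ?t \<union> slice X f ?t b)) (slice X f ?t b) id)" for k
    by simp
qed (auto simp: slice_def)

end

section \<open>Additivity\<close>

context homology_theory
begin

definition births_hi :: "bool \<Rightarrow> 'u topology \<Rightarrow> int \<Rightarrow> 'u set \<Rightarrow> 'u set \<Rightarrow> 'v set" where
  "births_hi e X k Y Z = birth_hi e (sub_homology X k Y) (sub_homology X k Z) (incl X k Z Y)"

definition births_lo :: "bool \<Rightarrow> 'u topology \<Rightarrow> int \<Rightarrow> 'u set \<Rightarrow> 'u set \<Rightarrow> 'u set \<Rightarrow> 'v set" where
  "births_lo e X k A Y Z =
     birth_lo e (sub_homology X k A) (sub_homology X k Z) (incl X k A Y) (incl X k Z Y)"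

lemma births_submodule:
  assumes "A \<subseteq> Y" "Z \<subseteq> Y"
  shows "submodule K (births_hi e X k Y Z) (sub_homology X k Z)"
    and "submodule K (births_lo e X k A Y Z) (sub_homology X k Z)"
    and "births_lo e X k A Y Z \<subseteq> births_hi e X k Y Z"
proof -
  interpret g: linear_map K "sub_homology X k A" "sub_homology X k Y" "incl X k A Y"
    by (rule incl_linear[OF assms(1)])
  interpret h: linear_map K "sub_homology X k Z" "sub_homology X k Y" "incl X k Z Y"
    by (rule incl_linear[OF assms(2)])
  show "submodule K (births_hi e X k Y Z) (sub_homology X k Z)"
    using h.vimage_submodule[OF h.V.submodule_carrier g.W.submodule_zero_set] h.V.submodule_carrier
    by (simp add: births_hi_def birth_hi_def)
  show "submodule K (births_lo e X k A Y Z) (sub_homology X k Z)"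
    using h.vimage_submodule[OF h.V.submodule_carrier g.image_submodule[OF g.V.submodule_carrier]]
      h.V.submodule_zero_set
    by (simp add: births_lo_def birth_lo_def)
  show "births_lo e X k A Y Z \<subseteq> births_hi e X k Y Z"
    by (auto simp: births_lo_def birth_lo_def births_hi_def birth_hi_def)
qed

text \<open>The arguments are the seven nodes as sets rather than four numbers, so that reading the
  zigzag backwards is a permutation of the arguments.\<close>

definition rect_dim ::
  "'u topology \<Rightarrow> int \<Rightarrow> bool \<Rightarrow> bool \<Rightarrow> 'u set \<Rightarrow> 'u set \<Rightarrow> 'u set \<Rightarrow> 'u set \<Rightarrow> 'u set \<Rightarrow> 'u set \<Rightarrow> 'u set \<Rightarrow> enat"
  where
  "rect_dim X k e e' A AB B BC C CD D = bar_dim K (sub_homology X k BC)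
     (incl X k B BC ` births_hi e X k AB B) (incl X k B BC ` births_lo e X k A AB B)
     (incl X k C BC ` births_hi e' X k CD C) (incl X k C BC ` births_lo e' X k D CD C)"

lemma rect_dim_flip: "rect_dim X k e e' A AB B BC C CD D = rect_dim X k e' e D CD C BC B AB A"
  unfolding rect_dim_def by (rule bar_dim_commute)

lemma mayer_vietorisE:
  assumes "mayer_vietoris X k A B" "A \<inter> B = C" "A \<union> B = U"
    and "\<alpha> \<in> carrier (sub_homology X k A)" "\<beta> \<in> carrier (sub_homology X k B)"
    and "incl X k A U \<alpha> = incl X k B U \<beta>"
  obtains \<gamma> where "\<gamma> \<in> carrier (sub_homology X k C)" "incl X k C A \<gamma> = \<alpha>" "incl X k C B \<gamma> = \<beta>"
  using assms unfolding mayer_vietoris_def by blast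

text \<open>The first two identities are exactness at \<open>p\<close>: a class of \<open>B\<close>
  that dies in \<open>AB\<close>, or agrees there with one of \<open>A\<close>, is matched in
  \<open>PB\<close> by a class of \<open>P\<close> with the prescribed image in \<open>AP\<close>.
  The last two identify the step at which the filtrations for \<open>[a, p]\<close> and
  \<open>[p, b]\<close> meet.\<close>

lemma births_pullback:
  assumes mv: "mayer_vietoris X k AP PB" and P: "AP \<inter> PB = P" and AB: "AP \<union> PB = AB"
    and A: "A \<subseteq> AP" and B: "B \<subseteq> PB"
  defines "pb \<equiv> \<lambda>W. {x \<in> carrier (sub_homology X k B). incl X k B PB x \<in> incl X k P PB ` W}"
  shows "births_hi False X k AB B = pb (births_hi False X k AP P)"
    and "births_lo True X k A AB B = pb (births_lo True X k A AP P)"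
    and "births_hi False X k PB B = pb (births_lo False X k A AP P)"
    and "births_lo True X k P PB B = pb (births_hi True X k AP P)"
proof -
  have sub: "P \<subseteq> AP" "P \<subseteq> PB" "AP \<subseteq> AB" "PB \<subseteq> AB" "B \<subseteq> AB" "P \<subseteq> AB" "A \<subseteq> AB"
    using P AB A B by auto
  interpret pa: linear_map K "sub_homology X k P" "sub_homology X k AP" "incl X k P AP"
    by (rule incl_linear[OF sub(1)])
  interpret pp: linear_map K "sub_homology X k P" "sub_homology X k PB" "incl X k P PB"
    by (rule incl_linear[OF sub(2)])
  interpret ab: linear_map K "sub_homology X k AP" "sub_homology X k AB" "incl X k AP AB"
    by (rule incl_linear[OF sub(3)])
  interpret bp: linear_map K "sub_homology X k B" "sub_homology X k PB" "incl X k B PB"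
    by (rule incl_linear[OF B])
  interpret aa: linear_map K "sub_homology X k A" "sub_homology X k AP" "incl X k A AP"
    by (rule incl_linear[OF A])
  have push: "incl X k B AB x = incl X k AP AB (incl X k P AP z)"
    if "x \<in> carrier (sub_homology X k B)" "z \<in> carrier (sub_homology X k P)"
      "incl X k B PB x = incl X k P PB z" for x z
    using incl_comp[OF B sub(4) that(1)] incl_comp[OF sub(2,4) that(2)]
      incl_comp[OF sub(1,3) that(2)] that(3) by simp
  have pull: "\<exists>z\<in>carrier (sub_homology X k P). incl X k P AP z = a \<and> incl X k P PB z = incl X k B PB x"
    if "x \<in> carrier (sub_homology X k B)" "a \<in> carrier (sub_homology X k AP)"
      "incl X k B AB x = incl X k AP AB a" for x a
  proof -
    have "incl X k AP AB a = incl X k PB AB (incl X k B PB x)"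
      using incl_comp[OF B sub(4) that(1)] that(3) by simp
    with mv P AB that(2) bp.T_im[OF that(1)] show ?thesis by (rule mayer_vietorisE) blast
  qed
  show "births_hi False X k AB B = pb (births_hi False X k AP P)"
  proof
    show "births_hi False X k AB B \<subseteq> pb (births_hi False X k AP P)"
    proof
      fix x assume "x \<in> births_hi False X k AB B"
      then have x: "x \<in> carrier (sub_homology X k B)" "incl X k B AB x = \<zero>\<^bsub>sub_homology X k AB\<^esub>"
        by (auto simp: births_hi_def birth_hi_def)
      then obtain z where "z \<in> carrier (sub_homology X k P)"
        "incl X k P AP z = \<zero>\<^bsub>sub_homology X k AP\<^esub>" "incl X k P PB z = incl X k B PB x"
        using pull[OF x(1), of "\<zero>\<^bsub>sub_homology X k AP\<^esub>"] by auto
      then show "x \<in> pb (births_hi False X k AP P)"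
        using x(1) by (force simp: pb_def births_hi_def birth_hi_def)
    qed
    show "pb (births_hi False X k AP P) \<subseteq> births_hi False X k AB B"
      using push by (auto simp: pb_def births_hi_def birth_hi_def)
  qed
  show "births_lo True X k A AB B = pb (births_lo True X k A AP P)"
  proof
    show "births_lo True X k A AB B \<subseteq> pb (births_lo True X k A AP P)"
    proof
      fix x assume "x \<in> births_lo True X k A AB B"
      then obtain v where x: "x \<in> carrier (sub_homology X k B)" and v: "v \<in> carrier (sub_homology X k A)"
        and xv: "incl X k B AB x = incl X k A AB v"
        by (auto simp: births_lo_def birth_lo_def)
      then have "incl X k B AB x = incl X k AP AB (incl X k A AP v)"
        using incl_comp[OF A sub(3) v] by simp
      then obtain z where "z \<in> carrier (sub_homology X k P)"
        "incl X k P AP z = incl X k A AP v" "incl X k P PB z = incl X k B PB x"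
        using pull[OF x aa.T_im[OF v]] by auto
      then show "x \<in> pb (births_lo True X k A AP P)"
        using x v by (force simp: pb_def births_lo_def birth_lo_def)
    qed
    show "pb (births_lo True X k A AP P) \<subseteq> births_lo True X k A AB B"
    proof
      fix x assume "x \<in> pb (births_lo True X k A AP P)"
      then obtain z v where x: "x \<in> carrier (sub_homology X k B)" and z: "z \<in> carrier (sub_homology X k P)"
        and v: "v \<in> carrier (sub_homology X k A)"
        and e: "incl X k B PB x = incl X k P PB z" "incl X k P AP z = incl X k A AP v"
        by (auto simp: pb_def births_lo_def birth_lo_def)
      have "incl X k B AB x = incl X k A AB v"
        using push[OF x z e(1)] e(2) incl_comp[OF A sub(3) v] by simp
      then show "x \<in> births_lo True X k A AB B" using x v by (auto simp: births_lo_def birth_lo_def)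
    qed
  qed
  show "births_hi False X k PB B = pb (births_lo False X k A AP P)"
    by (auto simp: pb_def births_hi_def birth_hi_def births_lo_def birth_lo_def)
  show "births_lo True X k P PB B = pb (births_hi True X k AP P)"
    by (auto simp: pb_def births_hi_def birth_hi_def births_lo_def birth_lo_def)
qed

text \<open>\<open>mv1\<close> is exactness at \<open>p\<close> and writes the steps of
  \<open>[a, b]\<close> as pullbacks from \<open>P\<close>; \<open>mv2\<close> is exactness at
  \<open>b\<close> and moves the piece of \<open>[a, p]\<close> from \<open>BC\<close> to
  \<open>PC\<close>.\<close>

lemma rect_dim_split:
  assumes mv1: "mayer_vietoris X k AP PB" and P: "AP \<inter> PB = P" and AB: "AP \<union> PB = AB"
    and mv2: "mayer_vietoris X k PB BC" and B: "PB \<inter> BC = B" and PC: "PB \<union> BC = PC"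
    and A: "A \<subseteq> AP" and C: "C \<subseteq> BC" "C \<subseteq> CD" "D \<subseteq> CD"
  shows "rect_dim X k e e' A AB B BC C CD D
    = rect_dim X k e e' A AP P PC C CD D + rect_dim X k e e' P PB B BC C CD D"
proof -
  have sub: "B \<subseteq> PB" "B \<subseteq> BC" "PB \<subseteq> PC" "BC \<subseteq> PC" "P \<subseteq> PB" "P \<subseteq> PC" "C \<subseteq> PC"
    "P \<subseteq> AP" "B \<subseteq> AB" "A \<subseteq> AB" using P AB B PC A C by auto
  interpret sq: exact_square K "sub_homology X k B" "sub_homology X k PB" "sub_homology X k BC"
    "sub_homology X k PC" "incl X k B PB" "incl X k B BC" "incl X k PB PC" "incl X k BC PC"
  proof (intro exact_square.intro exact_square_axioms.intro incl_linear sub)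
    show "incl X k PB PC (incl X k B PB x) = incl X k BC PC (incl X k B BC x)"
      if "x \<in> carrier (sub_homology X k B)" for x
      using incl_comp[OF sub(1,3) that] incl_comp[OF sub(2,4) that] by simp
    show "\<exists>x\<in>carrier (sub_homology X k B). incl X k B PB x = u \<and> incl X k B BC x = w"
      if "u \<in> carrier (sub_homology X k PB)" "w \<in> carrier (sub_homology X k BC)"
        "incl X k PB PC u = incl X k BC PC w" for u w
      using mv2 B PC that by (rule mayer_vietorisE) blast
  qed
  interpret cb: linear_map K "sub_homology X k C" "sub_homology X k BC" "incl X k C BC"
    by (rule incl_linear[OF C(1)])
  define pb where "pb W = {x \<in> carrier (sub_homology X k B). incl X k B PB x \<in> incl X k P PB ` W}" for W
  note pull = births_pullback[OF mv1 P AB A sub(1), folded pb_def]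
  note bP = births_submodule[OF A sub(8), of e X k]
  note bAB = births_submodule[OF sub(10,9), of e X k]
  note bPB = births_submodule[OF sub(5,1), of e X k]
  note bC = births_submodule[OF C(3,2), of e' X k]
  have Pcar: "births_hi e X k AP P \<subseteq> carrier (sub_homology X k P)"
    "births_lo e X k A AP P \<subseteq> carrier (sub_homology X k P)"
    "births_hi e' X k CD C \<subseteq> carrier (sub_homology X k C)"
    "births_lo e' X k D CD C \<subseteq> carrier (sub_homology X k C)"
    using bP bC by (simp_all add: submodule_def)
  have comp: "(\<lambda>z. incl X k PB PC (incl X k P PB z)) ` W = incl X k P PC ` W"
    if "W \<subseteq> carrier (sub_homology X k P)" for W
    using that incl_comp[OF sub(5,3)] by (intro image_cong) auto
  have compC: "(\<lambda>z. incl X k BC PC (incl X k C BC z)) ` W = incl X k C PC ` W"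
    if "W \<subseteq> carrier (sub_homology X k C)" for W
    using that incl_comp[OF C(1) sub(4)] by (intro image_cong) auto
  let ?R = "incl X k C BC ` births_hi e' X k CD C"
  let ?R' = "incl X k C BC ` births_lo e' X k D CD C"
  let ?i = "incl X k B BC"
  have transfer: "bar_dim K (sub_homology X k BC) (?i ` pb (births_hi e X k AP P))
      (?i ` pb (births_lo e X k A AP P)) ?R ?R' = rect_dim X k e e' A AP P PC C CD D"
    unfolding rect_dim_def
    using sq.bar_dim_transfer[OF incl_linear[OF sub(5)] incl_linear[OF C(1)] bP bC]
    by (simp add: comp compC Pcar pb_def)
  have R: "submodule K ?R (sub_homology X k BC)" "submodule K ?R' (sub_homology X k BC)" "?R' \<subseteq> ?R"
    using cb.image_submodule bC by auto
  have W: "vectorspace K (sub_homology X k BC)" by (rule space) simp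
  note im = bAB(1,2)[THEN sq.c.image_submodule] bPB(1,2)[THEN sq.c.image_submodule]
  show ?thesis
  proof (cases e)
    case False
    \<comment> \<open>The lower step is zero and the upper one is the kernel of \<open>B\<close> in
      \<open>AB\<close>. The kernel of \<open>B\<close> in \<open>PB\<close> lies between them, and
      the upper piece belongs to \<open>[a, p]\<close>.\<close>
    have lo: "births_lo e X k A AB B = births_lo e X k P PB B"
      using False by (simp add: births_lo_def birth_lo_def)
    have le: "births_lo e X k P PB B \<subseteq> births_hi e X k PB B" "births_hi e X k PB B \<subseteq> births_hi e X k AB B"
      using bPB(3) bP(3) False pull(1,3) by (auto simp: pb_def)
    have "bar_dim K (sub_homology X k BC) (?i ` births_hi e X k AB B) (?i ` births_lo e X k P PB B) ?R ?R'
      = bar_dim K (sub_homology X k BC) (?i ` births_hi e X k AB B) (?i ` births_hi e X k PB B) ?R ?R'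
      + bar_dim K (sub_homology X k BC) (?i ` births_hi e X k PB B) (?i ` births_lo e X k P PB B) ?R ?R'"
      by (rule bar_dim_add[OF W im(1,3,4) R(1,2) image_mono[OF le(1)] image_mono[OF le(2)] R(3)])
    then show ?thesis
      using transfer False pull(1,3) lo unfolding rect_dim_def by simp
  next
    case True
    \<comment> \<open>The upper step is everything, and the intermediate one consists of the classes
      of \<open>B\<close> that come from \<open>P\<close> in \<open>PB\<close>. Now it is the lower
      piece that belongs to \<open>[a, p]\<close>.\<close>
    have hi: "births_hi e X k AB B = births_hi e X k PB B"
      using True by (simp add: births_hi_def birth_hi_def)
    have le: "births_lo e X k A AB B \<subseteq> births_lo e X k P PB B" "births_lo e X k P PB B \<subseteq> births_hi e X k PB B"
      using bPB(3) bP(3) True pull(2,4) by (auto simp: pb_def)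
    have "bar_dim K (sub_homology X k BC) (?i ` births_hi e X k PB B) (?i ` births_lo e X k A AB B) ?R ?R'
      = bar_dim K (sub_homology X k BC) (?i ` births_hi e X k PB B) (?i ` births_lo e X k P PB B) ?R ?R'
      + bar_dim K (sub_homology X k BC) (?i ` births_lo e X k P PB B) (?i ` births_lo e X k A AB B) ?R ?R'"
      by (rule bar_dim_add[OF W im(3,4,2) R(1,2) image_mono[OF le(1)] image_mono[OF le(2)] R(3)])
    then show ?thesis
      using transfer True pull(2,4) hi unfolding rect_dim_def by (simp add: add.commute)
  qed
qed

lemma levelset_multiplicity:
  assumes "a \<le> b" "b \<le> c" "c \<le> d"
  shows "multiplicity K (levelset_zigzag H ind k X f a b c d) (if e then 2 else 3) (if e' then 6 else 5)
    = rect_dim X k e e' (slice X f a a) (slice X f a b) (slice X f b b) (slice X f b c)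
        (slice X f c c) (slice X f c d) (slice X f d d)"
proof -
  have len: "zz_len (levelset_zigzag H ind k X f a b c d) = 7"
    "zz_fwd (levelset_zigzag H ind k X f a b c d) = odd"
    by (simp_all add: levelset_zigzag_def Let_def)
  show ?thesis
    unfolding multiplicity_eq_bar_dim[OF field levelset_zigzag_module[OF assms] len]
    by (simp add: levelset_zigzag_def Let_def levelset_node_def arrow_src_def arrow_tgt_def
        rect_dim_def births_hi_def births_lo_def)
qed

theorem multiplicity_additive:
  fixes a p b c q d :: ereal and e e' :: bool and k :: int
  assumes f: "continuous_map X euclideanreal f"
    and taut: "\<And>t. levelset_taut K H ind X f t"
    and lt: "a < p" "p < b" "b < c" "c < q" "q < d"
  defines "m \<equiv> \<lambda>a b c d. multiplicity K (levelset_zigzag H ind k X f a b c d)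
    (if e then 2 else 3) (if e' then 6 else 5)"
  shows "m a b c d = m a p c d + m p b c d" "m a b c d = m a b c q + m a b q d"
proof -
  \<comment> \<open>A number strictly between two extended reals is finite, so tautness is available
    at it.\<close>
  have mv: "mayer_vietoris X k (slice X f x y) (slice X f y z)" if xyz: "x < y" "y < z" for x y z
  proof -
    obtain t where "y = ereal t" using xyz by (cases y) auto
    then show ?thesis using taut_mayer_vietoris[OF f taut] xyz by simp
  qed
  have slice: "slice X f x y \<inter> slice X f y z = slice X f y y"
    "slice X f x y \<union> slice X f y z = slice X f x z" if "x < y" "y < z" for x y z
    using that by (auto simp: slice_def intro: order_trans less_imp_le)
  have sub: "slice X f x x \<subseteq> slice X f x y" "slice X f y y \<subseteq> slice X f x y" if "x < y" for x y
    using that by (auto simp: slice_def intro: order_trans less_imp_le)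
  have ord: "a < b" "p < c" "b < q" "c < d" using lt by auto
  show "m a b c d = m a p c d + m p b c d"
    using lt ord unfolding m_def
    by (simp add: levelset_multiplicity less_imp_le)
      (intro rect_dim_split mv slice sub lt ord)
  have flip: "slice X f y z \<inter> slice X f x y = slice X f y y"
    "slice X f y z \<union> slice X f x y = slice X f x z" if "x < y" "y < z" for x y z
    using slice[OF that] by (auto simp: Int_commute Un_commute)
  \<comment> \<open>The zigzag is read from the right: \<open>d\<close>, \<open>q\<close>,
    \<open>c\<close>, \<open>b\<close>, \<open>a\<close> take the places of \<open>a\<close>,
    \<open>p\<close>, \<open>b\<close>, \<open>c\<close>, \<open>d\<close>.\<close>
  have "m a b c d = m a b q d + m a b c q"
    using lt ord unfolding m_def
    by (simp add: levelset_multiplicity less_imp_le rect_dim_flip[of X k e e'])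
      (intro rect_dim_split mayer_vietoris_commute[OF mv] flip sub lt ord)
  then show "m a b c d = m a b c q + m a b q d" by (simp add: add.commute)
qed

end

theorem theorem3p8:
  fixes K :: "'k ring"
    and H :: "int \<Rightarrow> 'u topology \<Rightarrow> 'u set \<Rightarrow> ('k, 'v) module"
    and ind :: "int \<Rightarrow> 'u topology \<Rightarrow> 'u set \<Rightarrow> 'u topology \<Rightarrow> 'u set \<Rightarrow> ('u \<Rightarrow> 'u) \<Rightarrow> 'v \<Rightarrow> 'v"
    and bd :: "int \<Rightarrow> 'u topology \<Rightarrow> 'u set \<Rightarrow> 'v \<Rightarrow> 'v"
    and j :: int
    and X :: "'u topology"
    and f :: "'u \<Rightarrow> real"
    and \<mu> :: "ereal \<Rightarrow> ereal \<Rightarrow> ereal \<Rightarrow> ereal \<Rightarrow> enat"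
    and a p b c q d :: ereal
  assumes "homology_theory K H ind bd"
    and "continuous_map X euclideanreal f"
    and "\<And>t :: real. levelset_taut K H ind X f t"
    and "\<mu> \<in> {mu_sb K H ind j X f, mu_bb K H ind j X f, mu_ss K H ind j X f, mu_bs K H ind j X f}"
    and "a < p" "p < b" "b < c" "c < q" "q < d"
  shows "\<mu> a b c d = \<mu> a p c d + \<mu> p b c d \<and> \<mu> a b c d = \<mu> a b c q + \<mu> a b q d"
proof -
  \<comment> \<open>\<open>e\<close> selects intervals that begin at node 2 instead of 3, and
    \<open>e'\<close> those that end at node 6 instead of 5; the four superscripts are the four
    combinations.\<close>
  define M where "M e e' = (\<lambda>a b c d. multiplicity K (levelset_zigzag H ind j X f a b c d)
      (if e then 2 else 3) (if e' then 6 else 5))" for e e' :: bool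
  have "mu_sb K H ind j X f = M False False" "mu_bb K H ind j X f = M True False"
    "mu_ss K H ind j X f = M False True" "mu_bs K H ind j X f = M True True"
    by (simp_all add: fun_eq_iff M_def mu_sb_def mu_bb_def mu_ss_def mu_bs_def)
  then have "\<exists>e e'. \<mu> = M e e'" using assms(4) by auto
  then obtain e e' where "\<mu> = M e e'" by blast
  then show ?thesis
    using homology_theory.multiplicity_additive[OF assms(1-3,5-9), of j e e'] by (simp add: M_def)
qed

end
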